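(* There exist universal constants $C_1, C_2>0$ such that for all integers $n\ge 2$ and $1\le k<n$ there is a randomized linear sketching scheme for vectors in $\mathbb{R}^n$, consisting of a random matrix $\Phi$ with $O(k\log n)$ rows (whose distribution does not depend on the input) and a recovery procedure $\mathcal{R}$, with the following properties. For every $\mathbf{x}\in\mathbb{R}^n$, the vector $\hat{\mathbf{x}}=\mathcal{R}(\Phi\mathbf{x})$ satisfies $$\Pr\Big[\|\hat{\mathbf{x}}-\mathbf{x}\|_\infty \le \frac{C_1}{\sqrt{k}}\cdot\min_{\beta\in\mathbb{R}}\mathrm{err}_2^k(\mathbf{x}-\beta)\Big]\ge 1-\frac{C_2}{n}.$$ Moreover, the sketch $\Phi\mathbf{x}$ can be computed in time $O(n\log n)$, its size is $O(k\log n)$, and the recovery can be computed in time $O(n\log n)$.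
   Context: For $\mathbf{x}\in\mathbb{R}^n$ and $\beta\in\mathbb{R}$, $\mathbf{x}-\beta=(x_1-\beta,\dots,x_n-\beta)$. A vector is $k$-sparse if it has at most $k$ nonzero coordinates. $\mathrm{err}_p^k(\mathbf{x})=\min_{k\text{-sparse }\mathbf{x}'}\|\mathbf{x}-\mathbf{x}'\|_p$, i.e. the $\ell_p$-norm of $\mathbf{x}$ after zeroing out its $k$ coordinates of largest absolute value. The probability is over the randomness of the scheme. *)

theory Defs
  imports
    "HOL-Probability.Probability"
    "HOL-Library.Log_Nat"
    "Jordan_Normal_Form.Matrix"
begin

unbundle no vec_syntax

section \<open>Norms and the error of the best sparse approximation\<close>

definition lp_norm :: "real \<Rightarrow> real vec \<Rightarrow> real" where
  "lp_norm p x = (\<Sum>i<dim_vec x. \<bar>x $ i\<bar> powr p) powr (1 / p)"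

text \<open>Only used for vectors of positive dimension.\<close>

definition linf_norm :: "real vec \<Rightarrow> real" where
  "linf_norm x = Max ((\<lambda>i. \<bar>x $ i\<bar>) ` {..<dim_vec x})"

definition k_sparse :: "nat \<Rightarrow> real vec \<Rightarrow> bool" where
  "k_sparse k x \<longleftrightarrow> card {i. i < dim_vec x \<and> x $ i \<noteq> 0} \<le> k"

text \<open>The infimum is a minimum, see \<open>err_attained\<close> below.\<close>

definition err :: "real \<Rightarrow> nat \<Rightarrow> real vec \<Rightarrow> real" where
  "err p k x = (INF x' \<in> {x' \<in> carrier_vec (dim_vec x). k_sparse k x'}. lp_norm p (x - x'))"

definition shift_vec :: "real vec \<Rightarrow> real \<Rightarrow> real vec" where
  "shift_vec x \<beta> = map_vec (\<lambda>t. t - \<beta>) x"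

text \<open>Again the infimum is a minimum for \<open>p = 2\<close>, see \<open>bias_err_attained\<close> below.\<close>

definition bias_err :: "real \<Rightarrow> nat \<Rightarrow> real vec \<Rightarrow> real" where
  "bias_err p k x = (INF \<beta>. err p k (shift_vec x \<beta>))"


section \<open>A real RAM with words of logarithmic length\<close>

text \<open>
  Running times refer to the following machine. It has integer registers and arrays, whose
  cells hold words in \<open>{..<W}\<close>, and real registers and arrays, whose cells hold exact real
  numbers. Arrays are indexed by words, so that a program, which mentions finitely many array names,
  has access to finitely many arrays of length \<open>W\<close>. There is no conversion between words and
  reals (in particular no floor function), and real constants in programs are natural numbers, so that
  no information can be hidden in a real number.
  Every operation on words or reals, memory access, comparison, constant and command costs one
  time unit.
\<close>

type_synonym name = string

datatype iexp =
    IConst nat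
  | IVar name
  | IArr name iexp
  | IAdd iexp iexp
  | ISub iexp iexp
  | IMul iexp iexp
  | IDiv iexp iexp
  | IMod iexp iexp

datatype rexp =
    RConst nat
  | RVar name
  | RArr name iexp
  | RAdd rexp rexp
  | RSub rexp rexp
  | RMul rexp rexp
  | RDiv rexp rexp

datatype bexp =
    ILess iexp iexp
  | RLess rexp rexp
  | BNot bexp
  | BAnd bexp bexp

datatype com =
    Skip
  | IAssign name iexp
  | RAssign name rexp
  | IStore name iexp iexp
  | RStore name iexp rexp
  | Seq com com
  | Cond bexp com com
  | While bexp com

record state =
  ivar :: "name \<Rightarrow> nat"
  iarr :: "name \<Rightarrow> nat \<Rightarrow> nat"
  rvar :: "name \<Rightarrow> real"
  rarr :: "name \<Rightarrow> nat \<Rightarrow> real"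

text \<open>
  Word arithmetic is modulo \<open>W\<close>, except that subtraction is truncated at \<open>0\<close>.
  Division by zero yields \<open>0\<close>, and \<open>a mod 0 = a\<close>.
\<close>

fun ival :: "nat \<Rightarrow> iexp \<Rightarrow> state \<Rightarrow> nat" where
  "ival W (IConst c) s = c mod W"
| "ival W (IVar v) s = ivar s v"
| "ival W (IArr a e) s = iarr s a (ival W e s)"
| "ival W (IAdd e f) s = (ival W e s + ival W f s) mod W"
| "ival W (ISub e f) s = ival W e s - ival W f s"
| "ival W (IMul e f) s = (ival W e s * ival W f s) mod W"
| "ival W (IDiv e f) s = ival W e s div ival W f s"
| "ival W (IMod e f) s = ival W e s mod ival W f s"

fun rval :: "nat \<Rightarrow> rexp \<Rightarrow> state \<Rightarrow> real" where
  "rval W (RConst c) s = real c"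
| "rval W (RVar v) s = rvar s v"
| "rval W (RArr a e) s = rarr s a (ival W e s)"
| "rval W (RAdd e f) s = rval W e s + rval W f s"
| "rval W (RSub e f) s = rval W e s - rval W f s"
| "rval W (RMul e f) s = rval W e s * rval W f s"
| "rval W (RDiv e f) s = rval W e s / rval W f s"

fun bval :: "nat \<Rightarrow> bexp \<Rightarrow> state \<Rightarrow> bool" where
  "bval W (ILess e f) s \<longleftrightarrow> ival W e s < ival W f s"
| "bval W (RLess e f) s \<longleftrightarrow> rval W e s < rval W f s"
| "bval W (BNot b) s \<longleftrightarrow> \<not> bval W b s"
| "bval W (BAnd b c) s \<longleftrightarrow> bval W b s \<and> bval W c s"

fun icost :: "iexp \<Rightarrow> nat" where
  "icost (IConst c) = 1"
| "icost (IVar v) = 1"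
| "icost (IArr a e) = 1 + icost e"
| "icost (IAdd e f) = 1 + icost e + icost f"
| "icost (ISub e f) = 1 + icost e + icost f"
| "icost (IMul e f) = 1 + icost e + icost f"
| "icost (IDiv e f) = 1 + icost e + icost f"
| "icost (IMod e f) = 1 + icost e + icost f"

fun rcost :: "rexp \<Rightarrow> nat" where
  "rcost (RConst c) = 1"
| "rcost (RVar v) = 1"
| "rcost (RArr a e) = 1 + icost e"
| "rcost (RAdd e f) = 1 + rcost e + rcost f"
| "rcost (RSub e f) = 1 + rcost e + rcost f"
| "rcost (RMul e f) = 1 + rcost e + rcost f"
| "rcost (RDiv e f) = 1 + rcost e + rcost f"

fun bcost :: "bexp \<Rightarrow> nat" where
  "bcost (ILess e f) = 1 + icost e + icost f"
| "bcost (RLess e f) = 1 + rcost e + rcost f"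
| "bcost (BNot b) = 1 + bcost b"
| "bcost (BAnd b c) = 1 + bcost b + bcost c"

text \<open>\<open>exec W P s t s'\<close>: with word range \<open>{..<W}\<close>, the program \<open>P\<close> started in \<open>s\<close>
  terminates in \<open>s'\<close> after \<open>t\<close> time units.\<close>

inductive exec :: "nat \<Rightarrow> com \<Rightarrow> state \<Rightarrow> nat \<Rightarrow> state \<Rightarrow> bool" for W :: nat where
  Skip: "exec W Skip s 1 s"
| IAssign: "exec W (IAssign v e) s (1 + icost e)
    (s\<lparr>ivar := (ivar s)(v := ival W e s)\<rparr>)"
| RAssign: "exec W (RAssign v e) s (1 + rcost e)
    (s\<lparr>rvar := (rvar s)(v := rval W e s)\<rparr>)"
| IStore: "exec W (IStore a i e) s (1 + icost i + icost e)
    (s\<lparr>iarr := (iarr s)(a := (iarr s a)(ival W i s := ival W e s))\<rparr>)"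
| RStore: "exec W (RStore a i e) s (1 + icost i + rcost e)
    (s\<lparr>rarr := (rarr s)(a := (rarr s a)(ival W i s := rval W e s))\<rparr>)"
| Seq: "exec W P s t s' \<Longrightarrow> exec W Q s' u s'' \<Longrightarrow> exec W (Seq P Q) s (1 + t + u) s''"
| CondTrue: "bval W b s \<Longrightarrow> exec W P s t s' \<Longrightarrow> exec W (Cond b P Q) s (1 + bcost b + t) s'"
| CondFalse: "\<not> bval W b s \<Longrightarrow> exec W Q s t s' \<Longrightarrow> exec W (Cond b P Q) s (1 + bcost b + t) s'"
| WhileFalse: "\<not> bval W b s \<Longrightarrow> exec W (While b P) s (1 + bcost b) s"
| WhileTrue: "bval W b s \<Longrightarrow> exec W P s t s' \<Longrightarrow> exec W (While b P) s' u s''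
    \<Longrightarrow> exec W (While b P) s (1 + bcost b + t + u) s''"


section \<open>Inputs, outputs and random seeds\<close>

text \<open>Words have \<open>c\<close> times as many bits as \<open>n\<close>; so \<open>n < word_range c n\<close> if \<open>c \<ge> 1\<close>, and
  \<open>word_range c n\<close> is polynomial in \<open>n\<close>.\<close>

definition word_range :: "nat \<Rightarrow> nat \<Rightarrow> nat" where
  "word_range c n = 2 ^ (c * floorlog 2 n)"

text \<open>The randomness is a table of independent uniformly distributed words. It is shared by the
  computation of the sketch and the recovery, which both can read it in the array \<open>rand\<close>.\<close>

definition seed_pmf :: "nat \<Rightarrow> (nat \<Rightarrow> nat) pmf" where
  "seed_pmf W = Pi_pmf {..<W} 0 (\<lambda>_. pmf_of_set {..<W})"

definition input_state :: "nat \<Rightarrow> nat \<Rightarrow> (nat \<Rightarrow> nat) \<Rightarrow> real vec \<Rightarrow> state" where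
  "input_state n k \<omega> v =
    \<lparr> ivar = (\<lambda>_. 0)(''n'' := n, ''k'' := k),
      iarr = (\<lambda>_ _. 0)(''rand'' := \<omega>),
      rvar = (\<lambda>_. 0),
      rarr = (\<lambda>_ _. 0)(''in'' := (\<lambda>i. if i < dim_vec v then v $ i else 0)) \<rparr>"

definition computes_within :: "nat \<Rightarrow> com \<Rightarrow> real \<Rightarrow> state \<Rightarrow> real vec \<Rightarrow> bool" where
  "computes_within W P T s v \<longleftrightarrow>
    (\<exists>t s'. exec W P s t s' \<and> real t \<le> T \<and> (\<forall>i<dim_vec v. rarr s' ''out'' i = v $ i))"


section \<open>The infima above are minima\<close>

definition zero_out :: "nat set \<Rightarrow> real vec \<Rightarrow> real vec" where
  "zero_out S x = vec (dim_vec x) (\<lambda>i. if i \<in> S then 0 else x $ i)"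

lemma lp_norm_nonneg: "lp_norm p x \<ge> 0"
  by (simp add: lp_norm_def)

lemma lp_norm_mono:
  assumes "p > 0" "dim_vec x = dim_vec y" "\<And>i. i < dim_vec x \<Longrightarrow> \<bar>x $ i\<bar> \<le> \<bar>y $ i\<bar>"
  shows "lp_norm p x \<le> lp_norm p y"
  unfolding lp_norm_def using assms
  by (auto intro!: powr_mono2 sum_mono sum_nonneg)

lemma zero_out_le_sparse:
  assumes "p > 0" "x' \<in> carrier_vec (dim_vec x)" "k_sparse k x'"
  shows "\<exists>S\<subseteq>{..<dim_vec x}. card S \<le> k \<and> lp_norm p (zero_out S x) \<le> lp_norm p (x - x')"
proof (intro exI conjI)
  let ?S = "{i. i < dim_vec x' \<and> x' $ i \<noteq> 0}"
  show "?S \<subseteq> {..<dim_vec x}" "card ?S \<le> k" using assms by (auto simp: k_sparse_def)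
  show "lp_norm p (zero_out ?S x) \<le> lp_norm p (x - x')"
    using assms by (intro lp_norm_mono) (auto simp: zero_out_def)
qed

lemma zero_out_sparse:
  assumes "S \<subseteq> {..<dim_vec x}" "card S \<le> k"
  shows "x - zero_out S x \<in> carrier_vec (dim_vec x)" "k_sparse k (x - zero_out S x)"
    "x - (x - zero_out S x) = zero_out S x"
proof -
  have "card {i. i < dim_vec x \<and> (x - zero_out S x) $ i \<noteq> 0} \<le> card S"
    using assms(1) finite_subset[OF assms(1)]
    by (intro card_mono) (auto simp: zero_out_def split: if_splits)
  then show "k_sparse k (x - zero_out S x)"
    using assms(2) by (simp add: k_sparse_def zero_out_def)
qed (auto simp: zero_out_def)

lemma err_le:
  assumes "x' \<in> carrier_vec (dim_vec x)" "k_sparse k x'"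
  shows "err p k x \<le> lp_norm p (x - x')"
  unfolding err_def using assms
  by (intro cINF_lower bdd_belowI2[where m=0]) (auto simp: lp_norm_nonneg)

lemma err_attained_zero_out:
  assumes "p > 0"
  shows "\<exists>S\<subseteq>{..<dim_vec x}. card S \<le> k \<and> err p k x = lp_norm p (zero_out S x)"
proof -
  let ?F = "{S. S \<subseteq> {..<dim_vec x} \<and> card S \<le> k}"
  have fin: "finite ?F" by (rule finite_subset[of _ "Pow {..<dim_vec x}"]) auto
  have ne: "?F \<noteq> {}" by (auto intro!: exI[of _ "{}"])
  obtain S where S: "S \<in> ?F" "\<And>S'. S' \<in> ?F \<Longrightarrow> lp_norm p (zero_out S x) \<le> lp_norm p (zero_out S' x)"
    using ex_is_arg_min_if_finite[OF fin ne, of "\<lambda>S. lp_norm p (zero_out S x)"]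
    by (auto simp: is_arg_min_linorder)
  have "err p k x \<le> lp_norm p (zero_out S x)"
    using err_le[of "x - zero_out S x" x k p] zero_out_sparse[of S x k] S(1) by simp
  moreover have "lp_norm p (zero_out S x) \<le> err p k x"
    unfolding err_def
  proof (rule cINF_greatest)
    show "{x' \<in> carrier_vec (dim_vec x). k_sparse k x'} \<noteq> {}"
      using zero_out_sparse[of S x k] S(1) by blast
    fix x' assume "x' \<in> {x' \<in> carrier_vec (dim_vec x). k_sparse k x'}"
    then obtain S' where "S' \<in> ?F" "lp_norm p (zero_out S' x) \<le> lp_norm p (x - x')"
      using zero_out_le_sparse[OF assms, of x' x k] by blast
    then show "lp_norm p (zero_out S x) \<le> lp_norm p (x - x')"
      using S(2)[of S'] by linarith
  qed
  ultimately have "err p k x = lp_norm p (zero_out S x)" by (rule antisym)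
  then show ?thesis using S(1) by blast
qed

lemma err_attained:
  assumes "p > 0"
  shows "\<exists>x'\<in>carrier_vec (dim_vec x). k_sparse k x' \<and> err p k x = lp_norm p (x - x')"
proof -
  obtain S where S: "S \<subseteq> {..<dim_vec x}" "card S \<le> k" "err p k x = lp_norm p (zero_out S x)"
    using err_attained_zero_out[OF assms, of x k] by blast
  show ?thesis
    using zero_out_sparse[OF S(1,2)] S(3) by (intro bexI[of _ "x - zero_out S x"] conjI) simp_all
qed

lemma err_le_zero_out:
  assumes "S \<subseteq> {..<dim_vec x}" "card S \<le> k"
  shows "err p k x \<le> lp_norm p (zero_out S x)"
  using err_le[of "x - zero_out S x" x k p] zero_out_sparse[OF assms] by simp

lemma sum_squares_mean:
  fixes x :: "nat \<Rightarrow> real"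
  assumes "finite A"
  shows "(\<Sum>i\<in>A. (x i - (\<Sum>j\<in>A. x j) / card A)\<^sup>2) \<le> (\<Sum>i\<in>A. (x i - \<beta>)\<^sup>2)"
proof (cases "A = {}")
  case False
  define \<mu> where "\<mu> = (\<Sum>j\<in>A. x j) / card A"
  have c: "real (card A) * \<mu> = (\<Sum>j\<in>A. x j)" using assms False by (simp add: \<mu>_def)
  have "(\<Sum>i\<in>A. (x i - \<beta>)\<^sup>2) = (\<Sum>i\<in>A. (x i - \<mu>)\<^sup>2 + (2 * (\<mu> - \<beta>) * (x i - \<mu>) + (\<mu> - \<beta>)\<^sup>2))"
    by (intro sum.cong) (auto simp: power2_eq_square algebra_simps)
  also have "\<dots> = (\<Sum>i\<in>A. (x i - \<mu>)\<^sup>2)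
      + (2 * (\<mu> - \<beta>) * ((\<Sum>i\<in>A. x i) - card A * \<mu>) + card A * (\<mu> - \<beta>)\<^sup>2)"
    by (simp add: sum.distrib sum_distrib_left[symmetric] sum_subtractf)
  finally show ?thesis using c by (simp add: \<mu>_def)
qed simp

lemma lp_norm_2_zero_out_shift:
  "lp_norm 2 (zero_out S (shift_vec x \<beta>)) = sqrt (\<Sum>i\<in>{..<dim_vec x} - S. (x $ i - \<beta>)\<^sup>2)"
proof -
  have "(\<Sum>i<dim_vec x. \<bar>zero_out S (shift_vec x \<beta>) $ i\<bar> powr 2)
      = (\<Sum>i<dim_vec x. if i \<in> S then 0 else (x $ i - \<beta>)\<^sup>2)"
    by (intro sum.cong) (auto simp: zero_out_def shift_vec_def)
  also have "\<dots> = (\<Sum>i\<in>{..<dim_vec x} - S. (x $ i - \<beta>)\<^sup>2)"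
    by (intro sum.mono_neutral_cong_right) auto
  finally show ?thesis
    by (simp add: lp_norm_def powr_half_sqrt sum_nonneg zero_out_def shift_vec_def)
qed

lemma bias_err_attained:
  "\<exists>\<beta>. bias_err 2 k x = err 2 k (shift_vec x \<beta>) \<and> (\<forall>\<beta>'. err 2 k (shift_vec x \<beta>) \<le> err 2 k (shift_vec x \<beta>'))"
proof -
  let ?F = "{S. S \<subseteq> {..<dim_vec x} \<and> card S \<le> k}"
  define \<mu> where "\<mu> S = (\<Sum>j\<in>{..<dim_vec x} - S. x $ j) / card ({..<dim_vec x} - S)" for S
  define g where "g S \<beta> = lp_norm 2 (zero_out S (shift_vec x \<beta>))" for S \<beta>
  have dim: "dim_vec (shift_vec x \<beta>) = dim_vec x" for \<beta> by (simp add: shift_vec_def)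
  have fin: "finite ?F" by (rule finite_subset[of _ "Pow {..<dim_vec x}"]) auto
  have ne: "?F \<noteq> {}" by (auto intro!: exI[of _ "{}"])
  obtain S where S: "S \<in> ?F" "\<And>S'. S' \<in> ?F \<Longrightarrow> g S (\<mu> S) \<le> g S' (\<mu> S')"
    using ex_is_arg_min_if_finite[OF fin ne, of "\<lambda>S. g S (\<mu> S)"]
    by (auto simp: is_arg_min_linorder)
  have min: "err 2 k (shift_vec x (\<mu> S)) \<le> err 2 k (shift_vec x \<beta>')" for \<beta>'
  proof -
    obtain S' where S': "S' \<in> ?F" "err 2 k (shift_vec x \<beta>') = g S' \<beta>'"
      using err_attained_zero_out[of 2 "shift_vec x \<beta>'" k] by (auto simp: dim g_def)
    have "err 2 k (shift_vec x (\<mu> S)) \<le> g S (\<mu> S)"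
      using err_le_zero_out[of S "shift_vec x (\<mu> S)" k 2] S(1) by (simp add: dim g_def)
    also have "\<dots> \<le> g S' (\<mu> S')" using S(2) S'(1) .
    also have "\<dots> \<le> g S' \<beta>'"
      unfolding g_def lp_norm_2_zero_out_shift \<mu>_def
      by (intro real_sqrt_le_mono sum_squares_mean) auto
    finally show ?thesis using S'(2) by simp
  qed
  then have "bias_err 2 k x = err 2 k (shift_vec x (\<mu> S))"
    unfolding bias_err_def
    by (intro antisym cINF_lower cINF_greatest bdd_belowI2[where m="err 2 k (shift_vec x (\<mu> S))"]) auto
  then show ?thesis using min by blast
qed

end

theory Submission
  imports Defs
begin

text \<open>
  With \<open>h = floorlog 2 n\<close>, the scheme is a Count-Sketch with \<open>2h\<close> rows of \<open>64k\<close> buckets, together with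
  \<open>2h\<close> randomly sampled coordinates of \<open>x\<close>. At most \<open>k\<close> coordinates are outliers, and few of the others
  are far from the optimal bias, so the median \<open>\<beta>\<close> of the samples misses that bias by \<open>O(E / \<surd>n)\<close>,
  where \<open>E\<close> is the optimal error. The buckets of the all-ones vector are known, hence \<open>\<beta>\<close> can be
  subtracted from the sketch, and the estimate of \<open>x\<^sub>i - \<beta>\<close> by one row has error \<open>O(E / \<surd>k)\<close> with
  probability \<open>15/16\<close>: no outlier collides with \<open>i\<close>, and the contribution of the remaining coordinates and
  that of the error in \<open>\<beta>\<close> are bounded by their second moments. The median over the rows then fails with
  probability at most \<open>4\<^sup>-\<^sup>h \<le> n\<^sup>-\<^sup>2\<close>.

  Computing \<open>n\<close> medians of \<open>2h\<close> numbers one by one would cost a sorting factor too much. Instead all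
  signed bucket values, at most \<open>n\<close> in number, are visited in increasing order by means of a
  tournament tree, and every visit increments a counter for each coordinate in the bucket. The estimate of a
  coordinate is the bucket value that makes its counter reach \<open>h\<close>. If there are more than \<open>n\<close> signed buckets,
  then \<open>n = O(k log n)\<close> and the identity matrix is used.
\<close>

section \<open>Independent words\<close>

text \<open>The sampled bias \<open>\<beta>\<close> is random, while second moments can be computed
  only for fixed vectors. The noise of \<open>x - \<beta>\<close> is therefore split into the noise
  of \<open>x - \<beta>'\<close>, with the optimal bias \<open>\<beta>'\<close>, and
  \<open>\<beta>' - \<beta>\<close> times the noise of the all-ones vector. The latter noise can be
  as large as \<open>sqrt (n / k)\<close>; this is exactly what an error of order
  \<open>E / sqrt n\<close> in the bias pays for. Both noises belong to fixed vectors, so a union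
  bound over the events "samples bad" and "rows bad" suffices, without conditioning on the samples.
  The constant 64 is dictated by the bound for medians: at least \<open>h\<close> of
  \<open>2 * h\<close> independent blocks fail with probability at most \<open>(4 * q) ^ h\<close>,
  so each block must fail with probability at most 1/16 to leave \<open>4 ^ h\<close> in the
  denominator. This covers a union bound over all \<open>n\<close> coordinates.\<close>

lemma prob_Pi_pmf_indep:
  fixes E F :: "('a \<Rightarrow> 'b) set"
  assumes "finite I" "K \<subseteq> I"
    and E: "\<And>\<omega> \<omega>'. (\<forall>a\<in>K. \<omega> a = \<omega>' a) \<Longrightarrow> \<omega> \<in> E \<longleftrightarrow> \<omega>' \<in> E"
    and F: "\<And>\<omega> \<omega>'. (\<forall>a. a \<notin> K \<longrightarrow> \<omega> a = \<omega>' a) \<Longrightarrow> \<omega> \<in> F \<longleftrightarrow> \<omega>' \<in> F"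
  shows "measure_pmf.prob (Pi_pmf I d p) (E \<inter> F)
    = measure_pmf.prob (Pi_pmf I d p) E * measure_pmf.prob (Pi_pmf I d p) F"
proof -
  define M where "M = Pi_pmf K d p"
  define N where "N = Pi_pmf (I - K) d p"
  define m where "m = (\<lambda>(f :: 'a \<Rightarrow> 'b, g) x. if x \<in> K then f x else g x)"
  have fin: "finite K" "finite (I - K)" using assms finite_subset by auto
  have I: "I = K \<union> (I - K)" using assms by auto
  have eq: "Pi_pmf I d p = map_pmf m (pair_pmf M N)"
    unfolding M_def N_def m_def by (subst I, subst Pi_pmf_union) (use fin in auto)
  have mE: "m (f, g) \<in> E \<longleftrightarrow> f \<in> E" for f g by (rule E) (simp add: m_def)
  have mF: "m (f, g) \<in> F \<longleftrightarrow> g \<in> F" for f g by (rule F) (simp add: m_def)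
  \<comment> \<open>Cutting both sets down to the supports makes them countable and changes no
    probability.\<close>
  have prod: "measure_pmf.prob (pair_pmf M N) (A \<times> B) = measure_pmf.prob M A * measure_pmf.prob N B" for A B
  proof -
    have "measure_pmf.prob (pair_pmf M N) (A \<times> B) = measure_pmf.prob (pair_pmf M N) ((A \<inter> set_pmf M) \<times> (B \<inter> set_pmf N))"
      by (intro measure_prob_cong_0) (auto simp: pmf_pair set_pmf_iff)
    also have "\<dots> = measure_pmf.prob M (A \<inter> set_pmf M) * measure_pmf.prob N (B \<inter> set_pmf N)"
      by (intro measure_pmf_prob_product) auto
    finally show ?thesis by (simp add: measure_Int_set_pmf)
  qed
  have v: "m -` (E \<inter> F) = E \<times> F" "m -` E = E \<times> UNIV" "m -` F = UNIV \<times> F"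
    using mE mF by auto
  show ?thesis unfolding eq using prod[of E F] prod[of E UNIV] prod[of UNIV F] v by simp
qed

lemma prob_Pi_pmf_Inter_blocks:
  fixes E :: "nat \<Rightarrow> ('a \<Rightarrow> 'b) set"
  assumes "finite I" "finite R" "\<And>r. r \<in> R \<Longrightarrow> K r \<subseteq> I"
    and disj: "\<And>r s. r \<in> R \<Longrightarrow> s \<in> R \<Longrightarrow> r \<noteq> s \<Longrightarrow> K r \<inter> K s = {}"
    and E: "\<And>r \<omega> \<omega>'. r \<in> R \<Longrightarrow> (\<forall>a\<in>K r. \<omega> a = \<omega>' a) \<Longrightarrow> \<omega> \<in> E r \<longleftrightarrow> \<omega>' \<in> E r"
    and q: "\<And>r. r \<in> R \<Longrightarrow> measure_pmf.prob (Pi_pmf I d p) (E r) \<le> q"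
  shows "measure_pmf.prob (Pi_pmf I d p) (\<Inter>r\<in>R. E r) \<le> q ^ card R"
  using assms(2-)
proof (induction R rule: finite_induct)
  case (insert r R)
  \<comment> \<open>The words in \<open>K r\<close> decide \<open>E r\<close>, and disjointness
    keeps the remaining events off \<open>K r\<close>.\<close>
  have "measure_pmf.prob (Pi_pmf I d p) (E r \<inter> (\<Inter>s\<in>R. E s))
      = measure_pmf.prob (Pi_pmf I d p) (E r) * measure_pmf.prob (Pi_pmf I d p) (\<Inter>s\<in>R. E s)"
  proof (rule prob_Pi_pmf_indep[where K = "K r"])
    fix \<omega> \<omega>' :: "'a \<Rightarrow> 'b" assume *: "\<forall>a. a \<notin> K r \<longrightarrow> \<omega> a = \<omega>' a"
    have "\<omega> \<in> E s \<longleftrightarrow> \<omega>' \<in> E s" if "s \<in> R" for s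
      using insert.prems(2)[of r s] insert.hyps that * by (intro insert.prems(3)) auto
    then show "\<omega> \<in> (\<Inter>s\<in>R. E s) \<longleftrightarrow> \<omega>' \<in> (\<Inter>s\<in>R. E s)" by auto
  next
    fix \<omega> \<omega>' :: "'a \<Rightarrow> 'b" assume "\<forall>a\<in>K r. \<omega> a = \<omega>' a"
    then show "\<omega> \<in> E r \<longleftrightarrow> \<omega>' \<in> E r" by (intro insert.prems(3)) auto
  qed (use assms(1) insert.prems(1) in auto)
  also have "\<dots> \<le> q * q ^ card R"
  proof (intro mult_mono)
    show "measure_pmf.prob (Pi_pmf I d p) (E r) \<le> q" using insert.prems(4) by simp
    show "measure_pmf.prob (Pi_pmf I d p) (\<Inter>s\<in>R. E s) \<le> q ^ card R"
    proof (rule insert.IH)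
      show "K s \<subseteq> I" if "s \<in> R" for s using insert.prems(1) that by auto
      show "K s \<inter> K t = {}" if "s \<in> R" "t \<in> R" "s \<noteq> t" for s t using insert.prems(2) that by auto
      show "\<omega> \<in> E s \<longleftrightarrow> \<omega>' \<in> E s" if "s \<in> R" "\<forall>a\<in>K s. \<omega> a = \<omega>' a" for s \<omega> \<omega>'
        using insert.prems(3)[of s] that by auto
      show "measure_pmf.prob (Pi_pmf I d p) (E s) \<le> q" if "s \<in> R" for s
        using insert.prems(4) that by auto
    qed
    show "0 \<le> q" using order_trans[OF measure_nonneg insert.prems(4)[of r]] by simp
  qed simp
  finally show ?case using insert.hyps by simp
qed simp

lemma choose_half_le: "(2 * h) choose h \<le> (4::nat) ^ h"
proof -
  have "(2 * h) choose h \<le> (\<Sum>i\<le>2*h. (2*h) choose i)" by (rule member_le_sum) auto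
  then show ?thesis by (simp add: choose_row_sum power_mult)
qed

text \<open>A Chernoff bound by a union bound over the \<open>h\<close>-subsets of bad blocks.\<close>

lemma prob_half_blocks_bad:
  fixes E :: "nat \<Rightarrow> ('a \<Rightarrow> 'b) set"
  assumes "finite I" "\<And>r. r < 2 * h \<Longrightarrow> K r \<subseteq> I"
    and "\<And>r s. r < 2 * h \<Longrightarrow> s < 2 * h \<Longrightarrow> r \<noteq> s \<Longrightarrow> K r \<inter> K s = {}"
    and "\<And>r \<omega> \<omega>'. r < 2 * h \<Longrightarrow> (\<forall>a\<in>K r. \<omega> a = \<omega>' a) \<Longrightarrow> \<omega> \<in> E r \<longleftrightarrow> \<omega>' \<in> E r"
    and "\<And>r. r < 2 * h \<Longrightarrow> measure_pmf.prob (Pi_pmf I d p) (E r) \<le> q" and "0 \<le> q"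
  shows "measure_pmf.prob (Pi_pmf I d p) {\<omega>. h \<le> card {r. r < 2 * h \<and> \<omega> \<in> E r}} \<le> (4 * q) ^ h"
proof -
  let ?P = "measure_pmf.prob (Pi_pmf I d p)"
  let ?F = "{R. R \<subseteq> {..<2 * h} \<and> card R = h}"
  have fin: "finite ?F" by (rule finite_subset[of _ "Pow {..<2 * h}"]) auto
  have "?P {\<omega>. h \<le> card {r. r < 2 * h \<and> \<omega> \<in> E r}} \<le> ?P (\<Union>R\<in>?F. \<Inter>r\<in>R. E r)"
  proof (rule measure_pmf.finite_measure_mono)
    show "{\<omega>. h \<le> card {r. r < 2 * h \<and> \<omega> \<in> E r}} \<subseteq> (\<Union>R\<in>?F. \<Inter>r\<in>R. E r)"
    proof
      fix \<omega> assume "\<omega> \<in> {\<omega>. h \<le> card {r. r < 2 * h \<and> \<omega> \<in> E r}}"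
      then have "h \<le> card {r. r < 2 * h \<and> \<omega> \<in> E r}" by simp
      then obtain R where "R \<subseteq> {r. r < 2 * h \<and> \<omega> \<in> E r}" "card R = h"
        by (rule obtain_subset_with_card_n)
      then show "\<omega> \<in> (\<Union>R\<in>?F. \<Inter>r\<in>R. E r)" by (intro UN_I[of R]) auto
    qed
  qed simp
  also have "\<dots> \<le> (\<Sum>R\<in>?F. ?P (\<Inter>r\<in>R. E r))"
    by (intro measure_pmf.finite_measure_subadditive_finite fin) auto
  also have "\<dots> \<le> (\<Sum>R\<in>?F. q ^ h)"
  proof (rule sum_mono)
    fix R assume R: "R \<in> ?F"
    then have lt: "r < 2 * h" if "r \<in> R" for r using that by auto
    have "?P (\<Inter>r\<in>R. E r) \<le> q ^ card R"
      by (rule prob_Pi_pmf_Inter_blocks[where K = K])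
        (use assms lt R finite_subset[of R "{..<2*h}"] in auto)
    then show "?P (\<Inter>r\<in>R. E r) \<le> q ^ h" using R by simp
  qed
  also have "\<dots> = real ((2 * h) choose h) * q ^ h"
    using n_subsets[of "{..<2*h}" h] by simp
  also have "\<dots> \<le> real (4 ^ h) * q ^ h"
    using choose_half_le[of h] \<open>0 \<le> q\<close> by (intro mult_right_mono) (auto simp del: of_nat_power simp: of_nat_le_iff)
  finally show ?thesis by (simp add: power_mult_distrib)
qed

text \<open>Redrawing one independent coordinate does not change the joint law. Expectations can
  thus be taken by averaging over a single word while all others stay fixed.\<close>

lemma Pi_pmf_resample:
  assumes "finite I" "a \<in> I"
  shows "Pi_pmf I d p = bind_pmf (Pi_pmf I d p) (\<lambda>\<omega>. map_pmf (\<lambda>y. (\<omega>)(a := y)) (p a))"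
proof -
  define Q where "Q = Pi_pmf (I - {a}) d p"
  have eq: "Pi_pmf I d p = bind_pmf (p a) (\<lambda>y. bind_pmf Q (\<lambda>f. return_pmf (f(a := y))))"
    using Pi_pmf_insert'[of "I - {a}" a d p] assms unfolding Q_def by (simp add: insert_absorb)
  \<comment> \<open>The value drawn first is overwritten. The equation is between functions of the
    new value because the resampling map eta-contracts to this form.\<close>
  have fun_upd_twice: "fun_upd (f(a := x)) a = fun_upd f a" for f :: "'a \<Rightarrow> 'b" and x
    by (intro ext) simp
  have "bind_pmf (Pi_pmf I d p) (\<lambda>\<omega>. map_pmf (\<lambda>y. (\<omega>)(a := y)) (p a))
      = bind_pmf (p a) (\<lambda>_. bind_pmf Q (\<lambda>f. map_pmf (\<lambda>y. f(a := y)) (p a)))"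
    by (simp add: eq bind_assoc_pmf bind_return_pmf fun_upd_twice)
  also have "\<dots> = bind_pmf Q (\<lambda>f. map_pmf (\<lambda>y. f(a := y)) (p a))" by simp
  also have "\<dots> = bind_pmf (p a) (\<lambda>y. bind_pmf Q (\<lambda>f. return_pmf (f(a := y))))"
    unfolding map_pmf_def by (rule bind_commute_pmf)
  finally show ?thesis by (simp add: eq)
qed

lemma expectation_Pi_pmf_resample:
  fixes X :: "('a \<Rightarrow> 'b) \<Rightarrow> real"
  assumes "finite I" "a \<in> I" "finite (set_pmf (Pi_pmf I d p))" "finite (set_pmf (p a))"
  shows "measure_pmf.expectation (Pi_pmf I d p) X
    = measure_pmf.expectation (Pi_pmf I d p) (\<lambda>\<omega>. measure_pmf.expectation (p a) (\<lambda>y. X ((\<omega>)(a := y))))"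
proof -
  let ?P = "Pi_pmf I d p"
  have "measure_pmf.expectation ?P X
      = measure_pmf.expectation (bind_pmf ?P (\<lambda>\<omega>. map_pmf (\<lambda>y. (\<omega>)(a := y)) (p a))) X"
    by (subst Pi_pmf_resample[OF assms(1,2)]) (rule refl)
  also have "\<dots> = (\<Sum>\<omega>\<in>set_pmf ?P. pmf ?P \<omega> *\<^sub>R
      measure_pmf.expectation (map_pmf (\<lambda>y. (\<omega>)(a := y)) (p a)) X)"
    by (rule pmf_expectation_bind) (use assms in auto)
  also have "\<dots> = measure_pmf.expectation ?P (\<lambda>\<omega>. measure_pmf.expectation (p a) (\<lambda>y. X ((\<omega>)(a := y))))"
    by (subst integral_measure_pmf[OF assms(3)]) (auto simp: mult.commute)
  finally show ?thesis .
qed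

text \<open>Markov's inequality with a strict threshold, which keeps it valid for
  \<open>D = 0\<close>: then the expectation vanishes and \<open>X\<close> is zero on the support.
  This case occurs when the shifted vector is exactly \<open>k\<close>-sparse.\<close>

lemma prob_gt_le_of_expectation:
  fixes X :: "'a \<Rightarrow> real"
  assumes "finite (set_pmf M)" "\<And>\<omega>. 0 \<le> X \<omega>" "measure_pmf.expectation M X \<le> q * D" "0 \<le> q" "0 \<le> D"
  shows "measure_pmf.prob M {\<omega>. D < X \<omega>} \<le> q"
proof (cases "D = 0")
  case True
  have int: "integrable (measure_pmf M) X" using assms(1) by (rule integrable_measure_pmf_finite)
  have "measure_pmf.expectation M X = 0"
    using assms True integral_nonneg_AE[of X "measure_pmf M"] by (simp add: order_antisym)
  then have "AE \<omega> in measure_pmf M. X \<omega> = 0"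
    using integral_nonneg_eq_0_iff_AE[OF int] assms(2) by simp
  then have "\<forall>\<omega>\<in>set_pmf M. X \<omega> = 0" by (simp add: AE_measure_pmf_iff)
  then have "measure_pmf.prob M {\<omega>. D < X \<omega>} = 0"
    using True by (auto simp: measure_pmf_zero_iff)
  then show ?thesis using assms by simp
next
  case False
  then have D: "D > 0" using assms by simp
  have "measure_pmf.prob M {\<omega>. D < X \<omega>} \<le> measure_pmf.prob M {\<omega>\<in>space M. D \<le> X \<omega>}"
    by (intro measure_pmf.finite_measure_mono) auto
  also have "\<dots> \<le> measure_pmf.expectation M X / D"
    by (rule integral_Markov_inequality_measure[where A="{}"])
      (use assms D in \<open>auto intro: integrable_measure_pmf_finite\<close>)
  also have "\<dots> \<le> q" using assms D by (simp add: divide_le_eq)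
  finally show ?thesis .
qed

section \<open>Buckets and signs read off one word\<close>

definition bucket_of :: "nat \<Rightarrow> nat \<Rightarrow> nat" where
  "bucket_of B w = (w div 2) mod B"

definition sign_of :: "nat \<Rightarrow> real" where
  "sign_of w = (if even w then 1 else - 1)"

lemma sign_of_sq [simp]: "sign_of w * sign_of w = 1"
  by (simp add: sign_of_def)

lemma sum_lessThan_double:
  fixes f :: "nat \<Rightarrow> 'a :: comm_monoid_add"
  shows "(\<Sum>y<2*H. f y) = (\<Sum>u<H. f (2 * u) + f (2 * u + 1))"
  by (induction H) (simp_all add: add.assoc)

text \<open>The lowest bit of a word is its sign and the other bits determine its bucket, so
  \<open>2 * u\<close> and \<open>2 * u + 1\<close> share a bucket and have opposite signs. The
  signs are thus exactly unbiased within each bucket, even if \<open>B\<close> does not divide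
  \<open>H\<close> and the buckets are only nearly uniform.\<close>

lemma sum_sign_bucket: "(\<Sum>y<2*H. if bucket_of B y = b then sign_of y else 0) = 0"
  unfolding sum_lessThan_double by (rule sum.neutral) (auto simp: bucket_of_def sign_of_def)

lemma sum_mod_eq_le:
  assumes "0 < B"
  shows "(\<Sum>u<H. if u mod B = b then 1 else 0 :: nat) \<le> H div B + 1"
proof -
  have "(\<Sum>u<H. if u mod B = b then 1 else 0 :: nat) = card {u. u < H \<and> u mod B = b}"
    by (simp add: sum.If_cases Int_def)
  also have "\<dots> \<le> card {..H div B}"
  proof (rule card_inj_on_le[where f = "\<lambda>u. u div B"])
    show "inj_on (\<lambda>u. u div B) {u. u < H \<and> u mod B = b}"
      by (rule inj_onI) (metis (mono_tags, lifting) div_mult_mod_eq mem_Collect_eq)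
  qed (auto simp: div_le_mono)
  finally show ?thesis by simp
qed

text \<open>Rounding costs at most a factor 2, because \<open>B \<le> H\<close> makes the extra 1 at
  most \<open>H / B\<close>.\<close>

lemma sum_bucket_le:
  assumes "0 < B" "B \<le> H"
  shows "(\<Sum>y<2*H. if bucket_of B y = b then 1 else 0 :: real) \<le> 2 / real B * real (2 * H)"
proof -
  have "(\<Sum>y<2*H. if bucket_of B y = b then 1 else 0 :: real)
      = 2 * real (\<Sum>u<H. if u mod B = b then 1 else 0 :: nat)"
    unfolding sum_lessThan_double by (simp add: bucket_of_def sum_distrib_left of_nat_sum) (intro sum.cong, auto)
  also have "\<dots> \<le> 2 * real (H div B + 1)"
    by (intro mult_left_mono of_nat_mono sum_mod_eq_le assms) simp
  also have "real (H div B) \<le> real H / real B" by (rule of_nat_div_le_of_nat)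
  then have "2 * real (H div B + 1) \<le> 2 * (real H / real B + real H / real B)"
    using assms by (simp add: field_simps)
  finally show ?thesis by (simp add: mult.commute)
qed

text \<open>A word modulo \<open>n\<close> is not exactly uniform, but as \<open>n \<le> W\<close>
  no residue gets more than twice its fair share.\<close>

lemma uniform_sum_mod_eq_le:
  assumes "0 < n" "n \<le> W"
  shows "(\<Sum>y<W. if y mod n = b then 1 else 0 :: real) \<le> 2 / real n * real W"
proof -
  have "(\<Sum>y<W. if y mod n = b then 1 else 0 :: real) = real (\<Sum>y<W. if y mod n = b then 1 else 0 :: nat)"
    by (simp add: of_nat_sum if_distrib cong: if_cong)
  also have "\<dots> \<le> real (W div n + 1)" unfolding of_nat_le_iff by (rule sum_mod_eq_le[OF assms(1)])
  also have "\<dots> \<le> real W / real n + real W / real n"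
    using assms of_nat_div_le_of_nat[of W n, where ?'a = real] by (simp add: field_simps)
  finally show ?thesis by simp
qed

text \<open>The sign of \<open>p\<close> is left out; it does not change squares.\<close>

definition noise :: "nat \<Rightarrow> 'a set \<Rightarrow> ('a \<Rightarrow> real) \<Rightarrow> 'a \<Rightarrow> ('a \<Rightarrow> nat) \<Rightarrow> real" where
  "noise B J v p \<omega> = (\<Sum>a\<in>J. if bucket_of B (\<omega> a) = bucket_of B (\<omega> p) then sign_of (\<omega> a) * v a else 0)"

section \<open>Collisions, noise and samples under uniform words\<close>

locale uniform_words =
  fixes W H :: nat and I :: "'a set" and d :: nat
  assumes W: "W = 2 * H" "0 < H" and fin: "finite I"
begin

abbreviation words :: "('a \<Rightarrow> nat) pmf" where
  "words \<equiv> Pi_pmf I d (\<lambda>_. pmf_of_set {..<W})"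

abbreviation "E \<equiv> measure_pmf.expectation words"

lemma W_pos: "0 < W" using W by simp

lemma finite_words: "finite (set_pmf words)"
proof -
  have "finite (PiE_dflt I d (set_pmf \<circ> (\<lambda>_. pmf_of_set {..<W})))"
    using fin W_pos by (intro finite_PiE_dflt) (auto simp: lessThan_empty_iff)
  then show ?thesis
    using set_Pi_pmf_subset'[OF fin] by (rule finite_subset[rotated])
qed

lemma integrable_words [simp]: "integrable (measure_pmf words) (f :: _ \<Rightarrow> real)"
  by (rule integrable_measure_pmf_finite[OF finite_words])

lemma E_resample: "a \<in> I \<Longrightarrow> E X = E (\<lambda>\<omega>. (\<Sum>y<W. X ((\<omega>)(a := y))) / real W)"
proof -
  assume a: "a \<in> I"
  have "measure_pmf.expectation (pmf_of_set {..<W}) f = (\<Sum>y<W. f y) / real W" for f :: "nat \<Rightarrow> real"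
    using W_pos by (subst integral_pmf_of_set) (auto simp: lessThan_empty_iff)
  then show ?thesis
    using W_pos by (subst expectation_Pi_pmf_resample[OF fin a finite_words]) (auto simp: lessThan_empty_iff)
qed

lemma E_bounded_resample:
  assumes "a \<in> I" "\<And>\<omega>. (\<Sum>y<W. X ((\<omega>)(a := y))) \<le> q * real W"
  shows "E X \<le> q"
proof -
  have "E X \<le> E (\<lambda>_. q)"
    unfolding E_resample[OF assms(1), of X]
    by (rule integral_mono) (use assms(2) W_pos in \<open>auto simp: divide_le_eq\<close>)
  then show ?thesis by simp
qed

text \<open>Only the word at \<open>a\<close> is averaged; as \<open>a \<noteq> p\<close>, the
  bucket of \<open>p\<close> is then a fixed target.\<close>

lemma E_collision:
  assumes "a \<in> I" "a \<noteq> p" "0 < B" "B \<le> H"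
  shows "E (\<lambda>\<omega>. if bucket_of B (\<omega> a) = bucket_of B (\<omega> p) then 1 else 0) \<le> 2 / real B"
proof (rule E_bounded_resample[OF assms(1)])
  fix \<omega>
  show "(\<Sum>y<W. if bucket_of B (((\<omega>)(a := y)) a) = bucket_of B (((\<omega>)(a := y)) p) then 1 else 0) \<le> 2 / real B * real W"
    using sum_bucket_le[OF assms(3,4), of "bucket_of B (\<omega> p)"] assms(2) by (simp add: W)
qed

lemma prob_collision:
  assumes "S \<subseteq> I" "p \<notin> S" "0 < B" "B \<le> H"
  shows "measure_pmf.prob words {\<omega>. \<exists>a\<in>S. bucket_of B (\<omega> a) = bucket_of B (\<omega> p)} \<le> real (card S) * (2 / real B)"
proof -
  have finS: "finite S" using assms(1) fin finite_subset by auto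
  have "measure_pmf.prob words {\<omega>. \<exists>a\<in>S. bucket_of B (\<omega> a) = bucket_of B (\<omega> p)}
      = measure_pmf.prob words (\<Union>a\<in>S. {\<omega>. bucket_of B (\<omega> a) = bucket_of B (\<omega> p)})"
    by (rule arg_cong[where f = "measure_pmf.prob words"]) auto
  also have "\<dots> \<le> (\<Sum>a\<in>S. measure_pmf.prob words {\<omega>. bucket_of B (\<omega> a) = bucket_of B (\<omega> p)})"
    by (intro measure_pmf.finite_measure_subadditive_finite finS) auto
  also have "\<dots> \<le> (\<Sum>a\<in>S. 2 / real B)"
  proof (rule sum_mono)
    fix a assume "a \<in> S"
    let ?A = "{\<omega>. bucket_of B (\<omega> a) = bucket_of B (\<omega> p)}"
    have "measure_pmf.prob words ?A = E (indicator ?A)" by simp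
    also have "\<dots> = E (\<lambda>\<omega>. if bucket_of B (\<omega> a) = bucket_of B (\<omega> p) then 1 else 0)"
      by (intro arg_cong[where f = E] ext) (simp add: indicator_def)
    also have "\<dots> \<le> 2 / real B" using \<open>a \<in> S\<close> assms by (intro E_collision) auto
    finally show "measure_pmf.prob words ?A \<le> 2 / real B" .
  qed
  finally show ?thesis by simp
qed

text \<open>In the expanded square the cross terms vanish: with all other words fixed, the sign at
  \<open>a\<close> averages to zero within the bucket of \<open>p\<close>. The diagonal terms are
  collision probabilities.\<close>

lemma E_noise_sq:
  assumes J: "J \<subseteq> I" "p \<notin> J" and B: "0 < B" "B \<le> H"
  shows "E (\<lambda>\<omega>. (noise B J v p \<omega>)\<^sup>2) \<le> 2 / real B * (\<Sum>a\<in>J. (v a)\<^sup>2)"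
proof -
  define u where "u a \<omega> = (if bucket_of B (\<omega> a) = bucket_of B (\<omega> p) then sign_of (\<omega> a) else 0)" for a \<omega>
  have finJ: "finite J" using J(1) fin finite_subset by auto
  have cross: "E (\<lambda>\<omega>. u a \<omega> * u b \<omega>) = 0" if "a \<in> J" "b \<in> J" "a \<noteq> b" for a b
  proof -
    have "(\<Sum>y<W. u a ((\<omega>)(a := y)) * u b ((\<omega>)(a := y))) = 0" for \<omega>
    proof -
      have "(\<Sum>y<W. u a ((\<omega>)(a := y)) * u b ((\<omega>)(a := y)))
          = (\<Sum>y<2*H. if bucket_of B y = bucket_of B (\<omega> p) then sign_of y else 0) * u b \<omega>"
        unfolding W(1) sum_distrib_right
        by (intro sum.cong) (use that J(2) in \<open>auto simp: u_def\<close>)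
      then show ?thesis by (simp add: sum_sign_bucket)
    qed
    then show ?thesis using that J(1) by (subst E_resample[of a]) auto
  qed
  have diag: "E (\<lambda>\<omega>. u a \<omega> * u a \<omega>) \<le> 2 / real B" if "a \<in> J" for a
  proof -
    have "(\<lambda>\<omega>. u a \<omega> * u a \<omega>) = (\<lambda>\<omega>. if bucket_of B (\<omega> a) = bucket_of B (\<omega> p) then 1 else 0)"
      by (auto simp: u_def)
    then show ?thesis using E_collision[of a p B] that J B by auto
  qed
  have "noise B J v p \<omega> = (\<Sum>a\<in>J. u a \<omega> * v a)" for \<omega>
    unfolding noise_def u_def by (intro sum.cong) auto
  then have "(noise B J v p \<omega>)\<^sup>2 = (\<Sum>a\<in>J. \<Sum>b\<in>J. (v a * v b) * (u a \<omega> * u b \<omega>))" for \<omega>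
    by (simp add: power2_eq_square sum_product mult_ac)
  then have "E (\<lambda>\<omega>. (noise B J v p \<omega>)\<^sup>2) = (\<Sum>a\<in>J. \<Sum>b\<in>J. (v a * v b) * E (\<lambda>\<omega>. u a \<omega> * u b \<omega>))"
    by simp
  also have "\<dots> = (\<Sum>a\<in>J. \<Sum>b\<in>J. if b = a then (v a * v a) * E (\<lambda>\<omega>. u a \<omega> * u a \<omega>) else 0)"
    by (intro sum.cong) (auto simp: cross)
  also have "\<dots> = (\<Sum>a\<in>J. (v a)\<^sup>2 * E (\<lambda>\<omega>. u a \<omega> * u a \<omega>))"
    using finJ by (simp add: power2_eq_square)
  also have "\<dots> \<le> (\<Sum>a\<in>J. (v a)\<^sup>2 * (2 / real B))"
    by (intro sum_mono mult_left_mono diag) auto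
  finally show ?thesis by (simp only: sum_distrib_right[symmetric] mult.commute)
qed

lemma prob_noise_sq_gt:
  assumes "J \<subseteq> I" "p \<notin> J" "0 < B" "B \<le> H" "2 / real B * (\<Sum>a\<in>J. (v a)\<^sup>2) \<le> q * D" "0 \<le> q" "0 \<le> D"
  shows "measure_pmf.prob words {\<omega>. D < (noise B J v p \<omega>)\<^sup>2} \<le> q"
  using E_noise_sq[OF assms(1-4), of v] assms(5-)
  by (intro prob_gt_le_of_expectation finite_words) auto

lemma prob_sample:
  assumes "a \<in> I" "0 < n" "n \<le> W" "A \<subseteq> {..<n}"
  shows "measure_pmf.prob words {\<omega>. \<omega> a mod n \<in> A} \<le> real (card A) * (2 / real n)"
proof -
  have finA: "finite A" using assms(4) finite_subset by auto
  have "E (indicator {\<omega>. \<omega> a mod n \<in> A}) \<le> real (card A) * (2 / real n)"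
  proof (rule E_bounded_resample[OF assms(1)])
    fix \<omega> :: "'a \<Rightarrow> nat"
    have "(\<Sum>y<W. indicator {\<omega>. \<omega> a mod n \<in> A} ((\<omega>)(a := y)))
        = (\<Sum>y<W. \<Sum>b\<in>A. if y mod n = b then 1 else 0 :: real)"
      using finA by (intro sum.cong) (auto simp: indicator_def)
    also have "\<dots> = (\<Sum>b\<in>A. \<Sum>y<W. if y mod n = b then 1 else 0)" by (rule sum.swap)
    also have "\<dots> \<le> (\<Sum>b\<in>A. 2 / real n * real W)"
      by (intro sum_mono uniform_sum_mod_eq_le assms)
    finally show "(\<Sum>y<W. indicator {\<omega>. \<omega> a mod n \<in> A} ((\<omega>)(a := y))) \<le> real (card A) * (2 / real n) * real W"
      by simp
  qed
  then show ?thesis by simp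
qed

end

section \<open>Count-sketch with random buckets and signs\<close>

text \<open>The \<open>h\<close>-th smallest value of \<open>f\<close> on a finite \<open>A\<close>,
  with multiplicity; so the lower median if \<open>card A = 2 * h\<close>. Counts are used because
  both median computations work by counting: one ranks samples, the other increments
  counters.\<close>

definition is_med :: "nat \<Rightarrow> 'a set \<Rightarrow> ('a \<Rightarrow> real) \<Rightarrow> real \<Rightarrow> bool" where
  "is_med h A f v \<longleftrightarrow> card {a \<in> A. f a < v} < h \<and> h \<le> card {a \<in> A. f a \<le> v}"

lemma is_med_cong:
  assumes "\<And>a. a \<in> A \<Longrightarrow> f a = g a"
  shows "is_med h A f v \<longleftrightarrow> is_med h A g v"
  unfolding is_med_def using assms by (simp cong: conj_cong)

text \<open>If \<open>v\<close> were too large, every entry would be far from \<open>x\<close> or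
  below \<open>v\<close>, which accounts for fewer than \<open>2 * h\<close> entries. If
  \<open>v\<close> were too small, the at least \<open>h\<close> entries up to \<open>v\<close>
  would all be far.\<close>

lemma is_med_close:
  assumes "is_med h A f v" "finite A" "card A = 2 * h" "card {a \<in> A. \<delta> < \<bar>f a - x\<bar>} < h"
  shows "\<bar>v - x\<bar> \<le> \<delta>"
proof (rule ccontr)
  assume "\<not> \<bar>v - x\<bar> \<le> \<delta>"
  then consider "x + \<delta> < v" | "v < x - \<delta>" by linarith
  then show False
  proof cases
    case 1
    have "A = {a \<in> A. \<delta> < \<bar>f a - x\<bar>} \<union> {a \<in> A. f a < v}" using 1 by auto
    then have "card A \<le> card {a \<in> A. \<delta> < \<bar>f a - x\<bar>} + card {a \<in> A. f a < v}"
      by (metis card_Un_le)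
    then show False using assms by (simp add: is_med_def)
  next
    case 2
    then have "{a \<in> A. f a \<le> v} \<subseteq> {a \<in> A. \<delta> < \<bar>f a - x\<bar>}" by auto
    then have "card {a \<in> A. f a \<le> v} \<le> card {a \<in> A. \<delta> < \<bar>f a - x\<bar>}"
      using assms(2) by (intro card_mono) auto
    then show False using assms by (simp add: is_med_def)
  qed
qed

text \<open>An index \<open>j = r * n + i\<close> stands for coordinate \<open>i\<close> in row
  \<open>r\<close>, and \<open>\<omega> j\<close> is the word of this pair. Row \<open>r\<close>
  owns the \<open>B\<close> consecutive cells from \<open>r * B\<close> on.\<close>

definition cell :: "nat \<Rightarrow> nat \<Rightarrow> (nat \<Rightarrow> nat) \<Rightarrow> nat \<Rightarrow> nat" where
  "cell n B \<omega> j = (j div n) * B + bucket_of B (\<omega> j)"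

text \<open>The bound \<open>M\<close> is a parameter so that partial sums can serve as invariants
  of the loops over \<open>j\<close>. With \<open>x\<close> constantly 1 this is the sketch of the
  all-ones vector.\<close>

definition cell_sum :: "nat \<Rightarrow> nat \<Rightarrow> nat \<Rightarrow> (nat \<Rightarrow> nat) \<Rightarrow> (nat \<Rightarrow> real) \<Rightarrow> nat \<Rightarrow> real" where
  "cell_sum M n B \<omega> x a = (\<Sum>j<M. if cell n B \<omega> j = a then sign_of (\<omega> j) * x (j mod n) else 0)"

lemma cell_eq_iff:
  assumes "0 < B"
  shows "cell n B \<omega> a = cell n B \<omega> p \<longleftrightarrow> a div n = p div n \<and> bucket_of B (\<omega> a) = bucket_of B (\<omega> p)"
proof
  have *: "cell n B \<omega> j div B = j div n" "cell n B \<omega> j mod B = bucket_of B (\<omega> j)" for j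
    using assms by (simp_all add: cell_def bucket_of_def)
  assume "cell n B \<omega> a = cell n B \<omega> p"
  then show "a div n = p div n \<and> bucket_of B (\<omega> a) = bucket_of B (\<omega> p)"
    using * by metis
qed (simp add: cell_def)

text \<open>By linearity, correcting a cell by \<open>\<beta>\<close> times the cell of the all-ones
  vector amounts to sketching the shifted vector. The sign of \<open>p\<close> squares to one and
  isolates its own entry; what remains comes from the other members of the bucket.\<close>

lemma cell_estimate:
  assumes "0 < B" "p < M"
  shows "sign_of (\<omega> p) * (cell_sum M n B \<omega> x (cell n B \<omega> p) - \<beta> * cell_sum M n B \<omega> (\<lambda>_. 1) (cell n B \<omega> p))
    = (x (p mod n) - \<beta>)
      + sign_of (\<omega> p) * noise B ({a. a < M \<and> a div n = p div n} - {p}) (\<lambda>a. x (a mod n) - \<beta>) p \<omega>"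
proof -
  let ?J = "{a. a < M \<and> a div n = p div n}"
  let ?f = "\<lambda>a. if bucket_of B (\<omega> a) = bucket_of B (\<omega> p) then sign_of (\<omega> a) * (x (a mod n) - \<beta>) else 0"
  have "cell_sum M n B \<omega> x (cell n B \<omega> p) - \<beta> * cell_sum M n B \<omega> (\<lambda>_. 1) (cell n B \<omega> p)
      = (\<Sum>a<M. if a div n = p div n then ?f a else 0)"
    unfolding cell_sum_def sum_distrib_left sum_subtractf[symmetric]
    by (intro sum.cong) (auto simp: cell_eq_iff[OF assms(1)] algebra_simps)
  also have "\<dots> = (\<Sum>a\<in>?J. ?f a)" by (intro sum.mono_neutral_cong_right) auto
  also have "\<dots> = ?f p + (\<Sum>a\<in>?J - {p}. ?f a)" using assms by (intro sum.remove) auto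
  also have "(\<Sum>a\<in>?J - {p}. ?f a) = noise B (?J - {p}) (\<lambda>a. x (a mod n) - \<beta>) p \<omega>"
    by (simp add: noise_def)
  finally have eq: "cell_sum M n B \<omega> x (cell n B \<omega> p) - \<beta> * cell_sum M n B \<omega> (\<lambda>_. 1) (cell n B \<omega> p)
      = sign_of (\<omega> p) * (x (p mod n) - \<beta>) + noise B (?J - {p}) (\<lambda>a. x (a mod n) - \<beta>) p \<omega>" by simp
  show ?thesis unfolding eq distrib_left mult.assoc[symmetric] by simp
qed

text \<open>To be used with the sampled bias as \<open>\<beta>\<close> and the optimal one as
  \<open>\<beta>'\<close>: on the right, randomness of the bias enters only through a scalar
  factor.\<close>

lemma noise_split:
  "noise B J (\<lambda>a. x a - \<beta>) p \<omega> = noise B J (\<lambda>a. x a - \<beta>') p \<omega> + (\<beta>' - \<beta>) * noise B J (\<lambda>_. 1) p \<omega>"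
  unfolding noise_def sum_distrib_left sum.distrib[symmetric]
  by (intro sum.cong) (auto simp: algebra_simps)

lemma noise_restrict:
  assumes "finite J" "\<And>a. a \<in> J - J' \<Longrightarrow> bucket_of B (\<omega> a) \<noteq> bucket_of B (\<omega> p)" "J' \<subseteq> J"
  shows "noise B J v p \<omega> = noise B J' v p \<omega>"
  unfolding noise_def by (rule sum.mono_neutral_right) (use assms in auto)

lemma noise_cong:
  assumes "\<And>a. a \<in> J \<Longrightarrow> \<omega> a = \<omega>' a" "\<omega> p = \<omega>' p"
  shows "noise B J v p \<omega> = noise B J v p \<omega>'"
  unfolding noise_def by (rule sum.cong) (use assms in auto)

text \<open>An outlier collides with \<open>i\<close>, or the noise of the other coordinates is
  large, or that of the all-ones vector is. None of this mentions the sampled bias, and only words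
  of row \<open>r\<close> are read, so different rows are independent.\<close>

definition bad_row :: "nat \<Rightarrow> nat \<Rightarrow> nat set \<Rightarrow> (nat \<Rightarrow> real) \<Rightarrow> real \<Rightarrow> nat \<Rightarrow> nat \<Rightarrow> (nat \<Rightarrow> nat) set" where
  "bad_row n k S v D i r = (let p = r * n + i; J = {r * n..<r * n + n} in
     {\<omega>. \<exists>a\<in>{a \<in> J. a mod n \<in> S} - {p}. bucket_of (64 * k) (\<omega> a) = bucket_of (64 * k) (\<omega> p)}
     \<union> {\<omega>. 2 * D / real k < (noise (64 * k) ({a \<in> J. a mod n \<notin> S} - {p}) (\<lambda>a. v (a mod n)) p \<omega>)\<^sup>2}
     \<union> {\<omega>. 2 * real n / real k < (noise (64 * k) (J - {p}) (\<lambda>_. 1) p \<omega>)\<^sup>2})"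

lemma bij_betw_Collect_image_mem: "bij_betw f A B \<Longrightarrow> bij_betw f {a \<in> A. f a \<in> C} (B \<inter> C)"
  by (auto simp: bij_betw_def inj_on_def)

lemma bij_betw_mod_block: "bij_betw (\<lambda>a. a mod n) {r * n..<r * n + n} {..<n :: nat}"
proof (rule bij_betwI[where g = "\<lambda>i. r * n + i"])
  show "r * n + a mod n = a" if "a \<in> {r * n..<r * n + n}" for a
  proof -
    have "a = r * n + (a - r * n)" "a - r * n < n" using that by auto
    then show ?thesis by (metis mod_less mod_mult_self3)
  qed
qed auto

text \<open>At most \<open>k\<close> outliers collide with probability \<open>2 / (64 * k)\<close>
  each, in total 1/32. The second moments are at most \<open>2 / (64 * k)\<close> times
  \<open>D\<close> and \<open>n\<close>; the thresholds in \<open>bad_row\<close> are 64 times as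
  large, so Markov's inequality gives 1/64 for each.\<close>

lemma prob_bad_row:
  assumes "uniform_words W H I" "{r * n..<r * n + n} \<subseteq> I" "i < n" "1 \<le> k" "64 * k \<le> H"
    and S: "S \<subseteq> {..<n}" "card S \<le> k" and D: "(\<Sum>i\<in>{..<n} - S. (v i)\<^sup>2) \<le> D"
  shows "measure_pmf.prob (Pi_pmf I d (\<lambda>_. pmf_of_set {..<W})) (bad_row n k S v D i r) \<le> 1 / 16"
proof -
  interpret uniform_words W H I d by fact
  let ?P = "measure_pmf.prob words"
  define p where "p = r * n + i"
  define J where "J = {r * n..<r * n + n}"
  let ?A1 = "{\<omega>. \<exists>a\<in>{a \<in> J. a mod n \<in> S} - {p}. bucket_of (64 * k) (\<omega> a) = bucket_of (64 * k) (\<omega> p)}"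
  let ?A2 = "{\<omega>. 2 * D / real k < (noise (64 * k) ({a \<in> J. a mod n \<notin> S} - {p}) (\<lambda>a. v (a mod n)) p \<omega>)\<^sup>2}"
  let ?A3 = "{\<omega>. 2 * real n / real k < (noise (64 * k) (J - {p}) (\<lambda>_. 1) p \<omega>)\<^sup>2}"
  have J: "J \<subseteq> I" "finite J" using assms(2) by (auto simp: J_def)
  have bij: "bij_betw (\<lambda>a. a mod n) J {..<n}" unfolding J_def by (rule bij_betw_mod_block)
  have D0: "0 \<le> D" using D sum_nonneg[of "{..<n} - S" "\<lambda>i. (v i)\<^sup>2"] by simp
  have "card ({a \<in> J. a mod n \<in> S} - {p}) \<le> card {a \<in> J. a mod n \<in> S}" using J by (intro card_mono) auto
  also have "\<dots> = card S"
  proof (rule bij_betw_same_card)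
    show "bij_betw (\<lambda>a. a mod n) {a \<in> J. a mod n \<in> S} S"
      using bij_betw_Collect_image_mem[OF bij, of S] S(1) by (simp add: Int_absorb1)
  qed
  finally have c: "card ({a \<in> J. a mod n \<in> S} - {p}) \<le> k" using S by simp
  have "?P ?A1 \<le> real (card ({a \<in> J. a mod n \<in> S} - {p})) * (2 / real (64 * k))"
    using J assms by (intro prob_collision) auto
  also have "\<dots> \<le> real k * (2 / real (64 * k))" using c by (intro mult_right_mono) auto
  finally have 1: "?P ?A1 \<le> 1 / 32" using assms by simp
  have "(\<Sum>a\<in>{a \<in> J. a mod n \<notin> S} - {p}. (v (a mod n))\<^sup>2) \<le> (\<Sum>a\<in>{a \<in> J. a mod n \<notin> S}. (v (a mod n))\<^sup>2)"
    using J by (intro sum_mono2) auto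
  also have "\<dots> = (\<Sum>i\<in>{..<n} - S. (v i)\<^sup>2)"
  proof (rule sum.reindex_bij_betw)
    show "bij_betw (\<lambda>a. a mod n) {a \<in> J. a mod n \<notin> S} ({..<n} - S)"
      using bij_betw_Collect_image_mem[OF bij, of "- S"] by (simp add: Diff_eq)
  qed
  finally have "(\<Sum>a\<in>{a \<in> J. a mod n \<notin> S} - {p}. (v (a mod n))\<^sup>2) \<le> D" using D by simp
  then have 2: "?P ?A2 \<le> 1 / 64"
    using J assms D0 by (intro prob_noise_sq_gt) (auto simp: divide_simps)
  have "card (J - {p}) \<le> card J" using J by (intro card_mono) auto
  then have "card (J - {p}) \<le> n" by (simp add: J_def)
  then have 3: "?P ?A3 \<le> 1 / 64"
    using J assms D0 by (intro prob_noise_sq_gt) (auto simp: divide_simps)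
  have "bad_row n k S v D i r = ?A1 \<union> ?A2 \<union> ?A3" by (simp add: bad_row_def p_def J_def Let_def)
  then have "?P (bad_row n k S v D i r) \<le> ?P ?A1 + ?P ?A2 + ?P ?A3"
    using measure_Un_le[of "?A1 \<union> ?A2" "measure_pmf words" ?A3] measure_Un_le[of ?A1 "measure_pmf words" ?A2] by simp
  then show ?thesis using 1 2 3 by simp
qed

text \<open>The noise of the shifted vector is at most \<open>sqrt (2 * D / k)\<close>. The bias
  error \<open>8 * sqrt (D / n)\<close> meets an all-ones noise of at most
  \<open>sqrt (2 * n / k)\<close>; here \<open>n\<close> cancels and eight more such terms result.
  The constant 13 is \<open>9 * sqrt 2\<close> rounded up.\<close>

lemma good_row_estimate:
  fixes x :: "nat \<Rightarrow> real"
  assumes "r * n + n \<le> M" "i < n" "1 \<le> k" "\<omega> \<notin> bad_row n k S (\<lambda>i. x i - \<beta>') D i r" "0 \<le> D"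
    and \<beta>: "(\<beta> - \<beta>')\<^sup>2 \<le> 64 * D / real n"
  defines "p \<equiv> r * n + i"
  shows "\<bar>sign_of (\<omega> p) * (cell_sum M n (64 * k) \<omega> x (cell n (64 * k) \<omega> p)
      - \<beta> * cell_sum M n (64 * k) \<omega> (\<lambda>_. 1) (cell n (64 * k) \<omega> p)) - (x i - \<beta>)\<bar> \<le> 13 * sqrt D / sqrt (real k)"
proof -
  define J where "J = {r * n..<r * n + n}"
  let ?B = "64 * k"
  let ?N1 = "noise ?B ({a \<in> J. a mod n \<notin> S} - {p}) (\<lambda>a. x (a mod n) - \<beta>') p \<omega>"
  let ?N2 = "noise ?B (J - {p}) (\<lambda>_. 1) p \<omega>"
  have p: "p div n = r" "p mod n = i" "p < M" using assms by (auto simp: p_def)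
  have J: "{a. a < M \<and> a div n = p div n} = J"
  proof -
    have "r * n \<le> a \<and> a < r * n + n" if "a div n = r" for a
      using that div_times_less_eq_dividend[of a n] dividend_less_div_times[of n a] \<open>i < n\<close> by simp
    moreover have "a div n = r" if "r * n \<le> a \<and> a < r * n + n" for a
      using that by (intro div_nat_eqI) (auto simp: mult.commute)
    ultimately have "a div n = r \<longleftrightarrow> r * n \<le> a \<and> a < r * n + n" for a by blast
    then show ?thesis using assms(1) by (simp add: J_def p set_eq_iff) linarith
  qed
  have good: "bucket_of ?B (\<omega> a) \<noteq> bucket_of ?B (\<omega> p)" if "a \<in> {a \<in> J. a mod n \<in> S} - {p}" for a
    using assms(4) that by (auto simp: bad_row_def Let_def p_def J_def)
  have N1: "?N1\<^sup>2 \<le> 2 * D / real k" and N2: "?N2\<^sup>2 \<le> 2 * real n / real k"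
    using assms(4) by (auto simp: bad_row_def Let_def p_def J_def not_less)
  have "noise ?B (J - {p}) (\<lambda>a. x (a mod n) - \<beta>) p \<omega>
      = noise ?B (J - {p}) (\<lambda>a. x (a mod n) - \<beta>') p \<omega> + (\<beta>' - \<beta>) * ?N2"
    by (rule noise_split)
  also have "noise ?B (J - {p}) (\<lambda>a. x (a mod n) - \<beta>') p \<omega> = ?N1"
    by (rule noise_restrict) (use good in \<open>auto simp: J_def\<close>)
  finally have eq: "sign_of (\<omega> p) * (cell_sum M n ?B \<omega> x (cell n ?B \<omega> p)
      - \<beta> * cell_sum M n ?B \<omega> (\<lambda>_. 1) (cell n ?B \<omega> p)) - (x i - \<beta>) = sign_of (\<omega> p) * (?N1 + (\<beta>' - \<beta>) * ?N2)"
    using cell_estimate[of ?B p M \<omega> n x \<beta>, unfolded J] p \<open>1 \<le> k\<close> by (simp add: distrib_left)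
  have "((\<beta>' - \<beta>) * ?N2)\<^sup>2 \<le> (64 * D / real n) * (2 * real n / real k)"
    unfolding power_mult_distrib using \<beta> N2 assms(5) by (intro mult_mono) (auto simp: power2_commute)
  also have "\<dots> = 64 * (2 * D / real k)" using \<open>i < n\<close> by simp
  also have "\<dots> = (8 * sqrt (2 * D / real k))\<^sup>2"
    unfolding power_mult_distrib using assms(5) by (subst real_sqrt_pow2) auto
  finally have "\<bar>(\<beta>' - \<beta>) * ?N2\<bar> \<le> \<bar>8 * sqrt (2 * D / real k)\<bar>"
    unfolding abs_le_square_iff .
  then have 2: "\<bar>(\<beta>' - \<beta>) * ?N2\<bar> \<le> 8 * sqrt (2 * D / real k)"
    using assms(5) by (subst (asm) (2) abs_of_nonneg) auto
  have 1: "\<bar>?N1\<bar> \<le> sqrt (2 * D / real k)" using N1 by (intro real_le_rsqrt) simp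
  have "\<bar>sign_of (\<omega> p) * (?N1 + (\<beta>' - \<beta>) * ?N2)\<bar> = \<bar>?N1 + (\<beta>' - \<beta>) * ?N2\<bar>"
    by (simp add: abs_mult sign_of_def)
  also have "\<dots> \<le> 9 * sqrt (2 * D / real k)" using 1 2 by linarith
  also have "\<dots> = 9 * sqrt 2 * (sqrt D / sqrt (real k))" by (simp add: real_sqrt_mult real_sqrt_divide)
  also have "\<dots> \<le> 13 * (sqrt D / sqrt (real k))"
  proof (rule mult_right_mono)
    have "sqrt 2 \<le> 13 / 9" by (rule real_le_lsqrt) (auto simp: power2_eq_square)
    then show "9 * sqrt 2 \<le> (13 :: real)" by simp
  qed (use assms(5) in auto)
  finally show ?thesis unfolding eq by simp
qed

text \<open>Markov's inequality by counting: more than \<open>n / 64\<close> such coordinates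
  outside \<open>S\<close> would by themselves exceed the sum \<open>D\<close>. The set
  \<open>S\<close> adds at most \<open>k\<close>.\<close>

lemma card_far_coordinates:
  fixes x :: "nat \<Rightarrow> real"
  assumes "S \<subseteq> {..<n}" "card S \<le> k" "0 < n" and D: "(\<Sum>i\<in>{..<n} - S. (x i - \<beta>)\<^sup>2) \<le> D"
  shows "real (card {i \<in> {..<n}. 64 * D / real n < (x i - \<beta>)\<^sup>2}) \<le> real k + real n / 64"
proof -
  let ?A = "{i \<in> {..<n}. 64 * D / real n < (x i - \<beta>)\<^sup>2}"
  have D0: "0 \<le> D" using D sum_nonneg[of "{..<n} - S" "\<lambda>i. (x i - \<beta>)\<^sup>2"] by simp
  have le: "(\<Sum>i\<in>?A - S. (x i - \<beta>)\<^sup>2) \<le> D"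
    by (rule order_trans[OF sum_mono2 D]) auto
  have "real (card (?A - S)) \<le> real n / 64"
  proof (cases "?A - S = {}")
    case False
    then have lt: "(\<Sum>i\<in>?A - S. 64 * D / real n) < (\<Sum>i\<in>?A - S. (x i - \<beta>)\<^sup>2)"
      by (intro sum_strict_mono) auto
    \<comment> \<open>For \<open>D = 0\<close> this would read \<open>0 < 0\<close>, so division by
      \<open>D\<close> is safe.\<close>
    then have *: "real (card (?A - S)) * (64 * D / real n) < D" using le by simp
    then have "D \<noteq> 0" by auto
    then have "D > 0" using D0 by simp
    then show ?thesis using * assms(3) by (simp add: field_simps)
  next
    case True
    then show ?thesis by (simp only: card.empty)
  qed
  moreover have "card ?A \<le> card (?A - S) + card S"
    using card_Un_le[of "?A - S" S] card_mono[of "(?A - S) \<union> S" ?A] assms(1) finite_subset[OF assms(1)]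
    by fastforce
  ultimately show ?thesis using assms(2) by linarith
qed

text \<open>The event concerns the words only: \<open>\<beta>\<close> and \<open>v\<close> range
  over all values meeting the median conditions, which is precisely what the recovery program is
  shown to deliver. With failure probability 1/16 per block, each median fails with probability at
  most \<open>4 ^ h\<close> in the denominator, hence at most \<open>1 / (n * n)\<close>. The
  samples and the union over the \<open>n\<close> coordinates account for \<open>1 / n\<close>
  each.\<close>

lemma prob_recovery_good:
  fixes x :: "nat \<Rightarrow> real"
  assumes W: "W = 2 * H" "64 * k \<le> H" "2 * h * n + 2 * h \<le> W" and "1 \<le> k" "64 * k \<le> n" "n \<le> 2 ^ h" "n \<le> W"
    and S: "S \<subseteq> {..<n}" "card S \<le> k" and D: "(\<Sum>i\<in>{..<n} - S. (x i - \<beta>')\<^sup>2) \<le> D"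
  shows "1 - 2 / real n \<le> measure_pmf.prob (Pi_pmf {..<W} d (\<lambda>_. pmf_of_set {..<W}))
    {\<omega>. \<forall>\<beta>. is_med h {..<2 * h} (\<lambda>t. x (\<omega> (2 * h * n + t) mod n)) \<beta> \<longrightarrow>
      (\<forall>i<n. \<forall>v. is_med h {j. j < 2 * h * n \<and> j mod n = i} (\<lambda>j. sign_of (\<omega> j) *
          (cell_sum (2 * h * n) n (64 * k) \<omega> x (cell n (64 * k) \<omega> j)
            - \<beta> * cell_sum (2 * h * n) n (64 * k) \<omega> (\<lambda>_. 1) (cell n (64 * k) \<omega> j))) (v - \<beta>)
        \<longrightarrow> \<bar>v - x i\<bar> \<le> 13 * sqrt D / sqrt (real k))}"
    (is "_ \<le> measure_pmf.prob _ ?good")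
proof -
  let ?P = "measure_pmf.prob (Pi_pmf {..<W} d (\<lambda>_. pmf_of_set {..<W}))"
  define A where "A = {i \<in> {..<n}. 64 * D / real n < (x i - \<beta>')\<^sup>2}"
  define Es where "Es t = {\<omega> :: nat \<Rightarrow> nat. \<omega> (2 * h * n + t) mod n \<in> A}" for t
  define Er where "Er i r = bad_row n k S (\<lambda>i. x i - \<beta>') D i r" for i r
  define bad_s where "bad_s = {\<omega>. h \<le> card {t. t < 2 * h \<and> \<omega> \<in> Es t}}"
  define bad_r where "bad_r i = {\<omega>. h \<le> card {r. r < 2 * h \<and> \<omega> \<in> Er i r}}" for i
  have n: "0 < n" "0 < k" "0 < H" using assms by auto
  interpret uniform_words W H "{..<W}" d by standard (use assms n in auto)
  have D0: "0 \<le> D" using D sum_nonneg[of "{..<n} - S" "\<lambda>i. (x i - \<beta>')\<^sup>2"] by simp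
  have row: "r * n + n \<le> 2 * h * n" if "r < 2 * h" for r
  proof -
    have "Suc r * n \<le> 2 * h * n" using that by (intro mult_right_mono) auto
    then show ?thesis by simp
  qed
  have pw: "(4 * (1 / 16)) ^ h \<le> 1 / real n * (1 / real n)"
  proof -
    have "real n * real n \<le> 2 ^ h * 2 ^ h" using \<open>n \<le> 2 ^ h\<close> by (intro mult_mono) (auto simp flip: of_nat_le_iff)
    then have "real n * real n \<le> 4 ^ h" by (simp flip: power_mult_distrib)
    then show ?thesis using n by (simp add: power_one_over field_simps)
  qed
  have "?P bad_s \<le> (4 * (1 / 16)) ^ h"
    unfolding bad_s_def
  \<comment> \<open>Each sample is a block consisting of one word; these words lie behind the
    \<open>2 * h * n\<close> words of the rows.\<close>
  proof (rule prob_half_blocks_bad[where K = "\<lambda>t. {2 * h * n + t}"])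
    fix t assume t: "t < 2 * h"
    have "?P (Es t) \<le> real (card A) * (2 / real n)"
      unfolding Es_def by (rule prob_sample) (use t assms n in \<open>auto simp: A_def\<close>)
    also have "\<dots> \<le> (real k + real n / 64) * (2 / real n)"
      unfolding A_def by (intro mult_right_mono card_far_coordinates[OF S n(1) D]) auto
    \<comment> \<open>Because \<open>64 * k \<le> n\<close>, the outliers count for no more than the
      other far coordinates: both terms are at most \<open>n / 64\<close>.\<close>
    also have "\<dots> \<le> 1 / 16" using \<open>64 * k \<le> n\<close> n by (simp add: field_simps)
    finally show "?P (Es t) \<le> 1 / 16" .
  qed (use assms in \<open>auto simp: Es_def\<close>)
  then have bs: "?P bad_s \<le> 1 / real n"
    using pw n by (smt (verit) divide_le_eq_1_pos mult_left_le_one_le of_nat_1 of_nat_mono One_nat_def Suc_leI divide_nonneg_nonneg)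
  have br: "?P (bad_r i) \<le> 1 / real n * (1 / real n)" if i: "i < n" for i
  proof -
    have "?P (bad_r i) \<le> (4 * (1 / 16)) ^ h"
      unfolding bad_r_def
    proof (rule prob_half_blocks_bad[where K = "\<lambda>r. {r * n..<r * n + n}"])
      fix r assume r: "r < 2 * h"
      show sub: "{r * n..<r * n + n} \<subseteq> {..<W}" using row[OF r] assms(3) by auto
      show "?P (Er i r) \<le> 1 / 16"
        unfolding Er_def by (rule prob_bad_row[OF uniform_words_axioms sub i]) (use assms in auto)
      fix \<omega> \<omega>' :: "nat \<Rightarrow> nat" assume eq: "\<forall>a\<in>{r * n..<r * n + n}. \<omega> a = \<omega>' a"
      then have p: "\<omega> (r * n + i) = \<omega>' (r * n + i)" using i by simp
      have b: "(\<exists>a\<in>{a \<in> {r * n..<r * n + n}. a mod n \<in> S} - {r * n + i}. bucket_of (64 * k) (\<omega> a) = bucket_of (64 * k) c)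
        \<longleftrightarrow> (\<exists>a\<in>{a \<in> {r * n..<r * n + n}. a mod n \<in> S} - {r * n + i}. bucket_of (64 * k) (\<omega>' a) = bucket_of (64 * k) c)" for c
        by (intro bex_cong refl) (use eq in auto)
      have c: "noise (64 * k) ({a \<in> {r * n..<r * n + n}. Q a} - {r * n + i}) u (r * n + i) \<omega>
        = noise (64 * k) ({a \<in> {r * n..<r * n + n}. Q a} - {r * n + i}) u (r * n + i) \<omega>'" for u Q
        by (rule noise_cong) (use eq p in auto)
      have c': "noise (64 * k) ({r * n..<r * n + n} - {r * n + i}) u (r * n + i) \<omega>
        = noise (64 * k) ({r * n..<r * n + n} - {r * n + i}) u (r * n + i) \<omega>'" for u
        by (rule noise_cong) (use eq p in auto)
      show "\<omega> \<in> Er i r \<longleftrightarrow> \<omega>' \<in> Er i r"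
        unfolding Er_def bad_row_def Let_def Un_iff mem_Collect_eq p b c[of "\<lambda>a. a mod n \<notin> S"]
          c' by (rule refl)
    next
      fix r s :: nat assume rs: "r \<noteq> s"
      have "a div n = r" if "a \<in> {r * n..<r * n + n}" for a r
        using that by (intro div_nat_eqI) (auto simp: mult.commute)
      then show "{r * n..<r * n + n} \<inter> {s * n..<s * n + n} = {}" using rs by blast
    qed auto
    then show ?thesis using pw by linarith
  qed
  have "- ?good \<subseteq> bad_s \<union> (\<Union>i\<in>{..<n}. bad_r i)"
  proof
    fix \<omega> assume "\<omega> \<in> - ?good"
    then obtain \<beta> i v where b: "is_med h {..<2 * h} (\<lambda>t. x (\<omega> (2 * h * n + t) mod n)) \<beta>" and i: "i < n"
      and v: "is_med h {j. j < 2 * h * n \<and> j mod n = i} (\<lambda>j. sign_of (\<omega> j) *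
          (cell_sum (2 * h * n) n (64 * k) \<omega> x (cell n (64 * k) \<omega> j)
            - \<beta> * cell_sum (2 * h * n) n (64 * k) \<omega> (\<lambda>_. 1) (cell n (64 * k) \<omega> j))) (v - \<beta>)"
      and far: "\<not> \<bar>v - x i\<bar> \<le> 13 * sqrt D / sqrt (real k)"
      by blast
    show "\<omega> \<in> bad_s \<union> (\<Union>i\<in>{..<n}. bad_r i)"
    proof (rule ccontr)
      assume "\<omega> \<notin> bad_s \<union> (\<Union>i\<in>{..<n}. bad_r i)"
      then have good_s: "card {t. t < 2 * h \<and> \<omega> \<in> Es t} < h" and good_r: "card {r. r < 2 * h \<and> \<omega> \<in> Er i r} < h"
        using i by (auto simp: bad_s_def bad_r_def not_le)
      have "\<bar>\<beta> - \<beta>'\<bar> \<le> sqrt (64 * D / real n)"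
      proof (rule is_med_close[OF b])
        have "{t \<in> {..<2 * h}. sqrt (64 * D / real n) < \<bar>x (\<omega> (2 * h * n + t) mod n) - \<beta>'\<bar>}
          \<subseteq> {t. t < 2 * h \<and> \<omega> \<in> Es t}"
        proof safe
          fix t assume "sqrt (64 * D / real n) < \<bar>x (\<omega> (2 * h * n + t) mod n) - \<beta>'\<bar>"
          then have "sqrt (64 * D / real n) < sqrt ((x (\<omega> (2 * h * n + t) mod n) - \<beta>')\<^sup>2)" by simp
          then show "\<omega> \<in> Es t" using n by (simp add: Es_def A_def del: real_sqrt_abs)
        qed
        then have "card {t \<in> {..<2 * h}. sqrt (64 * D / real n) < \<bar>x (\<omega> (2 * h * n + t) mod n) - \<beta>'\<bar>}
          \<le> card {t. t < 2 * h \<and> \<omega> \<in> Es t}" by (intro card_mono) auto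
        then show "card {t \<in> {..<2 * h}. sqrt (64 * D / real n) < \<bar>x (\<omega> (2 * h * n + t) mod n) - \<beta>'\<bar>} < h"
          using good_s by linarith
      qed auto
      then have "\<bar>\<beta> - \<beta>'\<bar>\<^sup>2 \<le> (sqrt (64 * D / real n))\<^sup>2" by (intro power_mono) auto
      then have \<beta>: "(\<beta> - \<beta>')\<^sup>2 \<le> 64 * D / real n" using D0 by simp
      let ?f = "\<lambda>j. sign_of (\<omega> j) *
          (cell_sum (2 * h * n) n (64 * k) \<omega> x (cell n (64 * k) \<omega> j)
            - \<beta> * cell_sum (2 * h * n) n (64 * k) \<omega> (\<lambda>_. 1) (cell n (64 * k) \<omega> j))"
      have idx: "{j. j < 2 * h * n \<and> j mod n = i} = (\<lambda>r. r * n + i) ` {..<2 * h}"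
      proof (intro equalityI subsetI)
        fix j assume "j \<in> {j. j < 2 * h * n \<and> j mod n = i}"
        then show "j \<in> (\<lambda>r. r * n + i) ` {..<2 * h}"
          by (intro image_eqI[of _ _ "j div n"]) (auto simp: less_mult_imp_div_less)
      next
        fix j assume "j \<in> (\<lambda>r. r * n + i) ` {..<2 * h}"
        then obtain r where "r < 2 * h" "j = r * n + i" by auto
        then show "j \<in> {j. j < 2 * h * n \<and> j mod n = i}" using row[of r] i by simp
      qed
      have inj: "inj_on (\<lambda>r. r * n + i) R" for R using n by (auto simp: inj_on_def)
      have "\<bar>(v - \<beta>) - (x i - \<beta>)\<bar> \<le> 13 * sqrt D / sqrt (real k)"
      proof (rule is_med_close[OF v])
        show "card {j. j < 2 * h * n \<and> j mod n = i} = 2 * h"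
          unfolding idx by (subst card_image[OF inj]) simp
        have "{j \<in> {j. j < 2 * h * n \<and> j mod n = i}. 13 * sqrt D / sqrt (real k) < \<bar>?f j - (x i - \<beta>)\<bar>}
          \<subseteq> (\<lambda>r. r * n + i) ` {r. r < 2 * h \<and> \<omega> \<in> Er i r}"
        proof
          fix j assume j: "j \<in> {j \<in> {j. j < 2 * h * n \<and> j mod n = i}. 13 * sqrt D / sqrt (real k) < \<bar>?f j - (x i - \<beta>)\<bar>}"
          then obtain r where r: "r < 2 * h" "j = r * n + i" using idx by blast
          have "\<omega> \<in> Er i r"
          proof (rule ccontr)
            assume "\<omega> \<notin> Er i r"
            then have "\<bar>?f j - (x i - \<beta>)\<bar> \<le> 13 * sqrt D / sqrt (real k)"
              unfolding r(2) Er_def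
              by (intro good_row_estimate[OF row[OF r(1)] i]) (use assms D0 \<beta> in auto)
            then show False using j by simp
          qed
          then show "j \<in> (\<lambda>r. r * n + i) ` {r. r < 2 * h \<and> \<omega> \<in> Er i r}" using r by blast
        qed
        then have "card {j \<in> {j. j < 2 * h * n \<and> j mod n = i}. 13 * sqrt D / sqrt (real k) < \<bar>?f j - (x i - \<beta>)\<bar>}
          \<le> card ((\<lambda>r. r * n + i) ` {r. r < 2 * h \<and> \<omega> \<in> Er i r})" by (intro card_mono) auto
        also have "\<dots> < h" using good_r by (simp add: card_image[OF inj])
        finally show "card {j \<in> {j. j < 2 * h * n \<and> j mod n = i}. 13 * sqrt D / sqrt (real k) < \<bar>?f j - (x i - \<beta>)\<bar>} < h" .
      qed auto
      then show False using far by simp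
    qed
  qed
  then have "?P (- ?good) \<le> ?P (bad_s \<union> (\<Union>i\<in>{..<n}. bad_r i))"
    by (intro measure_pmf.finite_measure_mono) auto
  also have "\<dots> \<le> ?P bad_s + ?P (\<Union>i\<in>{..<n}. bad_r i)" by (rule measure_Un_le) auto
  also have "?P (\<Union>i\<in>{..<n}. bad_r i) \<le> (\<Sum>i<n. ?P (bad_r i))"
    by (intro measure_pmf.finite_measure_subadditive_finite) auto
  also have "\<dots> \<le> (\<Sum>i<n. 1 / real n * (1 / real n))" by (intro sum_mono br) auto
  also have "\<dots> = 1 / real n" using n by simp
  finally have "?P (- ?good) \<le> 2 / real n" using bs by simp
  then show ?thesis using measure_pmf.prob_compl[of ?good words] by (simp add: Compl_eq_Diff_UNIV)
qed

section \<open>Reasoning about running times\<close>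

definition runs :: "nat \<Rightarrow> com \<Rightarrow> state \<Rightarrow> nat \<Rightarrow> (state \<Rightarrow> bool) \<Rightarrow> bool" where
  "runs W P s T Q \<longleftrightarrow> (\<exists>t s'. exec W P s t s' \<and> t \<le> T \<and> Q s')"

lemma runs_mono: "runs W P s T Q \<Longrightarrow> T \<le> T' \<Longrightarrow> (\<And>s'. Q s' \<Longrightarrow> Q' s') \<Longrightarrow> runs W P s T' Q'"
  unfolding runs_def by (meson order_trans)

lemma runs_Seq:
  assumes "runs W P s T1 R" "\<And>s'. R s' \<Longrightarrow> runs W P' s' T2 Q"
  shows "runs W (Seq P P') s (1 + T1 + T2) Q"
  using assms unfolding runs_def by (meson add_mono exec.Seq order_refl)

lemma runs_Cond:
  assumes "bval W b s \<Longrightarrow> runs W P s T Q" "\<not> bval W b s \<Longrightarrow> runs W P' s T Q"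
  shows "runs W (Cond b P P') s (1 + bcost b + T) Q"
  using assms unfolding runs_def by (cases "bval W b s") (meson add_left_mono exec.CondTrue exec.CondFalse)+

fun mods :: "com \<Rightarrow> name set" where
  "mods Skip = {}"
| "mods (IAssign v e) = {v}"
| "mods (RAssign v e) = {v}"
| "mods (IStore a i e) = {a}"
| "mods (RStore a i e) = {a}"
| "mods (Seq P Q) = mods P \<union> mods Q"
| "mods (Cond b P Q) = mods P \<union> mods Q"
| "mods (While b P) = mods P"

text \<open>Names are not separated by sort: writing to one of the four objects called
  \<open>v\<close> gives up all knowledge about the other three as well.\<close>

definition frame :: "name set \<Rightarrow> state \<Rightarrow> state \<Rightarrow> bool" where
  "frame X s s' \<longleftrightarrow> (\<forall>v. v \<notin> X \<longrightarrow>
    ivar s' v = ivar s v \<and> iarr s' v = iarr s v \<and> rvar s' v = rvar s v \<and> rarr s' v = rarr s v)"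

lemma frameD:
  assumes "frame X s s'" "v \<notin> X"
  shows "ivar s' v = ivar s v" "iarr s' v = iarr s v" "rvar s' v = rvar s v" "rarr s' v = rarr s v"
  using assms by (auto simp: frame_def)

lemma frame_refl: "frame X s s" by (simp add: frame_def)

lemma frame_trans: "frame X s s' \<Longrightarrow> frame Y s' s'' \<Longrightarrow> frame (X \<union> Y) s s''"
  by (simp add: frame_def)

lemma exec_frame: "exec W P s t s' \<Longrightarrow> frame (mods P) s s'"
  by (induction rule: exec.induct) (auto simp: frame_def)

lemma runs_frame: "runs W P s T Q \<Longrightarrow> runs W P s T (\<lambda>s'. Q s' \<and> frame (mods P) s s')"
  unfolding runs_def using exec_frame by blast

section \<open>Loop-free programs and loops\<close>

fun straight :: "com \<Rightarrow> bool" where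
  "straight (Seq P Q) \<longleftrightarrow> straight P \<and> straight Q"
| "straight (Cond b P Q) \<longleftrightarrow> straight P \<and> straight Q"
| "straight (While b P) \<longleftrightarrow> False"
| "straight _ \<longleftrightarrow> True"

text \<open>Loop-free code has a final state that the simplifier can evaluate. The clause for
  \<open>While\<close> is a dummy, excluded by \<open>straight\<close>.\<close>

fun step :: "nat \<Rightarrow> com \<Rightarrow> state \<Rightarrow> state" where
  "step W Skip s = s"
| "step W (IAssign v e) s = s\<lparr>ivar := (ivar s)(v := ival W e s)\<rparr>"
| "step W (RAssign v e) s = s\<lparr>rvar := (rvar s)(v := rval W e s)\<rparr>"
| "step W (IStore a i e) s = s\<lparr>iarr := (iarr s)(a := (iarr s a)(ival W i s := ival W e s))\<rparr>"
| "step W (RStore a i e) s = s\<lparr>rarr := (rarr s)(a := (rarr s a)(ival W i s := rval W e s))\<rparr>"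
| "step W (Seq P Q) s = step W Q (step W P s)"
| "step W (Cond b P Q) s = (if bval W b s then step W P s else step W Q s)"
| "step W (While b P) s = s"

fun max_cost :: "com \<Rightarrow> nat" where
  "max_cost Skip = 1"
| "max_cost (IAssign v e) = 1 + icost e"
| "max_cost (RAssign v e) = 1 + rcost e"
| "max_cost (IStore a i e) = 1 + icost i + icost e"
| "max_cost (RStore a i e) = 1 + icost i + rcost e"
| "max_cost (Seq P Q) = 1 + max_cost P + max_cost Q"
| "max_cost (Cond b P Q) = 1 + bcost b + max (max_cost P) (max_cost Q)"
| "max_cost (While b P) = 0"

lemma runs_step: "straight P \<Longrightarrow> runs W P s (max_cost P) (\<lambda>s'. s' = step W P s)"
proof (induction P arbitrary: s)
  case (Seq P Q)
  have "runs W (Seq P Q) s (1 + max_cost P + max_cost Q) (\<lambda>s'. s' = step W Q (step W P s))"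
    by (rule runs_Seq[where R = "\<lambda>s'. s' = step W P s"]) (use Seq in auto)
  then show ?case by simp
next
  case (Cond b P Q)
  have "runs W (Cond b P Q) s (1 + bcost b + max (max_cost P) (max_cost Q)) (\<lambda>s'. s' = step W (Cond b P Q) s)"
    by (rule runs_Cond; rule runs_mono, rule Cond.IH) (use Cond.prems in auto)
  then show ?case by simp
qed (force simp: runs_def intro: exec.intros)+

lemma runs_straight:
  assumes "straight P" "max_cost P \<le> T" "Q (step W P s)"
  shows "runs W P s T Q"
  using runs_mono[OF runs_step[OF assms(1)] assms(2)] assms(3) by blast

text \<open>The first argument of the invariant is the time still available.\<close>

lemma runs_While_budget:
  assumes "I m s"
    and "\<And>m s. I m s \<Longrightarrow> bval W b s \<Longrightarrow> \<exists>T. runs W P s T (\<lambda>s'. \<exists>m'. I m' s' \<and> T + bcost b + 1 + m' \<le> m)"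
  shows "runs W (While b P) s (m + bcost b + 1) (\<lambda>s'. (\<exists>m'. I m' s') \<and> \<not> bval W b s')"
  using assms(1)
\<comment> \<open>Every iteration uses up at least one unit of the budget, so the time bound proves
  termination as well.\<close>
proof (induction m arbitrary: s rule: less_induct)
  case (less m)
  show ?case
  proof (cases "bval W b s")
    case True
    then obtain T t s' m' where s': "exec W P s t s'" "t \<le> T" "I m' s'" "T + bcost b + 1 + m' \<le> m"
      using assms(2)[OF less.prems] by (auto simp: runs_def)
    then obtain t' s'' m'' where "exec W (While b P) s' t' s''" "t' \<le> m' + bcost b + 1" "I m'' s''" "\<not> bval W b s''"
      using less.IH[of m' s'] by (auto simp: runs_def)
    with s' exec.WhileTrue[OF True s'(1), of t' s''] show ?thesis
      unfolding runs_def by (intro exI[of _ "1 + bcost b + t + t'"] exI[of _ s'']) auto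
  next
    case False
    then show ?thesis using less.prems exec.WhileFalse[OF False, of P] unfolding runs_def
      by (intro exI[of _ "1 + bcost b"] exI[of _ s]) auto
  qed
qed

lemma runs_While:
  assumes "I s"
    and "\<And>s. I s \<Longrightarrow> bval W b s \<Longrightarrow> \<exists>T. runs W P s T (\<lambda>s'. I s' \<and> T + bcost b + 1 + \<Psi> s' \<le> \<Psi> s)"
  shows "runs W (While b P) s (\<Psi> s + bcost b + 1) (\<lambda>s'. I s' \<and> \<not> bval W b s')"
  using runs_While_budget[of "\<lambda>m s. I s \<and> m = \<Psi> s" "\<Psi> s" s W b P] assms by simp

definition For :: "name \<Rightarrow> name \<Rightarrow> com \<Rightarrow> com" where
  "For v m P = Seq (IAssign v (IConst 0))
    (While (ILess (IVar v) (IVar m)) (Seq P (IAssign v (IAdd (IVar v) (IConst 1)))))"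

lemma mods_For [simp]: "mods (For v m P) = insert v (mods P)"
  by (auto simp: For_def)

text \<open>\<open>\<Psi>\<close> pays for bodies whose running time is only bounded in an amortized sense.\<close>

lemma runs_For_amortized:
  assumes v: "v \<notin> mods P" "m \<notin> mods P" "v \<noteq> m" and N: "ivar s m = N" "N < W"
    and init: "I 0 s"
    and step: "\<And>j s'. j < N \<Longrightarrow> frame (insert v (mods P)) s s' \<Longrightarrow> ivar s' v = j \<Longrightarrow> I j s'
      \<Longrightarrow> \<exists>T'. runs W P s' T' (\<lambda>s''. I (Suc j) s'' \<and> T' + \<Psi> s'' \<le> T + \<Psi> s')"
    and stable: "\<And>j s' x. I j s' \<Longrightarrow> I j (s'\<lparr>ivar := (ivar s')(v := x)\<rparr>)"
      "\<And>s' x. \<Psi> (s'\<lparr>ivar := (ivar s')(v := x)\<rparr>) = \<Psi> s'"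
  shows "runs W (For v m P) s (N * (T + 9) + \<Psi> s + 7) (\<lambda>s'. I N s' \<and> frame (insert v (mods P)) s s')"
proof -
  let ?b = "ILess (IVar v) (IVar m)"
  let ?inc = "IAssign v (IAdd (IVar v) (IConst 1))"
  let ?X = "insert v (mods P)"
  let ?I = "\<lambda>s'. ivar s' v \<le> N \<and> I (ivar s' v) s' \<and> frame ?X s s'"
  \<comment> \<open>Each round adds 9 to the cost of the body: 4 for the test, 1 for the sequencing,
    4 for the increment. The final 7 is made up of the initialization and the last test.\<close>
  let ?F = "\<lambda>s'. (N - ivar s' v) * (T + 9) + \<Psi> s'"
  let ?s0 = "s\<lparr>ivar := (ivar s)(v := 0)\<rparr>"
  have fr0: "frame ?X s (s'\<lparr>ivar := (ivar s')(v := x)\<rparr>)" if "frame ?X s s'" for s' x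
    using that by (auto simp: frame_def)
  have "runs W (While ?b (Seq P ?inc)) ?s0 (?F ?s0 + bcost ?b + 1) (\<lambda>s'. ?I s' \<and> \<not> bval W ?b s')"
  proof (rule runs_While)
    show "?I ?s0" using stable(1)[OF init] fr0[OF frame_refl] by simp
    fix s' assume I: "?I s'" and b: "bval W ?b s'"
    have m: "ivar s' m = N" using I v N by (auto dest: frameD(1)[of _ _ _ m])
    then have j: "ivar s' v < N" using b by simp
    obtain T' where T': "runs W P s' T' (\<lambda>s''. I (Suc (ivar s' v)) s'' \<and> T' + \<Psi> s'' \<le> T + \<Psi> s')"
      using step[OF j _ refl] I by blast
    let ?Q = "\<lambda>s''. ?I s'' \<and> (1 + T' + 4) + bcost ?b + 1 + ?F s'' \<le> ?F s'"
    have "runs W (Seq P ?inc) s' (1 + T' + 4) ?Q"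
    proof (rule runs_Seq[OF runs_frame[OF T']])
      fix s'' assume s'': "(I (Suc (ivar s' v)) s'' \<and> T' + \<Psi> s'' \<le> T + \<Psi> s') \<and> frame (mods P) s' s''"
      then have iv: "ivar s'' v = ivar s' v" using v by (auto dest: frameD)
      have "frame ?X s s''" using frame_trans[of ?X s s' "mods P" s''] I s'' by (simp add: Un_absorb2 subset_insertI)
      then have fr: "frame ?X s (s''\<lparr>ivar := (ivar s'')(v := x)\<rparr>)" for x by (rule fr0)
      have inc: "step W ?inc s'' = s''\<lparr>ivar := (ivar s'')(v := Suc (ivar s' v))\<rparr>" using j N iv by simp
      have "N - ivar s' v = Suc (N - Suc (ivar s' v))" using j by simp
      then have "(N - ivar s' v) * (T + 9) = (T + 9) + (N - Suc (ivar s' v)) * (T + 9)" by simp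
      then show "runs W ?inc s'' 4 ?Q"
        using s'' j fr stable unfolding inc[symmetric] by (intro runs_straight, simp, simp, unfold inc) simp
    qed
    then show "\<exists>T'. runs W (Seq P ?inc) s' T' (\<lambda>s''. ?I s'' \<and> T' + bcost ?b + 1 + ?F s'' \<le> ?F s')" by blast
  qed
  then have w: "runs W (While ?b (Seq P ?inc)) ?s0 (?F ?s0 + bcost ?b + 1) (\<lambda>s'. I N s' \<and> frame ?X s s')"
  proof (rule runs_mono)
    fix s' assume *: "?I s' \<and> \<not> bval W ?b s'"
    then have "ivar s' m = N" using v N by (auto dest: frameD(1)[of _ _ _ m])
    then show "I N s' \<and> frame ?X s s'" using * by auto
  qed simp
  have "runs W (For v m P) s (1 + 2 + (?F ?s0 + bcost ?b + 1)) (\<lambda>s'. I N s' \<and> frame ?X s s')"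
    unfolding For_def
  proof (rule runs_Seq)
    show "runs W (IAssign v (IConst 0)) s 2 (\<lambda>s'. s' = ?s0)" by (rule runs_straight) simp_all
  qed (use w in simp)
  then show ?thesis by (rule runs_mono) (simp_all add: stable)
qed

text \<open>The round number is an argument of \<open>I\<close>; the invariant must be stable under
  changes of the register \<open>v\<close>, since the increment happens outside the body.\<close>

lemma runs_For:
  assumes "v \<notin> mods P" "m \<notin> mods P" "v \<noteq> m" "ivar s m = N" "N < W" "I 0 s"
    and step: "\<And>j s'. j < N \<Longrightarrow> frame (insert v (mods P)) s s' \<Longrightarrow> ivar s' v = j \<Longrightarrow> I j s'
      \<Longrightarrow> runs W P s' T (I (Suc j))"
    and "\<And>j s' x. I j s' \<Longrightarrow> I j (s'\<lparr>ivar := (ivar s')(v := x)\<rparr>)"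
  shows "runs W (For v m P) s (N * (T + 9) + 7) (\<lambda>s'. I N s' \<and> frame (insert v (mods P)) s s')"
proof -
  have "runs W (For v m P) s (N * (T + 9) + 0 + 7) (\<lambda>s'. I N s' \<and> frame (insert v (mods P)) s s')"
  proof (rule runs_For_amortized[where \<Psi> = "\<lambda>_. 0"])
    fix j s' assume "j < N" "frame (insert v (mods P)) s s'" "ivar s' v = j" "I j s'"
    from runs_mono[OF step[OF this] order_refl]
    show "\<exists>T'. runs W P s' T' (\<lambda>s''. I (Suc j) s'' \<and> T' + 0 \<le> T + 0)" by (intro exI[of _ T]) simp
  qed (use assms in auto)
  then show ?thesis by simp
qed

section \<open>Tournament trees\<close>

text \<open>A total preorder in which the smaller key wins and a dead player behaves like one with
  infinite key. The machine has no infinite real number, so removal is recorded by a mark.\<close>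

definition beats :: "(nat \<Rightarrow> bool) \<Rightarrow> (nat \<Rightarrow> real) \<Rightarrow> nat \<Rightarrow> nat \<Rightarrow> bool" where
  "beats dead key a b \<longleftrightarrow> dead b \<or> (\<not> dead a \<and> key a \<le> key b)"

lemma beats_refl: "beats dead key a a" by (auto simp: beats_def)

lemma beats_trans: "beats dead key a b \<Longrightarrow> beats dead key b c \<Longrightarrow> beats dead key a c"
  by (auto simp: beats_def)

lemma not_beats: "\<not> beats dead key a b \<Longrightarrow> beats dead key b a"
  by (auto simp: beats_def)

definition node_ok :: "(nat \<Rightarrow> bool) \<Rightarrow> (nat \<Rightarrow> real) \<Rightarrow> (nat \<Rightarrow> nat) \<Rightarrow> nat \<Rightarrow> bool" where
  "node_ok dead key t q \<longleftrightarrow> t q \<in> {t (2 * q), t (2 * q + 1)}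
    \<and> beats dead key (t q) (t (2 * q)) \<and> beats dead key (t q) (t (2 * q + 1))"

text \<open>A tournament among \<open>N\<close> players: the inner nodes are \<open>1, \<dots>, N - 1\<close>, node \<open>q\<close> has the children
  \<open>2q\<close> and \<open>2q + 1\<close>, and player \<open>g\<close> sits at the leaf \<open>N + g\<close>. \<open>N\<close> need not be a power of two.\<close>

definition rematch :: "(nat \<Rightarrow> bool) \<Rightarrow> (nat \<Rightarrow> real) \<Rightarrow> (nat \<Rightarrow> nat) \<Rightarrow> nat \<Rightarrow> (nat \<Rightarrow> nat)" where
  "rematch dead key t q =
    t(q := if beats dead key (t (2 * q)) (t (2 * q + 1)) then t (2 * q) else t (2 * q + 1))"

lemma rematch_leaf: "q < N \<Longrightarrow> rematch dead key t q (N + g) = t (N + g)"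
  by (simp add: rematch_def)

lemma node_ok_rematch: "1 \<le> q \<Longrightarrow> node_ok dead key (rematch dead key t q) q"
  using not_beats[of dead key "t (2 * q)" "t (2 * q + 1)"]
  by (auto simp: node_ok_def rematch_def beats_refl)

text \<open>Entry \<open>q\<close> of the tree matters only to node \<open>q\<close> and to its
  parent \<open>q div 2\<close>.\<close>

lemma node_ok_rematch_other:
  "node_ok dead key t q' \<Longrightarrow> q' \<noteq> q \<Longrightarrow> q' \<noteq> q div 2 \<Longrightarrow> node_ok dead key (rematch dead key t q) q'"
proof -
  assume "q' \<noteq> q" "q' \<noteq> q div 2" "node_ok dead key t q'"
  moreover from this have "2 * q' \<noteq> q" "2 * q' + 1 \<noteq> q" by auto
  ultimately show ?thesis by (simp add: node_ok_def rematch_def)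
qed

text \<open>Repeated halving leads from any \<open>p\<close> to the root, and \<open>beats\<close>
  is transitive along this path. Leaves may sit at different depths, so any \<open>N\<close> is
  covered.\<close>

lemma root_beats_all:
  assumes "\<And>q. 1 \<le> q \<Longrightarrow> q < N \<Longrightarrow> node_ok dead key t q" "1 \<le> p" "p < 2 * N"
  shows "beats dead key (t 1) (t p)"
  using assms(2,3)
proof (induction p rule: less_induct)
  case (less p)
  show ?case
  proof (cases "p = 1")
    case False
    then have q: "p div 2 < p" "1 \<le> p div 2" "p div 2 < N" using less.prems by auto
    have "p = 2 * (p div 2) \<or> p = 2 * (p div 2) + 1" by presburger
    then have "beats dead key (t (p div 2)) (t p)" using assms(1)[OF q(2,3)] by (auto simp: node_ok_def)
    moreover have "beats dead key (t 1) (t (p div 2))" using less.IH[OF q(1,2)] q(3) less.prems by simp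
    ultimately show ?thesis by (blast intro: beats_trans)
  qed (simp add: beats_refl)
qed

text \<open>Following the winner downwards from \<open>p\<close> ends at its own leaf. So every node
  displaying a player is an ancestor of that player's leaf, which tells what has to be replayed
  after a death.\<close>

lemma node_player:
  fixes t :: "nat \<Rightarrow> nat"
  assumes "\<And>q. 1 \<le> q \<Longrightarrow> q < N \<Longrightarrow> t q \<in> {t (2 * q), t (2 * q + 1)}" "\<And>g. g < N \<Longrightarrow> t (N + g) = g"
    and "1 \<le> p" "p < 2 * N"
  shows "t p < N \<and> (\<exists>e. p = (N + t p) div 2 ^ e)"
  using assms(3,4)
proof (induction "2 * N - p" arbitrary: p rule: less_induct)
  case less
  show ?case
  proof (cases "p < N")
    case True
    then obtain c where c: "c = 2 * p \<or> c = 2 * p + 1" "t p = t c" using assms(1)[of p] less.prems by blast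
    then have "c < 2 * N" "1 \<le> c" "2 * N - c < 2 * N - p" using True less.prems by auto
    then obtain e where e: "t c < N" "c = (N + t c) div 2 ^ e" using less.hyps[of c] by blast
    have "p = c div 2" using c(1) by auto
    also have "\<dots> = (N + t p) div 2 ^ Suc e"
      unfolding c(2) by (subst e(2)) (simp add: power_Suc2 div_mult2_eq del: power_Suc)
    finally show ?thesis using e c(2) by metis
  next
    case False
    then have "t p = p - N" using assms(2)[of "p - N"] less.prems by simp
    then show ?thesis using False less.prems by (intro conjI exI[of _ 0]) auto
  qed
qed

text \<open>One step of the repair: if only ancestors of \<open>p\<close>, including
  \<open>p\<close>, are in disorder, then replaying \<open>p\<close> mends it and can disturb only
  its parent. The disorder moves up one level.\<close>

lemma rematch_path:
  assumes "\<And>q. 1 \<le> q \<Longrightarrow> q < N \<Longrightarrow> node_ok dead key t q \<or> (\<exists>e. q = p div 2 ^ e)" "1 \<le> p"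
    and "1 \<le> q" "q < N"
  shows "node_ok dead key (rematch dead key t p) q \<or> (\<exists>e. q = (p div 2) div 2 ^ e)"
proof (cases "q = p")
  case True
  then show ?thesis using node_ok_rematch[OF assms(2), of dead key t] by simp
next
  case qp: False
  show ?thesis
  proof (cases "q = p div 2")
    case True
    then show ?thesis by (intro disjI2 exI[of _ 0]) simp
  next
    case False
    from assms(1)[OF assms(3,4)] show ?thesis
    proof
      assume "\<exists>e. q = p div 2 ^ e"
      then obtain e where e: "q = p div 2 ^ e" by blast
      then obtain e' where "e = Suc e'" using qp by (cases e) auto
      then have "q = (p div 2) div 2 ^ e'" using e by (simp add: div_mult2_eq)
      then show ?thesis by blast
    qed (use node_ok_rematch_other qp False in blast)
  qed
qed

text \<open>Where \<open>w\<close> is not on display, its death only makes the match easier for the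
  displayed player. The inner nodes displaying \<open>w\<close> are proper ancestors of the leaf
  \<open>N + w\<close>, so the replay starts at \<open>(N + w) div 2\<close>.\<close>

lemma kill_winner:
  assumes "\<And>q. 1 \<le> q \<Longrightarrow> q < N \<Longrightarrow> node_ok dead key t q" "\<And>g. g < N \<Longrightarrow> t (N + g) = g"
    and "1 \<le> q" "q < N"
  shows "node_ok (dead(w := True)) key t q \<or> (\<exists>e. q = ((N + w) div 2) div 2 ^ e)"
proof (cases "t q = w")
  case True
  have "t p \<in> {t (2 * p), t (2 * p + 1)}" if "1 \<le> p" "p < N" for p
    using assms(1)[OF that] by (simp add: node_ok_def)
  then have "\<exists>e. q = (N + t q) div 2 ^ e"
    using node_player[of N t q] assms(2-4) by auto
  then obtain e where e: "q = (N + w) div 2 ^ e" using True by auto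
  then obtain e' where "e = Suc e'" using assms(4) by (cases e) auto
  then have "q = ((N + w) div 2) div 2 ^ e'" using e by (simp add: div_mult2_eq)
  then show ?thesis by blast
next
  case False
  then show ?thesis using assms(1)[OF assms(3,4)] by (auto simp: node_ok_def beats_def)
qed

section \<open>The sketching program\<close>

text \<open>\<open>L\<close> becomes \<open>floorlog 2 n\<close>, found by doubling, and
  \<open>N\<close> the number of signed buckets: two signs, \<open>2 * L\<close> rows,
  \<open>64 * k\<close> buckets.\<close>

definition set_thresholds :: com where
  "set_thresholds =
    Seq (IAssign ''L'' (IConst 0)) (Seq (IAssign ''pow'' (IConst 1))
   (Seq (While (BNot (ILess (IVar ''n'') (IVar ''pow'')))
      (Seq (IAssign ''pow'' (IAdd (IVar ''pow'') (IVar ''pow'')))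
        (IAssign ''L'' (IAdd (IVar ''L'') (IConst 1)))))
    (IAssign ''N'' (IMul (IMul (IConst 256) (IVar ''k'')) (IVar ''L'')))))"

definition copy_input :: com where
  "copy_input = For ''i'' ''n'' (RStore ''out'' (IVar ''i'') (RArr ''in'' (IVar ''i'')))"

text \<open>There are \<open>d\<close> rows of \<open>B\<close> buckets, hence \<open>DB\<close>
  cells; \<open>M\<close> is the number of pairs of a row and a coordinate.\<close>

definition set_constants :: com where
  "set_constants =
    Seq (IAssign ''d'' (IAdd (IVar ''L'') (IVar ''L'')))
   (Seq (IAssign ''B'' (IMul (IConst 64) (IVar ''k'')))
   (Seq (IAssign ''DB'' (IMul (IVar ''d'') (IVar ''B'')))
    (IAssign ''M'' (IMul (IVar ''d'') (IVar ''n'')))))"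

definition load_cell :: com where
  "load_cell =
    Seq (IAssign ''w'' (IArr ''rand'' (IVar ''j'')))
    (IAssign ''e'' (IAdd (IMul (IDiv (IVar ''j'') (IVar ''n'')) (IVar ''B''))
      (IMod (IDiv (IVar ''w'') (IConst 2)) (IVar ''B''))))"

definition even_w :: bexp where
  "even_w = ILess (IMod (IVar ''w'') (IConst 2)) (IConst 1)"

definition add_to_cells :: com where
  "add_to_cells = For ''j'' ''M'' (Seq load_cell (Cond even_w
    (RStore ''out'' (IVar ''e'') (RAdd (RArr ''out'' (IVar ''e'')) (RArr ''in'' (IMod (IVar ''j'') (IVar ''n'')))))
    (RStore ''out'' (IVar ''e'') (RSub (RArr ''out'' (IVar ''e'')) (RArr ''in'' (IMod (IVar ''j'') (IVar ''n'')))))))"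

text \<open>A sampled coordinate is linear in the input, so the samples are further rows of the
  sketch, stored behind the \<open>DB\<close> cells. They use the words from \<open>M\<close>
  on.\<close>

definition take_samples :: com where
  "take_samples = For ''t'' ''d'' (RStore ''out'' (IAdd (IVar ''DB'') (IVar ''t''))
    (RArr ''in'' (IMod (IArr ''rand'' (IAdd (IVar ''M'') (IVar ''t''))) (IVar ''n''))))"

definition sketch_prog :: com where
  "sketch_prog = Seq set_thresholds (Cond (ILess (IVar ''n'') (IVar ''N'')) copy_input
    (Seq set_constants (Seq add_to_cells take_samples)))"

locale sketch_params =
  fixes n k W h :: nat
  assumes n: "2 \<le> n" and k: "1 \<le> k" "k < n" and h: "h = floorlog 2 n" and W: "W = 2 ^ (8 * h)"
begin

lemma n_less_pow: "n < 2 ^ h"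
  using floorlog_bounds[of n 2] n by (simp add: h)

lemma h_ge: "2 \<le> h"
proof (rule ccontr)
  assume "\<not> 2 \<le> h"
  then have "(2::nat) ^ h \<le> 2 ^ 1" by (intro power_increasing) auto
  then show False using n_less_pow n by simp
qed

lemma h_less: "h < 2 ^ h" by (rule less_exp)

text \<open>As \<open>h \<ge> 2\<close>, the constant 256 is at most \<open>2 ^ (4 * h)\<close>, and
  each factor has at most \<open>h\<close> bits. Words of \<open>8 * h\<close> bits thus hold all
  addresses and counters without wrapping around.\<close>

lemma mult_less_W:
  assumes ab: "a < 2 ^ h" "b < 2 ^ h"
  shows "256 * a * b < W"
proof -
  have "(2::nat) ^ 8 \<le> 2 ^ (4 * h)" using h_ge by (intro power_increasing) auto
  then have "256 * (a * b) \<le> 2 ^ (4 * h) * (a * b)" by (intro mult_right_mono) auto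
  also have "\<dots> < 2 ^ (4 * h) * (2 ^ h * 2 ^ h)" using ab by (intro mult_strict_left_mono mult_strict_mono) auto
  also have "\<dots> = (2::nat) ^ (4 * h + (h + h))" by (simp only: power_add)
  also have "\<dots> \<le> W" unfolding W by (intro power_increasing) auto
  finally show ?thesis by (simp add: mult.assoc)
qed

lemma bounds: "256 * k * h < W" "256 * k < W" "256 * h * n < W" "256 * n < W" "256 * h < W" "256 < W"
proof -
  have "1 < (2::nat) ^ h" using h_ge by (intro one_less_power) auto
  then show "256 * k * h < W" "256 * k < W" "256 * h * n < W" "256 * n < W" "256 * h < W" "256 < W"
    using mult_less_W[of k h] mult_less_W[of k 1] mult_less_W[of h n] mult_less_W[of n 1] mult_less_W[of h 1]
      mult_less_W[of 1 1] n_less_pow h_less k by simp_all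
qed

lemma runs_set_thresholds:
  assumes "ivar s ''n'' = n" "ivar s ''k'' = k"
  shows "runs W set_thresholds s (16 * h + 20)
    (\<lambda>s'. (ivar s' ''L'' = h \<and> ivar s' ''N'' = 256 * k * h) \<and> frame {''L'', ''pow'', ''N''} s s')"
proof -
  let ?b = "BNot (ILess (IVar ''n'') (IVar ''pow''))"
  let ?P = "Seq (IAssign ''pow'' (IAdd (IVar ''pow'') (IVar ''pow''))) (IAssign ''L'' (IAdd (IVar ''L'') (IConst 1)))"
  let ?I = "\<lambda>s :: state. ivar s ''L'' \<le> h \<and> ivar s ''pow'' = 2 ^ ivar s ''L'' \<and> ivar s ''n'' = n \<and> ivar s ''k'' = k"
  let ?\<Psi> = "\<lambda>s :: state. (h - ivar s ''L'') * 16"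
  have loop: "runs W (While ?b ?P) s (?\<Psi> s + bcost ?b + 1) (\<lambda>s'. ?I s' \<and> \<not> bval W ?b s')" if "?I s" for s
  proof (rule runs_While)
    fix s' assume I: "?I s'" and b: "bval W ?b s'"
    define l where "l = ivar s' ''L''"
    have le: "2 ^ l \<le> n" using I b by (simp add: l_def)
    then have "l \<noteq> h" using n_less_pow by auto
    then have l: "l < h" using I by (simp add: l_def)
    have mods: "(2 ^ l + 2 ^ l) mod W = 2 * 2 ^ l" "(l + 1 mod W) mod W = Suc l"
      using le l bounds by auto
    have "runs W ?P s' 9 (\<lambda>s''. ?I s'' \<and> 9 + bcost ?b + 1 + ?\<Psi> s'' \<le> ?\<Psi> s')"
      using I l mods[folded l_def] by (intro runs_straight) (simp_all flip: l_def)
    then show "\<exists>T. runs W ?P s' T (\<lambda>s''. ?I s'' \<and> T + bcost ?b + 1 + ?\<Psi> s'' \<le> ?\<Psi> s')" by blast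
  qed fact
  \<comment> \<open>The loop cannot stop earlier, because \<open>2 ^ (h - 1) \<le> n\<close> by the
    definition of \<open>floorlog\<close>.\<close>
  have lh: "ivar s ''L'' = h" if "?I s" "\<not> bval W ?b s" for s
  proof (rule ccontr)
    assume "ivar s ''L'' \<noteq> h"
    then have "(2::nat) ^ ivar s ''L'' \<le> 2 ^ (h - 1)" using that(1) by (intro power_increasing) auto
    also have "\<dots> \<le> n" using floorlog_bounds[of n 2] n by (simp add: h)
    finally show False using that by simp
  qed
  have "runs W set_thresholds s (1 + 2 + (1 + 2 + (1 + (16 * h + 5) + 6)))
    (\<lambda>s'. (ivar s' ''L'' = h \<and> ivar s' ''N'' = 256 * k * h))"
    unfolding set_thresholds_def
  proof (intro runs_Seq)
    show "runs W (IAssign ''L'' (IConst 0)) s 2 (\<lambda>s'. ivar s' ''L'' = 0 \<and> ivar s' ''n'' = n \<and> ivar s' ''k'' = k)"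
      using assms by (intro runs_straight) auto
    fix s' :: state assume s': "ivar s' ''L'' = 0 \<and> ivar s' ''n'' = n \<and> ivar s' ''k'' = k"
    show "runs W (IAssign ''pow'' (IConst 1)) s' 2 (\<lambda>s''. ?I s'' \<and> ivar s'' ''L'' = 0)"
      using s' bounds by (intro runs_straight) auto
    fix s'' :: state assume s'': "?I s'' \<and> ivar s'' ''L'' = 0"
    show "runs W (While ?b ?P) s'' (16 * h + 5) (\<lambda>s'. ?I s' \<and> \<not> bval W ?b s')"
      by (rule runs_mono[OF loop]) (use s'' in auto)
    fix s3 :: state assume s3: "?I s3 \<and> \<not> bval W ?b s3"
    then have "ivar s3 ''L'' = h" using lh by blast
    then show "runs W (IAssign ''N'' (IMul (IMul (IConst 256) (IVar ''k'')) (IVar ''L''))) s3 6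
        (\<lambda>s'. ivar s' ''L'' = h \<and> ivar s' ''N'' = 256 * k * h)"
      using s3 bounds by (intro runs_straight) auto
  qed
  from runs_frame[OF this] show ?thesis
    by (rule runs_mono) (auto simp: set_thresholds_def insert_commute)
qed

lemma runs_copy_input:
  assumes "ivar s ''n'' = n"
  shows "runs W copy_input s (n * 14 + 7) (\<lambda>s'. \<forall>i<n. rarr s' ''out'' i = rarr s ''in'' i)"
proof -
  have "runs W copy_input s (n * (5 + 9) + 7)
    (\<lambda>s'. (\<forall>i<n. rarr s' ''out'' i = rarr s ''in'' i) \<and> frame (insert ''i'' (mods (RStore ''out'' (IVar ''i'') (RArr ''in'' (IVar ''i''))))) s s')"
    unfolding copy_input_def
  proof (rule runs_For[where I = "\<lambda>j s'. \<forall>i<j. rarr s' ''out'' i = rarr s ''in'' i"])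
    fix j s' assume *: "j < n" "frame (insert ''i'' (mods (RStore ''out'' (IVar ''i'') (RArr ''in'' (IVar ''i''))))) s s'"
      "ivar s' ''i'' = j" "\<forall>i<j. rarr s' ''out'' i = rarr s ''in'' i"
    then have "rarr s' ''in'' = rarr s ''in''" by (auto dest: frameD)
    then show "runs W (RStore ''out'' (IVar ''i'') (RArr ''in'' (IVar ''i''))) s' 5 (\<lambda>s''. \<forall>i<Suc j. rarr s'' ''out'' i = rarr s ''in'' i)"
      using * by (intro runs_straight) (auto simp: less_Suc_eq)
  qed (use assms bounds in auto)
  then show ?thesis by (rule runs_mono) auto
qed

end

text \<open>At most \<open>n\<close> signed buckets. This bound serves two ends: sorting them costs
  only \<open>O(n log n)\<close>, and it yields \<open>64 * k \<le> n\<close>, so that few samples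
  hit outliers.\<close>

locale sketch_mode = sketch_params +
  assumes mode: "256 * k * h \<le> n"
begin

definition env :: "(nat \<Rightarrow> nat) \<Rightarrow> state \<Rightarrow> bool" where
  "env \<omega> s \<longleftrightarrow> ivar s ''n'' = n \<and> ivar s ''k'' = k \<and> ivar s ''L'' = h \<and> ivar s ''d'' = 2 * h \<and> ivar s ''B'' = 64 * k
    \<and> ivar s ''DB'' = 128 * k * h \<and> ivar s ''N'' = 256 * k * h \<and> ivar s ''M'' = 2 * h * n \<and> iarr s ''rand'' = \<omega>"

lemma env_frame:
  assumes "env \<omega> s" "frame X s s'" "X \<inter> {''n'', ''k'', ''L'', ''d'', ''B'', ''DB'', ''N'', ''M'', ''rand''} = {}"
  shows "env \<omega> s'"
  using assms by (auto simp: env_def frame_def)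

lemma env_upd [simp]:
  "v \<notin> {''n'', ''k'', ''L'', ''d'', ''B'', ''DB'', ''N'', ''M'', ''rand''} \<Longrightarrow> env \<omega> (s\<lparr>ivar := (ivar s)(v := x)\<rparr>) = env \<omega> s"
  by (auto simp: env_def)

lemma runs_set_constants:
  assumes "ivar s ''n'' = n" "ivar s ''k'' = k" "ivar s ''L'' = h" "ivar s ''N'' = 256 * k * h" "iarr s ''rand'' = \<omega>"
  shows "runs W set_constants s 19 (\<lambda>s'. env \<omega> s' \<and> frame {''d'', ''B'', ''DB'', ''M''} s s')"
proof -
  have "h + h < W" "64 * k < W" "64 < W" "128 * k * h < W" "2 * h * n < W"
    using bounds by linarith+
  then have "(h + h) mod W = 2 * h" "64 * k mod W = 64 * k" "(h + h) * (64 * k) mod W = 128 * k * h"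
    "(h + h) * n mod W = 2 * h * n" "64 mod W = 64"
    "128 * (h * k) mod W = 128 * k * h" "2 * h * n mod W = 2 * h * n"
    by (simp_all add: mult_ac flip: mult_2)
  then show ?thesis using assms
    by (intro runs_straight) (simp_all add: set_constants_def env_def frame_def)
qed

lemma cell_less: "j < 2 * h * n \<Longrightarrow> cell n (64 * k) \<omega> j < 128 * k * h"
proof -
  assume "j < 2 * h * n"
  then have "j div n < 2 * h" by (simp add: less_mult_imp_div_less)
  then have "Suc (j div n) * (64 * k) \<le> 2 * h * (64 * k)" by (intro mult_right_mono) auto
  moreover have "bucket_of (64 * k) (\<omega> j) < 64 * k" using k by (simp add: bucket_of_def)
  ultimately show ?thesis by (simp add: cell_def algebra_simps)
qed

lemma load_cell_simps [simp]:
  "straight load_cell" "max_cost load_cell = 16" "mods load_cell = {''w'', ''e''}" "bcost even_w = 5"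
  by (auto simp: load_cell_def even_w_def)

lemma step_load_cell:
  assumes "env \<omega> s" "ivar s ''j'' = j" "j < 2 * h * n"
  shows "step W load_cell s = s\<lparr>ivar := (ivar s)(''w'' := \<omega> j, ''e'' := cell n (64 * k) \<omega> j)\<rparr>"
proof -
  have "cell n (64 * k) \<omega> j < W" using cell_less[OF assms(3), of \<omega>] bounds by linarith
  then have "j div n * (64 * k) + (\<omega> j div 2) mod (64 * k) < W" by (simp add: cell_def bucket_of_def)
  moreover from this have "j div n * (64 * k) < W" by linarith
  moreover have "2 < W" using bounds by linarith
  ultimately show ?thesis using assms
    by (simp add: load_cell_def env_def cell_def bucket_of_def)
qed

lemma cell_sum_Suc:
  "cell_sum (Suc j) n B \<omega> x = (\<lambda>a. cell_sum j n B \<omega> x a + (if cell n B \<omega> j = a then sign_of (\<omega> j) * x (j mod n) else 0))"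
  by (simp add: cell_sum_def fun_eq_iff)

lemma even_w_iff: "bval W even_w s \<longleftrightarrow> even (ivar s ''w'')"
  using bounds by (auto simp: even_w_def even_iff_mod_2_eq_zero)

lemma runs_add_to_cells:
  assumes "env \<omega> s" "rarr s ''out'' = (\<lambda>_. 0)"
  shows "runs W add_to_cells s (2 * h * n * 49 + 7) (\<lambda>s'.
    rarr s' ''out'' = cell_sum (2 * h * n) n (64 * k) \<omega> (rarr s ''in'') \<and> frame {''j'', ''w'', ''e'', ''out''} s s')"
proof -
  let ?P = "Seq load_cell (Cond even_w
    (RStore ''out'' (IVar ''e'') (RAdd (RArr ''out'' (IVar ''e'')) (RArr ''in'' (IMod (IVar ''j'') (IVar ''n'')))))
    (RStore ''out'' (IVar ''e'') (RSub (RArr ''out'' (IVar ''e'')) (RArr ''in'' (IMod (IVar ''j'') (IVar ''n''))))))"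
  have m: "insert ''j'' (mods ?P) = {''j'', ''w'', ''e'', ''out''}" by auto
  have "runs W add_to_cells s (2 * h * n * (40 + 9) + 7) (\<lambda>s'.
    rarr s' ''out'' = cell_sum (2 * h * n) n (64 * k) \<omega> (rarr s ''in'') \<and> frame (insert ''j'' (mods ?P)) s s')"
    unfolding add_to_cells_def
  proof (rule runs_For[where I = "\<lambda>j s'. rarr s' ''out'' = cell_sum j n (64 * k) \<omega> (rarr s ''in'')"])
    show "rarr s ''out'' = cell_sum 0 n (64 * k) \<omega> (rarr s ''in'')" using assms(2) by (simp add: cell_sum_def fun_eq_iff)
    fix j s' assume *: "j < 2 * h * n" "frame (insert ''j'' (mods ?P)) s s'" "ivar s' ''j'' = j"
      "rarr s' ''out'' = cell_sum j n (64 * k) \<omega> (rarr s ''in'')"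
    have e: "env \<omega> s'" using assms(1) *(2) unfolding m by (rule env_frame) auto
    have i: "rarr s' ''in'' = rarr s ''in''" "ivar s' ''n'' = n" using frameD(4)[OF *(2)[unfolded m]] e by (simp_all add: env_def)
    show "runs W ?P s' 40 (\<lambda>s''. rarr s'' ''out'' = cell_sum (Suc j) n (64 * k) \<omega> (rarr s ''in''))"
    proof (rule runs_straight)
      show "rarr (step W ?P s') ''out'' = cell_sum (Suc j) n (64 * k) \<omega> (rarr s ''in'')"
        unfolding step.simps step_load_cell[OF e *(3,1)] even_w_iff cell_sum_Suc
        by (rule ext) (simp add: *(3,4) i sign_of_def)
    qed simp_all
  qed (use assms bounds in \<open>auto simp: env_def load_cell_def\<close>)
  then show ?thesis unfolding m by simp
qed

lemma runs_take_samples: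
  assumes "env \<omega> s"
  shows "runs W take_samples s (2 * h * 20 + 7) (\<lambda>s'.
    (\<forall>a. rarr s' ''out'' a = (if 128 * k * h \<le> a \<and> a < 128 * k * h + 2 * h
      then rarr s ''in'' (\<omega> (2 * h * n + (a - 128 * k * h)) mod n) else rarr s ''out'' a))
    \<and> frame {''t'', ''out''} s s')"
proof -
  let ?P = "RStore ''out'' (IAdd (IVar ''DB'') (IVar ''t''))
    (RArr ''in'' (IMod (IArr ''rand'' (IAdd (IVar ''M'') (IVar ''t''))) (IVar ''n'')))"
  let ?I = "\<lambda>j s'. \<forall>a. rarr s' ''out'' a = (if 128 * k * h \<le> a \<and> a < 128 * k * h + j
      then rarr s ''in'' (\<omega> (2 * h * n + (a - 128 * k * h)) mod n) else rarr s ''out'' a)"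
  have "runs W take_samples s (2 * h * (11 + 9) + 7) (\<lambda>s'. ?I (2 * h) s' \<and> frame (insert ''t'' (mods ?P)) s s')"
    unfolding take_samples_def
  proof (rule runs_For[where I = ?I])
    fix j s' assume *: "j < 2 * h" "frame (insert ''t'' (mods ?P)) s s'" "ivar s' ''t'' = j" "?I j s'"
    have e: "env \<omega> s'" using assms(1) *(2) by (rule env_frame) auto
    have i: "rarr s' ''in'' = rarr s ''in''" using *(2) by (auto dest: frameD)
    have "128 * k * h + j < W" "2 * h * n + j < W"
      using *(1) bounds mode n k by (auto intro: order.strict_trans1[of _ "256 * k * h"] order.strict_trans1[of _ "256 * h * n"])
    then show "runs W ?P s' 11 (?I (Suc j))"
      using *(3,4) i e by (intro runs_straight) (auto simp: env_def)
  qed (use assms bounds in \<open>auto simp: env_def\<close>)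
  then show ?thesis by (rule runs_mono) auto
qed

lemma runs_sketch:
  assumes "ivar s ''n'' = n" "ivar s ''k'' = k" "iarr s ''rand'' = \<omega>" "rarr s ''out'' = (\<lambda>_. 0)"
  shows "runs W sketch_prog s (400 * (h * n)) (\<lambda>s'.
    \<forall>a < 128 * k * h + 2 * h. rarr s' ''out'' a = (if a < 128 * k * h
      then cell_sum (2 * h * n) n (64 * k) \<omega> (rarr s ''in'') a
      else rarr s ''in'' (\<omega> (2 * h * n + (a - 128 * k * h)) mod n)))" (is "runs _ _ _ _ ?Q")
proof -
  let ?T = "2 * h * n * 49 + 7"
  let ?T' = "2 * h * 20 + 7"
  have "runs W sketch_prog s (1 + (16 * h + 20) + (1 + 3 + (1 + 19 + (1 + ?T + ?T')))) ?Q"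
    unfolding sketch_prog_def
  proof (rule runs_Seq[OF runs_set_thresholds[OF assms(1,2)]])
    fix s1 :: state
    assume s1: "(ivar s1 ''L'' = h \<and> ivar s1 ''N'' = 256 * k * h) \<and> frame {''L'', ''pow'', ''N''} s s1"
    have c: "ivar s1 ''n'' = n" "ivar s1 ''k'' = k" "ivar s1 ''L'' = h" "ivar s1 ''N'' = 256 * k * h" "iarr s1 ''rand'' = \<omega>"
      and o1: "rarr s1 ''out'' = (\<lambda>_. 0)" "rarr s1 ''in'' = rarr s ''in''"
      using s1 assms frameD[OF conjunct2[OF s1]] by simp_all
    have "runs W (Seq set_constants (Seq add_to_cells take_samples)) s1 (1 + 19 + (1 + ?T + ?T')) ?Q"
    proof (rule runs_Seq[OF runs_set_constants[OF c]])
      fix s2 assume s2: "env \<omega> s2 \<and> frame {''d'', ''B'', ''DB'', ''M''} s1 s2"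
      have o2: "rarr s2 ''out'' = (\<lambda>_. 0)" "rarr s2 ''in'' = rarr s ''in''"
        using o1 frameD[OF conjunct2[OF s2]] by simp_all
      show "runs W (Seq add_to_cells take_samples) s2 (1 + ?T + ?T') ?Q"
      proof (rule runs_Seq[OF runs_add_to_cells[OF conjunct1[OF s2] o2(1)]])
        fix s3 assume s3: "rarr s3 ''out'' = cell_sum (2 * h * n) n (64 * k) \<omega> (rarr s2 ''in'')
          \<and> frame {''j'', ''w'', ''e'', ''out''} s2 s3"
        have e3: "env \<omega> s3" by (rule env_frame[OF conjunct1[OF s2] conjunct2[OF s3]]) simp
        have o3: "rarr s3 ''in'' = rarr s ''in''" using o2 frameD[OF conjunct2[OF s3]] by simp
        show "runs W take_samples s3 ?T' ?Q"
          by (rule runs_mono[OF runs_take_samples[OF e3]]) (use s3 o2 o3 in auto)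
      qed
    qed
    then show "runs W (Cond (ILess (IVar ''n'') (IVar ''N'')) copy_input
      (Seq set_constants (Seq add_to_cells take_samples))) s1 (1 + 3 + (1 + 19 + (1 + ?T + ?T'))) ?Q"
      using runs_Cond[of W "ILess (IVar ''n'') (IVar ''N'')" s1 copy_input "1 + 19 + (1 + ?T + ?T')" ?Q
        "Seq set_constants (Seq add_to_cells take_samples)"] c mode by simp
  qed
  moreover have "h \<le> h * n" "4 \<le> h * n" "2 * h * n = 2 * (h * n)" using n mult_mono[OF h_ge n] by simp_all
  ultimately show ?thesis by (elim runs_mono) linarith+
qed

end

lemma (in sketch_params) runs_sketch_copy:
  assumes "n < 256 * k * h" "ivar s ''n'' = n" "ivar s ''k'' = k"
  shows "runs W sketch_prog s (400 * (h * n)) (\<lambda>s'. \<forall>i<n. rarr s' ''out'' i = rarr s ''in'' i)" (is "runs _ _ _ _ ?Q")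
proof -
  have "runs W sketch_prog s (1 + (16 * h + 20) + (1 + 3 + (n * 14 + 7))) ?Q"
    unfolding sketch_prog_def
  proof (rule runs_Seq[OF runs_set_thresholds[OF assms(2,3)]])
    fix s1 :: state
    assume s1: "(ivar s1 ''L'' = h \<and> ivar s1 ''N'' = 256 * k * h) \<and> frame {''L'', ''pow'', ''N''} s s1"
    have c: "ivar s1 ''n'' = n" "ivar s1 ''N'' = 256 * k * h" "rarr s1 ''in'' = rarr s ''in''"
      using s1 assms frameD[OF conjunct2[OF s1]] by simp_all
    show "runs W (Cond (ILess (IVar ''n'') (IVar ''N'')) copy_input
      (Seq set_constants (Seq add_to_cells take_samples))) s1 (1 + 3 + (n * 14 + 7)) ?Q"
      using runs_Cond[of W "ILess (IVar ''n'') (IVar ''N'')" s1 copy_input "n * 14 + 7" ?Q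
        "Seq set_constants (Seq add_to_cells take_samples)"] runs_copy_input[OF c(1)] c assms(1) by simp
  qed
  moreover have "h \<le> h * n" "n \<le> h * n" "4 \<le> h * n" using n h_ge mult_mono[OF h_ge n] by simp_all
  ultimately show ?thesis by (elim runs_mono) linarith+
qed

section \<open>The recovery program: bias and bucket lists\<close>

text \<open>Take the largest entry with fewer than \<open>h\<close> entries below it. If fewer than
  \<open>h\<close> entries were at most as large, some entry would be larger, and the least such one
  would also have fewer than \<open>h\<close> entries below it.\<close>

lemma is_med_exists:
  assumes "finite A" "0 < h" "h \<le> card A"
  shows "\<exists>a\<in>A. is_med h A f (f a)"
proof -
  let ?C = "{a \<in> A. card {b \<in> A. f b < f a} < h}"
  have "A \<noteq> {}" using assms by auto
  then have "Min (f ` A) \<in> f ` A" using assms(1) by (intro Min_in) auto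
  then obtain m where m: "m \<in> A" "f m = Min (f ` A)" by auto
  have e: "{b \<in> A. f b < f m} = {}" using assms(1) m by (auto simp: not_less)
  have "card {b \<in> A. f b < f m} < h" unfolding e using assms(2) by simp
  then have C: "?C \<noteq> {}" "finite ?C" using m assms(1) by auto
  then have "Max (f ` ?C) \<in> f ` ?C" by (intro Max_in) auto
  then obtain a where a: "a \<in> ?C" "f a = Max (f ` ?C)" by (metis (no_types, lifting) imageE)
  have "h \<le> card {b \<in> A. f b \<le> f a}"
  proof (rule ccontr)
    assume *: "\<not> h \<le> card {b \<in> A. f b \<le> f a}"
    let ?D = "{b \<in> A. f a < f b}"
    have "?D \<noteq> {}"
    proof
      assume "?D = {}"
      then have "{b \<in> A. f b \<le> f a} = A" by (auto simp: not_less)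
      then show False using * assms(3) by simp
    qed
    then have "Min (f ` ?D) \<in> f ` ?D" using assms(1) by (intro Min_in) auto
    then obtain c where c: "c \<in> ?D" "f c = Min (f ` ?D)" by (metis (no_types, lifting) imageE)
    have "{b \<in> A. f b < f c} \<subseteq> {b \<in> A. f b \<le> f a}"
    proof
      fix b assume b: "b \<in> {b \<in> A. f b < f c}"
      have "f c \<le> f b" if "b \<in> ?D" using that assms(1) unfolding c(2) by (intro Min_le) auto
      then have "b \<notin> ?D" using b by auto
      then show "b \<in> {b \<in> A. f b \<le> f a}" using b by auto
    qed
    then have "card {b \<in> A. f b < f c} \<le> card {b \<in> A. f b \<le> f a}" using assms(1) by (intro card_mono) auto
    then have "c \<in> ?C" using * c by simp
    then have "f c \<le> f a" using C(2) a(2) by simp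
    then show False using c by simp
  qed
  moreover have "a \<in> A" "card {b \<in> A. f b < f a} < h" using a(1) by auto
  ultimately show ?thesis unfolding is_med_def by blast
qed

text \<open>Pointers are stored increased by one, so that 0, the initial content of every array, is
  the null pointer.\<close>

fun linked :: "(nat \<Rightarrow> nat) \<Rightarrow> nat \<Rightarrow> nat list \<Rightarrow> bool" where
  "linked nx p [] \<longleftrightarrow> p = 0"
| "linked nx p (x # xs) \<longleftrightarrow> p = Suc x \<and> linked nx (nx x) xs"

lemma linked_upd: "x \<notin> set xs \<Longrightarrow> linked (nx(x := v)) p xs = linked nx p xs"
  by (induction xs arbitrary: p) auto

text \<open>Every sample is ranked against all others. This takes time of order
  \<open>h * h\<close>, which is affordable because \<open>h \<le> n\<close>.\<close>

definition find_median_sample :: com where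
  "find_median_sample = For ''t'' ''d''
    (Seq (RAssign ''v'' (RArr ''in'' (IAdd (IVar ''DB'') (IVar ''t''))))
    (Seq (IAssign ''c1'' (IConst 0))
    (Seq (IAssign ''c2'' (IConst 0))
    (Seq (For ''u'' ''d''
      (Seq (Cond (RLess (RArr ''in'' (IAdd (IVar ''DB'') (IVar ''u''))) (RVar ''v''))
        (IAssign ''c1'' (IAdd (IVar ''c1'') (IConst 1))) Skip)
      (Cond (RLess (RVar ''v'') (RArr ''in'' (IAdd (IVar ''DB'') (IVar ''u''))))
        Skip (IAssign ''c2'' (IAdd (IVar ''c2'') (IConst 1))))))
    (Cond (BAnd (ILess (IVar ''c1'') (IVar ''L'')) (BNot (ILess (IVar ''c2'') (IVar ''L''))))
      (RAssign ''beta'' (RVar ''v'')) Skip)))))"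

text \<open>The same pass threads each pair of a row and a coordinate onto the list of its signed
  bucket. The sketch of the all-ones vector is never stored; it is subtracted one signed unit at a
  time.\<close>

definition subtract_bias :: com where
  "subtract_bias = For ''j'' ''M'' (Seq load_cell (Seq (Cond even_w
    (Seq (RStore ''in'' (IVar ''e'') (RSub (RArr ''in'' (IVar ''e'')) (RVar ''beta'')))
      (IAssign ''g'' (IAdd (IVar ''e'') (IVar ''e''))))
    (Seq (RStore ''in'' (IVar ''e'') (RAdd (RArr ''in'' (IVar ''e'')) (RVar ''beta'')))
      (IAssign ''g'' (IAdd (IAdd (IVar ''e'') (IVar ''e'')) (IConst 1)))))
    (Seq (IStore ''next'' (IVar ''j'') (IArr ''head'' (IVar ''g'')))
      (IStore ''head'' (IVar ''g'') (IAdd (IVar ''j'') (IConst 1))))))"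

definition set_keys :: com where
  "set_keys = For ''e'' ''DB''
    (Seq (RStore ''key'' (IAdd (IVar ''e'') (IVar ''e'')) (RArr ''in'' (IVar ''e'')))
    (RStore ''key'' (IAdd (IAdd (IVar ''e'') (IVar ''e'')) (IConst 1)) (RSub (RConst 0) (RArr ''in'' (IVar ''e'')))))"

context sketch_mode
begin

lemma runs_find_median_sample:
  assumes "env \<omega> s"
  shows "runs W find_median_sample s (2 * h * (2 * h * 50 + 50) + 7) (\<lambda>s'.
    is_med h {..<2 * h} (\<lambda>t. rarr s ''in'' (128 * k * h + t)) (rvar s' ''beta'')
    \<and> frame {''t'', ''v'', ''c1'', ''c2'', ''u'', ''beta''} s s')"
proof -
  define f where "f t = rarr s ''in'' (128 * k * h + t)" for t
  let ?U = "Seq (Cond (RLess (RArr ''in'' (IAdd (IVar ''DB'') (IVar ''u''))) (RVar ''v''))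
        (IAssign ''c1'' (IAdd (IVar ''c1'') (IConst 1))) Skip)
      (Cond (RLess (RVar ''v'') (RArr ''in'' (IAdd (IVar ''DB'') (IVar ''u''))))
        Skip (IAssign ''c2'' (IAdd (IVar ''c2'') (IConst 1))))"
  let ?E = "Cond (BAnd (ILess (IVar ''c1'') (IVar ''L'')) (BNot (ILess (IVar ''c2'') (IVar ''L''))))
      (RAssign ''beta'' (RVar ''v'')) Skip"
  let ?P = "Seq (RAssign ''v'' (RArr ''in'' (IAdd (IVar ''DB'') (IVar ''t''))))
    (Seq (IAssign ''c1'' (IConst 0)) (Seq (IAssign ''c2'' (IConst 0)) (Seq (For ''u'' ''d'' ?U) ?E)))"
  let ?X = "{''t'', ''v'', ''c1'', ''c2'', ''u'', ''beta''}"
  \<comment> \<open>The implication is vacuous until a sample passes the test; that some sample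
    passes follows from \<open>is_med_exists\<close>.\<close>
  let ?I = "\<lambda>j s. (\<exists>t<j. is_med h {..<2 * h} f (f t)) \<longrightarrow> is_med h {..<2 * h} f (rvar s ''beta'')"
  have m: "insert ''t'' (mods ?P) = ?X" by auto
  have DBt: "(128 * k * h + t) mod W = 128 * k * h + t" if "t < 2 * h" for t
  proof -
    have "h \<le> k * h" using k by simp
    then have "128 * k * h + t < W" using that bounds by linarith
    then show ?thesis by (rule mod_less)
  qed
  have Suc_mod: "Suc c mod W = Suc c" if "c \<le> 2 * h" for c using bounds that by simp
  have inner: "runs W (For ''u'' ''d'' ?U) s1 (2 * h * (26 + 9) + 7) (\<lambda>s2.
      (rvar s2 ''v'' = v \<and> ivar s2 ''c1'' = card {t \<in> {..<2 * h}. f t < v} \<and> ivar s2 ''c2'' = card {t \<in> {..<2 * h}. f t \<le> v})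
      \<and> frame (insert ''u'' (mods ?U)) s1 s2)"
    if s1: "env \<omega> s1" "rarr s1 ''in'' = rarr s ''in''" "rvar s1 ''v'' = v" "ivar s1 ''c1'' = 0" "ivar s1 ''c2'' = 0" for s1 v
  proof (rule runs_For[where I = "\<lambda>j s. rvar s ''v'' = v \<and> ivar s ''c1'' = card {t \<in> {..<j}. f t < v}
      \<and> ivar s ''c2'' = card {t \<in> {..<j}. f t \<le> v}"])
    fix j s' assume *: "j < 2 * h" "frame (insert ''u'' (mods ?U)) s1 s'" "ivar s' ''u'' = j"
      "rvar s' ''v'' = v \<and> ivar s' ''c1'' = card {t \<in> {..<j}. f t < v} \<and> ivar s' ''c2'' = card {t \<in> {..<j}. f t \<le> v}"
    have i: "rarr s' ''in'' = rarr s ''in''" "ivar s' ''DB'' = 128 * k * h"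
      using frameD[OF *(2)] s1 by (auto simp: env_def)
    have sets: "{t \<in> {..<Suc j}. R t} = (if R j then insert j {t \<in> {..<j}. R t} else {t \<in> {..<j}. R t})" for R
      by (auto simp: less_Suc_eq)
    have le: "card {t \<in> {..<j}. R t} \<le> 2 * h" for R
    proof -
      have "card {t \<in> {..<j}. R t} \<le> card {..<j}" by (rule card_mono) auto
      then show ?thesis using *(1) by simp
    qed
    show "runs W ?U s' 26 (\<lambda>s. rvar s ''v'' = v \<and> ivar s ''c1'' = card {t \<in> {..<Suc j}. f t < v}
      \<and> ivar s ''c2'' = card {t \<in> {..<Suc j}. f t \<le> v})"
    proof (rule runs_straight)
      show "rvar (step W ?U s') ''v'' = v \<and> ivar (step W ?U s') ''c1'' = card {t \<in> {..<Suc j}. f t < v}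
        \<and> ivar (step W ?U s') ''c2'' = card {t \<in> {..<Suc j}. f t \<le> v}"
        using *(3,4) bounds le[of "\<lambda>t. f t < v"] le[of "\<lambda>t. f t \<le> v"]
        unfolding sets by (auto simp: i DBt[OF *(1)] f_def Suc_mod)
    qed simp_all
  qed (use s1 bounds in \<open>auto simp: env_def\<close>)
  have "runs W find_median_sample s (2 * h * ((1 + 5 + (1 + 2 + (1 + 2 + (1 + (2 * h * (26 + 9) + 7) + 11)))) + 9) + 7)
    (\<lambda>s'. ?I (2 * h) s' \<and> frame (insert ''t'' (mods ?P)) s s')"
    unfolding find_median_sample_def
  proof (rule runs_For[where I = ?I])
    fix j s' assume *: "j < 2 * h" "frame (insert ''t'' (mods ?P)) s s'" "ivar s' ''t'' = j" "?I j s'"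
    have e: "env \<omega> s'" using env_frame[OF assms *(2)] by simp
    have i: "rarr s' ''in'' = rarr s ''in''" "ivar s' ''DB'' = 128 * k * h"
      using frameD[OF *(2)] e by (auto simp: env_def)
    let ?v = "f j"
    let ?Q1 = "\<lambda>s1. env \<omega> s1 \<and> rarr s1 ''in'' = rarr s ''in'' \<and> rvar s1 ''v'' = ?v \<and> rvar s1 ''beta'' = rvar s' ''beta''"
    show "runs W ?P s' (1 + 5 + (1 + 2 + (1 + 2 + (1 + (2 * h * (26 + 9) + 7) + 11)))) (?I (Suc j))"
    proof (intro runs_Seq)
      show "runs W (RAssign ''v'' (RArr ''in'' (IAdd (IVar ''DB'') (IVar ''t'')))) s' 5 ?Q1"
        using e *(3) by (intro runs_straight) (simp_all add: i DBt[OF *(1)] f_def env_def)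
    next
      fix s1 assume "?Q1 s1"
      then show "runs W (IAssign ''c1'' (IConst 0)) s1 2 (\<lambda>s2. ?Q1 s2 \<and> ivar s2 ''c1'' = 0)"
        by (intro runs_straight) auto
    next
      fix s1 assume "?Q1 s1 \<and> ivar s1 ''c1'' = 0"
      then show "runs W (IAssign ''c2'' (IConst 0)) s1 2 (\<lambda>s2. ?Q1 s2 \<and> ivar s2 ''c1'' = 0 \<and> ivar s2 ''c2'' = 0)"
        by (intro runs_straight) auto
    next
      fix s1 assume s1: "?Q1 s1 \<and> ivar s1 ''c1'' = 0 \<and> ivar s1 ''c2'' = 0"
      have "runs W (For ''u'' ''d'' ?U) s1 (2 * h * (26 + 9) + 7) (\<lambda>s2.
        (rvar s2 ''v'' = ?v \<and> ivar s2 ''c1'' = card {t \<in> {..<2 * h}. f t < ?v} \<and> ivar s2 ''c2'' = card {t \<in> {..<2 * h}. f t \<le> ?v})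
        \<and> frame (insert ''u'' (mods ?U)) s1 s2)"
        by (rule inner) (use s1 in auto)
      then show "runs W (For ''u'' ''d'' ?U) s1 (2 * h * (26 + 9) + 7) (\<lambda>s2.
        rvar s2 ''v'' = ?v \<and> ivar s2 ''c1'' = card {t \<in> {..<2 * h}. f t < ?v} \<and> ivar s2 ''c2'' = card {t \<in> {..<2 * h}. f t \<le> ?v}
        \<and> rvar s2 ''beta'' = rvar s' ''beta'' \<and> ivar s2 ''L'' = h)"
      proof (rule runs_mono)
        fix s2 assume s2: "(rvar s2 ''v'' = ?v \<and> ivar s2 ''c1'' = card {t \<in> {..<2 * h}. f t < ?v}
          \<and> ivar s2 ''c2'' = card {t \<in> {..<2 * h}. f t \<le> ?v}) \<and> frame (insert ''u'' (mods ?U)) s1 s2"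
        show "rvar s2 ''v'' = ?v \<and> ivar s2 ''c1'' = card {t \<in> {..<2 * h}. f t < ?v} \<and> ivar s2 ''c2'' = card {t \<in> {..<2 * h}. f t \<le> ?v}
        \<and> rvar s2 ''beta'' = rvar s' ''beta'' \<and> ivar s2 ''L'' = h"
          using s1 s2 frameD[OF conjunct2[OF s2], of "''beta''"] frameD[OF conjunct2[OF s2], of "''L''"]
          by (simp add: env_def)
      qed simp
    next
      fix s2 :: state assume s2: "rvar s2 ''v'' = ?v \<and> ivar s2 ''c1'' = card {t \<in> {..<2 * h}. f t < ?v}
        \<and> ivar s2 ''c2'' = card {t \<in> {..<2 * h}. f t \<le> ?v} \<and> rvar s2 ''beta'' = rvar s' ''beta'' \<and> ivar s2 ''L'' = h"
      show "runs W ?E s2 11 (?I (Suc j))"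
      proof (rule runs_straight)
        show "?I (Suc j) (step W ?E s2)"
          using s2 *(4) by (auto simp: less_Suc_eq is_med_def not_less)
      qed simp_all
    qed
  qed (use assms bounds in \<open>auto simp: env_def\<close>)
  then show ?thesis
    unfolding m
  proof (rule runs_mono)
    fix s' assume *: "?I (2 * h) s' \<and> frame ?X s s'"
    have "\<exists>t\<in>{..<2 * h}. is_med h {..<2 * h} f (f t)" using h_ge by (intro is_med_exists) auto
    then show "is_med h {..<2 * h} (\<lambda>t. rarr s ''in'' (128 * k * h + t)) (rvar s' ''beta'') \<and> frame ?X s s'"
      using * unfolding f_def by auto
  qed simp
qed

text \<open>Port \<open>2a\<close> carries the value of cell \<open>a\<close>, port \<open>2a + 1\<close> its negative; so a row estimates a coordinate
  by the value of its port.\<close>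

definition port :: "(nat \<Rightarrow> nat) \<Rightarrow> nat \<Rightarrow> nat" where
  "port \<omega> j = 2 * cell n (64 * k) \<omega> j + (if even (\<omega> j) then 0 else 1)"

lemma port_less: "j < 2 * h * n \<Longrightarrow> port \<omega> j < 256 * k * h"
proof -
  assume "j < 2 * h * n"
  then have "2 * cell n (64 * k) \<omega> j + 1 < 256 * k * h" using cell_less[of j \<omega>] by linarith
  then show ?thesis unfolding port_def by (rule order.strict_trans1[rotated]) simp
qed

text \<open>Reversed, because \<open>subtract_bias\<close> inserts at the head of a list.\<close>

definition members :: "(nat \<Rightarrow> nat) \<Rightarrow> nat \<Rightarrow> nat \<Rightarrow> nat list" where
  "members \<omega> j g = rev (filter (\<lambda>i. port \<omega> i = g) [0..<j])"

lemma members_Suc: "members \<omega> (Suc j) g = (if port \<omega> j = g then j # members \<omega> j g else members \<omega> j g)"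
  by (simp add: members_def)

lemma set_members: "set (members \<omega> j g) = {i. i < j \<and> port \<omega> i = g}"
  by (auto simp: members_def)

lemma distinct_members: "distinct (members \<omega> j g)"
  by (simp add: members_def)

lemma runs_subtract_bias:
  assumes "env \<omega> s" "iarr s ''head'' = (\<lambda>_. 0)"
  shows "runs W subtract_bias s (2 * h * n * 80 + 7) (\<lambda>s'.
    (rarr s' ''in'' = (\<lambda>a. rarr s ''in'' a - rvar s ''beta'' * cell_sum (2 * h * n) n (64 * k) \<omega> (\<lambda>_. 1) a)
    \<and> (\<forall>g. linked (iarr s' ''next'') (iarr s' ''head'' g) (members \<omega> (2 * h * n) g)))
    \<and> frame {''j'', ''w'', ''e'', ''g'', ''in'', ''next'', ''head''} s s')"
proof -
  let ?C1 = "Seq (RStore ''in'' (IVar ''e'') (RSub (RArr ''in'' (IVar ''e'')) (RVar ''beta'')))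
      (IAssign ''g'' (IAdd (IVar ''e'') (IVar ''e'')))"
  let ?C2 = "Seq (RStore ''in'' (IVar ''e'') (RAdd (RArr ''in'' (IVar ''e'')) (RVar ''beta'')))
      (IAssign ''g'' (IAdd (IAdd (IVar ''e'') (IVar ''e'')) (IConst 1)))"
  let ?P = "Seq load_cell (Seq (Cond even_w ?C1 ?C2)
    (Seq (IStore ''next'' (IVar ''j'') (IArr ''head'' (IVar ''g'')))
      (IStore ''head'' (IVar ''g'') (IAdd (IVar ''j'') (IConst 1)))))"
  let ?X = "{''j'', ''w'', ''e'', ''g'', ''in'', ''next'', ''head''}"
  let ?I = "\<lambda>j s'. rarr s' ''in'' = (\<lambda>a. rarr s ''in'' a - rvar s ''beta'' * cell_sum j n (64 * k) \<omega> (\<lambda>_. 1) a)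
    \<and> (\<forall>g. linked (iarr s' ''next'') (iarr s' ''head'' g) (members \<omega> j g))"
  have m: "insert ''j'' (mods ?P) = ?X" by auto
  have "runs W subtract_bias s (2 * h * n * (71 + 9) + 7) (\<lambda>s'. ?I (2 * h * n) s' \<and> frame (insert ''j'' (mods ?P)) s s')"
    unfolding subtract_bias_def
  proof (rule runs_For[where I = ?I])
    show "?I 0 s" using assms(2) by (simp add: cell_sum_def members_def)
    fix j s' assume *: "j < 2 * h * n" "frame (insert ''j'' (mods ?P)) s s'" "ivar s' ''j'' = j" "?I j s'"
    have e: "env \<omega> s'" using env_frame[OF assms(1) *(2)] unfolding m by simp
    have beta: "rvar s' ''beta'' = rvar s ''beta''" using frameD[OF *(2)[unfolded m]] by simp
    let ?c = "cell n (64 * k) \<omega> j"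
    have c: "?c + ?c < W" "Suc (?c + ?c) < W" "Suc j < W" using cell_less[OF *(1), of \<omega>] bounds *(1) by linarith+
    have p: "port \<omega> j = (if even (\<omega> j) then ?c + ?c else Suc (?c + ?c))" by (simp add: port_def)
    let ?st1 = "rarr (step W ?P s') ''in'' = (rarr s' ''in'')(?c := rarr s' ''in'' ?c - rvar s ''beta'' * sign_of (\<omega> j))"
    let ?st2 = "iarr (step W ?P s') ''next'' = (iarr s' ''next'')(j := iarr s' ''head'' (port \<omega> j))"
    let ?st3 = "iarr (step W ?P s') ''head'' = (iarr s' ''head'')(port \<omega> j := Suc j)"
    let ?st = "?st1 \<and> ?st2 \<and> ?st3"
    have st: ?st1 ?st2 ?st3
    proof -
      note simps = step_load_cell[OF e *(3,1)] even_w_iff p sign_of_def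
      have "?st" if ev: "even (\<omega> j)" using c *(3) beta by (simp add: simps ev)
      moreover have "?st" if ev: "odd (\<omega> j)" using c *(3) beta by (simp add: simps ev)
      ultimately show "?st1" "?st2" "?st3" by blast+
    qed
    show "runs W ?P s' 71 (?I (Suc j))"
    proof (rule runs_straight)
      show "?I (Suc j) (step W ?P s')"
        unfolding st
      proof (intro conjI allI)
        show "(rarr s' ''in'')(?c := rarr s' ''in'' ?c - rvar s ''beta'' * sign_of (\<omega> j))
            = (\<lambda>a. rarr s ''in'' a - rvar s ''beta'' * cell_sum (Suc j) n (64 * k) \<omega> (\<lambda>_. 1) a)"
          by (rule ext) (simp add: conjunct1[OF *(4)] cell_sum_Suc distrib_left)
        fix g
        \<comment> \<open>The index \<open>j\<close> is new, so setting its \<open>next\<close>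
          entry leaves all earlier lists intact.\<close>
        have "j \<notin> set (members \<omega> j g')" for g' by (simp add: set_members)
        then show "linked ((iarr s' ''next'')(j := iarr s' ''head'' (port \<omega> j)))
            (((iarr s' ''head'')(port \<omega> j := Suc j)) g) (members \<omega> (Suc j) g)"
          using *(4) by (simp add: members_Suc linked_upd)
      qed
    qed simp_all
  qed (use assms bounds in \<open>auto simp: env_def\<close>)
  then show ?thesis unfolding m by simp
qed

lemma runs_set_keys:
  assumes "env \<omega> s"
  shows "runs W set_keys s (128 * k * h * 40 + 7) (\<lambda>s'.
    (\<forall>a < 128 * k * h. rarr s' ''key'' (2 * a) = rarr s ''in'' a \<and> rarr s' ''key'' (2 * a + 1) = - rarr s ''in'' a)
    \<and> frame {''e'', ''key''} s s')"
proof -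
  let ?P = "Seq (RStore ''key'' (IAdd (IVar ''e'') (IVar ''e'')) (RArr ''in'' (IVar ''e'')))
    (RStore ''key'' (IAdd (IAdd (IVar ''e'') (IVar ''e'')) (IConst 1)) (RSub (RConst 0) (RArr ''in'' (IVar ''e''))))"
  let ?I = "\<lambda>j s'. \<forall>a<j. rarr s' ''key'' (2 * a) = rarr s ''in'' a \<and> rarr s' ''key'' (2 * a + 1) = - rarr s ''in'' a"
  have m: "insert ''e'' (mods ?P) = {''e'', ''key''}" by auto
  have "runs W set_keys s (128 * k * h * (31 + 9) + 7) (\<lambda>s'. ?I (128 * k * h) s' \<and> frame (insert ''e'' (mods ?P)) s s')"
    unfolding set_keys_def
  proof (rule runs_For[where I = ?I])
    fix j s' assume *: "j < 128 * k * h" "frame (insert ''e'' (mods ?P)) s s'" "ivar s' ''e'' = j" "?I j s'"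
    have i: "rarr s' ''in'' = rarr s ''in''" using frameD[OF *(2)[unfolded m]] by simp
    have c: "(j + j) mod W = 2 * j" "Suc (2 * j) mod W = Suc (2 * j)" "W \<noteq> Suc 0" using *(1) bounds by auto
    have odd: "2 * a \<noteq> Suc (2 * j)" "Suc (2 * a) \<noteq> 2 * j" for a by presburger+
    have st: "rarr (step W ?P s') ''key'' = (rarr s' ''key'')(2 * j := rarr s ''in'' j, Suc (2 * j) := - rarr s ''in'' j)"
      by (simp add: *(3) i c)
    show "runs W ?P s' 31 (?I (Suc j))"
    proof (rule runs_straight)
      show "?I (Suc j) (step W ?P s')"
        using *(4) unfolding st by (simp add: less_Suc_eq odd)
    qed simp_all
  qed (use assms bounds in \<open>auto simp: env_def\<close>)
  then show ?thesis unfolding m by simp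
qed

end

section \<open>The recovery program: sorting the buckets\<close>

definition set_leaves :: com where
  "set_leaves = For ''g'' ''N'' (IStore ''tree'' (IAdd (IVar ''N'') (IVar ''g'')) (IVar ''g''))"

text \<open>The test is the negation of \<open>beats\<close> for the left child against the right
  one, so ties go to the left as in \<open>rematch\<close>.\<close>

definition update_node :: com where
  "update_node =
    Seq (IAssign ''l'' (IArr ''tree'' (IAdd (IVar ''q'') (IVar ''q''))))
   (Seq (IAssign ''r'' (IArr ''tree'' (IAdd (IAdd (IVar ''q'') (IVar ''q'')) (IConst 1))))
    (Cond (BAnd (ILess (IArr ''dead'' (IVar ''r'')) (IConst 1))
        (BNot (BAnd (ILess (IArr ''dead'' (IVar ''l'')) (IConst 1))
          (BNot (RLess (RArr ''key'' (IVar ''r'')) (RArr ''key'' (IVar ''l'')))))))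
      (IStore ''tree'' (IVar ''q'') (IVar ''r''))
      (IStore ''tree'' (IVar ''q'') (IVar ''l''))))"

text \<open>The nodes are played in decreasing order, so that both children are settled before their
  parent; the loop counts upwards, hence the subtraction.\<close>

definition build_tree :: com where
  "build_tree = Seq (IAssign ''N1'' (ISub (IVar ''N'') (IConst 1)))
    (For ''u'' ''N1'' (Seq (IAssign ''q'' (ISub (IVar ''N1'') (IVar ''u''))) update_node))"

text \<open>The output is written only when the counter equals \<open>L\<close>, which takes two
  comparisons; later visits, with larger values, must not overwrite it.\<close>

definition visit_members :: com where
  "visit_members = While (ILess (IConst 0) (IVar ''j''))
    (Seq (IAssign ''j'' (ISub (IVar ''j'') (IConst 1)))
    (Seq (IAssign ''i'' (IMod (IVar ''j'') (IVar ''n'')))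
    (Seq (IStore ''cnt'' (IVar ''i'') (IAdd (IArr ''cnt'' (IVar ''i'')) (IConst 1)))
    (Seq (Cond (BAnd (BNot (ILess (IArr ''cnt'' (IVar ''i'')) (IVar ''L'')))
                 (BNot (ILess (IVar ''L'') (IArr ''cnt'' (IVar ''i'')))))
      (RStore ''out'' (IVar ''i'') (RAdd (RArr ''key'' (IVar ''w'')) (RVar ''beta''))) Skip)
    (IAssign ''j'' (IArr ''next'' (IVar ''j'')))))))"

definition climb :: com where
  "climb = While (ILess (IConst 0) (IVar ''q''))
    (Seq update_node (IAssign ''q'' (IDiv (IVar ''q'') (IConst 2))))"

definition sweep :: com where
  "sweep = For ''t'' ''N''
    (Seq (IAssign ''w'' (IArr ''tree'' (IConst 1)))
    (Seq (IAssign ''j'' (IArr ''head'' (IVar ''w'')))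
    (Seq visit_members
    (Seq (IStore ''dead'' (IVar ''w'') (IConst 1))
    (Seq (IAssign ''q'' (IDiv (IAdd (IVar ''N'') (IVar ''w'')) (IConst 2)))
    climb)))))"

definition recover_prog :: com where
  "recover_prog = Seq set_thresholds (Cond (ILess (IVar ''n'') (IVar ''N'')) copy_input
    (Seq set_constants (Seq find_median_sample (Seq subtract_bias
    (Seq set_keys (Seq set_leaves (Seq build_tree sweep)))))))"

abbreviation dead_of :: "state \<Rightarrow> nat \<Rightarrow> bool" where
  "dead_of s g \<equiv> iarr s ''dead'' g \<noteq> 0"

abbreviation ok_at :: "state \<Rightarrow> nat \<Rightarrow> bool" where
  "ok_at s \<equiv> node_ok (dead_of s) (rarr s ''key'') (iarr s ''tree'')"

lemma update_node_simps [simp]: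
  "straight update_node" "max_cost update_node = 35" "mods update_node = {''l'', ''r'', ''tree''}"
  by (auto simp: update_node_def)

context sketch_mode
begin

lemma one_less_W: "1 < W" using bounds by linarith

lemma runs_set_leaves:
  assumes "env \<omega> s"
  shows "runs W set_leaves s (256 * k * h * 14 + 7)
    (\<lambda>s'. (\<forall>g < 256 * k * h. iarr s' ''tree'' (256 * k * h + g) = g) \<and> frame {''g'', ''tree''} s s')"
proof -
  let ?P = "IStore ''tree'' (IAdd (IVar ''N'') (IVar ''g'')) (IVar ''g'')"
  let ?I = "\<lambda>j s'. \<forall>g<j. iarr s' ''tree'' (256 * k * h + g) = g"
  have m: "insert ''g'' (mods ?P) = {''g'', ''tree''}" by auto
  have "runs W set_leaves s (256 * k * h * (5 + 9) + 7) (\<lambda>s'. ?I (256 * k * h) s' \<and> frame (insert ''g'' (mods ?P)) s s')"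
    unfolding set_leaves_def
  proof (rule runs_For[where I = ?I])
    fix j s' assume *: "j < 256 * k * h" "frame (insert ''g'' (mods ?P)) s s'" "ivar s' ''g'' = j" "?I j s'"
    have i: "ivar s' ''N'' = 256 * k * h" using frameD[OF *(2)[unfolded m]] assms by (simp add: env_def)
    have "256 * k * h + j < W" using *(1) bounds mode by linarith
    then have st: "iarr (step W ?P s') ''tree'' = (iarr s' ''tree'')(256 * k * h + j := j)"
      by (simp add: *(3) i)
    show "runs W ?P s' 5 (?I (Suc j))"
    proof (rule runs_straight)
      show "?I (Suc j) (step W ?P s')" using *(4) unfolding st by (simp add: less_Suc_eq)
    qed simp_all
  qed (use assms bounds in \<open>auto simp: env_def\<close>)
  then show ?thesis unfolding m by simp
qed

lemma step_update_node:
  assumes "ivar s ''q'' = q" "q < 256 * k * h"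
  shows "iarr (step W update_node s) ''tree'' = rematch (dead_of s) (rarr s ''key'') (iarr s ''tree'') q"
    and "ivar (step W update_node s) ''q'' = q"
proof -
  have q: "(q + q) mod W = 2 * q" "Suc (2 * q) mod W = Suc (2 * q)" "W \<noteq> Suc 0" using assms bounds mode by auto
  show "iarr (step W update_node s) ''tree'' = rematch (dead_of s) (rarr s ''key'') (iarr s ''tree'') q"
    by (simp add: update_node_def assms(1) q rematch_def beats_def not_less)
  show "ivar (step W update_node s) ''q'' = q" by (simp add: update_node_def assms(1))
qed

lemma frame_update_node: "frame {''l'', ''r'', ''tree''} s (step W update_node s)"
proof -
  obtain t where "exec W update_node s t (step W update_node s)"
    using runs_step[of update_node W s] by (auto simp: runs_def)
  then show ?thesis using exec_frame by fastforce
qed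

lemma runs_build_tree:
  assumes "env \<omega> s" "\<forall>g < 256 * k * h. iarr s ''tree'' (256 * k * h + g) = g"
  shows "runs W build_tree s (256 * k * h * 56 + 12)
    (\<lambda>s'. (\<forall>g < 256 * k * h. iarr s' ''tree'' (256 * k * h + g) = g) \<and> (\<forall>q. 1 \<le> q \<and> q < 256 * k * h \<longrightarrow> ok_at s' q)
    \<and> frame {''N1'', ''u'', ''q'', ''l'', ''r'', ''tree''} s s')"
proof -
  define N where "N = 256 * k * h"
  have N: "1 \<le> N" "N < W" using k h_ge bounds by (auto simp: N_def)
  let ?P = "Seq (IAssign ''q'' (ISub (IVar ''N1'') (IVar ''u''))) update_node"
  let ?I = "\<lambda>j s'. (\<forall>g < N. iarr s' ''tree'' (N + g) = g) \<and> (\<forall>q. N - 1 - j < q \<and> q < N \<longrightarrow> ok_at s' q)"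
  have m: "insert ''u'' (mods ?P) = {''u'', ''q'', ''l'', ''r'', ''tree''}" by auto
  have loop: "runs W (For ''u'' ''N1'' ?P) s1 ((N - 1) * (47 + 9) + 7) (\<lambda>s'. ?I (N - 1) s' \<and> frame (insert ''u'' (mods ?P)) s1 s')"
    if s1: "ivar s1 ''N1'' = N - 1" "\<forall>g < N. iarr s1 ''tree'' (N + g) = g" for s1
  proof (rule runs_For[where I = ?I])
    fix j s' assume *: "j < N - 1" "frame (insert ''u'' (mods ?P)) s1 s'" "ivar s' ''u'' = j" "?I j s'"
    have i: "ivar s' ''N1'' = N - 1" using frameD[OF *(2)[unfolded m]] s1 by simp
    define q where "q = N - 1 - j"
    have q: "1 \<le> q" "q < N" using *(1) by (auto simp: q_def)
    let ?s1 = "s'\<lparr>ivar := (ivar s')(''q'' := q)\<rparr>"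
    have st: "step W ?P s' = step W update_node ?s1" by (simp add: *(3) i q_def)
    have t: "iarr (step W update_node ?s1) ''tree'' = rematch (dead_of s') (rarr s' ''key'') (iarr s' ''tree'') q"
      using step_update_node(1)[of ?s1 q] q by (simp add: N_def)
    have o: "iarr (step W update_node ?s1) ''dead'' = iarr s' ''dead''" "rarr (step W update_node ?s1) ''key'' = rarr s' ''key''"
      using frameD[OF frame_update_node[of ?s1]] by simp_all
    show "runs W ?P s' 47 (?I (Suc j))"
    proof (rule runs_straight)
      show "?I (Suc j) (step W ?P s')"
        unfolding st t o
      proof (intro conjI allI impI)
        fix g assume "g < N" then show "rematch (dead_of s') (rarr s' ''key'') (iarr s' ''tree'') q (N + g) = g"
          using *(4) q(2) by (simp add: rematch_leaf)
      next
        fix p assume p: "N - 1 - Suc j < p \<and> p < N"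
        show "node_ok (dead_of s') (rarr s' ''key'') (rematch (dead_of s') (rarr s' ''key'') (iarr s' ''tree'') q) p"
        proof (cases "p = q")
          case True then show ?thesis using node_ok_rematch q by simp
        next
          case False
          then have "q < p" using p by (auto simp: q_def)
          \<comment> \<open>The parent of \<open>q\<close> is smaller than \<open>q\<close> and
            therefore not yet among the nodes claimed to be in order.\<close>
          then show ?thesis using *(4) p by (intro node_ok_rematch_other) (auto simp: q_def)
        qed
      qed
    qed simp_all
  qed (use s1 N in auto)
  have "runs W build_tree s (1 + 4 + ((N - 1) * (47 + 9) + 7))
    (\<lambda>s'. (\<forall>g < N. iarr s' ''tree'' (N + g) = g) \<and> (\<forall>q. 1 \<le> q \<and> q < N \<longrightarrow> ok_at s' q))"
    unfolding build_tree_def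
  proof (rule runs_Seq)
    show "runs W (IAssign ''N1'' (ISub (IVar ''N'') (IConst 1))) s 4 (\<lambda>s'. ivar s' ''N1'' = N - 1 \<and> iarr s' ''tree'' = iarr s ''tree'')"
      using assms(1) one_less_W by (intro runs_straight) (simp_all add: env_def N_def)
    fix s1 :: state assume "ivar s1 ''N1'' = N - 1 \<and> iarr s1 ''tree'' = iarr s ''tree''"
    then show "runs W (For ''u'' ''N1'' ?P) s1 ((N - 1) * (47 + 9) + 7)
      (\<lambda>s'. (\<forall>g < N. iarr s' ''tree'' (N + g) = g) \<and> (\<forall>q. 1 \<le> q \<and> q < N \<longrightarrow> ok_at s' q))"
      using assms(2) by (intro runs_mono[OF loop]) (auto simp: N_def)
  qed
  from runs_frame[OF this] show ?thesis
    unfolding N_def[symmetric]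
    by (rule runs_mono) (use N in \<open>auto simp: build_tree_def insert_commute\<close>)
qed

text \<open>The disorder is confined to the path from \<open>q\<close> to the root and moves up one
  level per iteration, by \<open>rematch_path\<close>; \<open>m\<close> bounds the length of the
  path.\<close>

lemma runs_climb:
  assumes "\<forall>g < 256 * k * h. iarr s ''tree'' (256 * k * h + g) = g"
    and "\<And>q. 1 \<le> q \<Longrightarrow> q < 256 * k * h \<Longrightarrow> ok_at s q \<or> (\<exists>e. q = ivar s ''q'' div 2 ^ e)"
    and "ivar s ''q'' < 2 ^ m" "ivar s ''q'' < 256 * k * h"
  shows "runs W climb s (m * 60 + 4)
    (\<lambda>s'. ((\<forall>g < 256 * k * h. iarr s' ''tree'' (256 * k * h + g) = g) \<and> (\<forall>q. 1 \<le> q \<and> q < 256 * k * h \<longrightarrow> ok_at s' q))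
    \<and> frame {''q'', ''l'', ''r'', ''tree''} s s')"
proof -
  define N where "N = 256 * k * h"
  let ?P = "Seq update_node (IAssign ''q'' (IDiv (IVar ''q'') (IConst 2)))"
  let ?b = "ILess (IConst 0) (IVar ''q'')"
  let ?I = "\<lambda>c s'. (\<forall>g < N. iarr s' ''tree'' (N + g) = g) \<and>
    (\<forall>q. 1 \<le> q \<and> q < N \<longrightarrow> ok_at s' q \<or> (\<exists>e. q = ivar s' ''q'' div 2 ^ e)) \<and>
    (\<exists>m. ivar s' ''q'' < 2 ^ m \<and> c = m * 60) \<and> ivar s' ''q'' < N"
  have "runs W climb s (m * 60 + bcost ?b + 1) (\<lambda>s'. (\<exists>c. ?I c s') \<and> \<not> bval W ?b s')"
    unfolding climb_def
  proof (rule runs_While_budget[where I = ?I])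
    show "?I (m * 60) s" using assms by (auto simp: N_def)
    fix c s' assume I: "?I c s'" and b: "bval W ?b s'"
    define q where "q = ivar s' ''q''"
    have q: "1 \<le> q" "q < N" using I b by (auto simp: q_def)
    obtain l where l: "q < 2 ^ l" "c = l * 60" using I by (auto simp: q_def)
    then obtain l' where l': "l = Suc l'" using q by (cases l) auto
    let ?s1 = "step W update_node s'"
    let ?s2 = "?s1\<lparr>ivar := (ivar ?s1)(''q'' := q div 2)\<rparr>"
    note un = step_update_node[of s' q, folded N_def, OF q_def[symmetric] q(2)]
    have two: "2 mod W = 2" using bounds by simp
    have st: "step W ?P s' = ?s2" using un(2) by (simp add: two)
    have o: "iarr ?s1 ''dead'' = iarr s' ''dead''" "rarr ?s1 ''key'' = rarr s' ''key''"
      using frameD[OF frame_update_node[of s']] by simp_all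
    have path: "ok_at ?s2 p \<or> (\<exists>e. p = (q div 2) div 2 ^ e)" if p: "1 \<le> p" "p < N" for p
      using rematch_path[of N "dead_of s'" "rarr s' ''key''" "iarr s' ''tree''" q p] I q(1) p
      by (simp add: un(1) o q_def)
    have "?I (l' * 60) ?s2"
      using I path q l l' by (auto simp: un(1) rematch_leaf)
    then have "runs W ?P s' 48 (\<lambda>s''. \<exists>c'. ?I c' s'' \<and> 48 + bcost ?b + 1 + c' \<le> c)"
      unfolding l l' by (intro runs_straight) (auto simp: st simp del: step.simps)
    then show "\<exists>T. runs W ?P s' T (\<lambda>s''. \<exists>c'. ?I c' s'' \<and> T + bcost ?b + 1 + c' \<le> c)" by blast
  qed
  \<comment> \<open>On exit \<open>q\<close> is 0, and no node from 1 on has the form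
    \<open>0 div 2 ^ e\<close>; so the exception has become empty.\<close>
  from runs_frame[OF this] show ?thesis
    unfolding N_def[symmetric]
    by (rule runs_mono) (auto simp: climb_def insert_commute)
qed

section \<open>Medians by counting in sorted order\<close>

definition settled :: "(nat \<Rightarrow> nat) \<Rightarrow> (nat \<Rightarrow> real) \<Rightarrow> real \<Rightarrow> nat \<Rightarrow> real \<Rightarrow> bool" where
  "settled \<omega> key \<beta> i z \<longleftrightarrow> (\<exists>v. z = v + \<beta> \<and> is_med h {j. j < 2 * h * n \<and> j mod n = i} (\<lambda>j. key (port \<omega> j)) v)"

text \<open>\<open>X\<close> is the set of pairs visited so far. Once the counter of a coordinate
  has reached \<open>h\<close>, its output is final.\<close>

definition counted :: "(nat \<Rightarrow> nat) \<Rightarrow> (nat \<Rightarrow> real) \<Rightarrow> real \<Rightarrow> nat set \<Rightarrow> state \<Rightarrow> bool" where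
  "counted \<omega> key \<beta> X s \<longleftrightarrow> (\<forall>i<n. iarr s ''cnt'' i = card {x \<in> X. x mod n = i}
    \<and> (h \<le> iarr s ''cnt'' i \<longrightarrow> settled \<omega> key \<beta> i (rarr s ''out'' i)))"

text \<open>Every pair with key below \<open>key w\<close> has been visited, and no visited pair has
  a larger key. When the visit of \<open>x\<close> lifts a counter to \<open>h\<close>, fewer than
  \<open>h\<close> entries of this coordinate are below \<open>key w\<close>, while the
  \<open>h\<close> visited ones are at most \<open>key w\<close>. So \<open>key w\<close> is the
  median.\<close>

lemma counted_visit:
  assumes "counted \<omega> key \<beta> X s" "finite X" "X \<subseteq> {..<2 * h * n}" "x < 2 * h * n" "x \<notin> X"
    and before: "\<And>y. y \<in> X \<Longrightarrow> key (port \<omega> y) \<le> key w" "\<And>y. y < 2 * h * n \<Longrightarrow> key (port \<omega> y) < key w \<Longrightarrow> y \<in> X"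
    and w: "port \<omega> x = w"
    and cnt: "iarr s' ''cnt'' = (iarr s ''cnt'')(x mod n := Suc (iarr s ''cnt'' (x mod n)))"
    and out: "rarr s' ''out'' = (if Suc (iarr s ''cnt'' (x mod n)) = h
      then (rarr s ''out'')(x mod n := key w + \<beta>) else rarr s ''out'')"
  shows "counted \<omega> key \<beta> (insert x X) s'"
  unfolding counted_def
proof (intro allI impI conjI)
  fix i assume i: "i < n"
  have c: "iarr s ''cnt'' i = card {x \<in> X. x mod n = i}" and st: "h \<le> iarr s ''cnt'' i \<Longrightarrow> settled \<omega> key \<beta> i (rarr s ''out'' i)"
    using assms(1) i by (auto simp: counted_def)
  have ins: "{y \<in> insert x X. y mod n = i} = (if x mod n = i then insert x {y \<in> X. y mod n = i} else {y \<in> X. y mod n = i})"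
    by auto
  show c': "iarr s' ''cnt'' i = card {y \<in> insert x X. y mod n = i}"
    unfolding ins cnt using assms(2,5) c by (cases "x mod n = i") auto
  assume h: "h \<le> iarr s' ''cnt'' i"
  show "settled \<omega> key \<beta> i (rarr s' ''out'' i)"
  proof (cases "x mod n = i \<and> Suc (iarr s ''cnt'' i) = h")
    case False
    then have "h \<le> iarr s ''cnt'' i" using h by (auto simp: cnt split: if_splits)
    then show ?thesis using st False by (auto simp: out)
  next
    case True
    let ?A = "{j. j < 2 * h * n \<and> j mod n = i}"
    have "{a \<in> ?A. key (port \<omega> a) < key w} \<subseteq> {y \<in> X. y mod n = i}" using before(2) by auto
    then have "card {a \<in> ?A. key (port \<omega> a) < key w} \<le> card {y \<in> X. y mod n = i}"
      using assms(2) by (intro card_mono) auto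
    moreover have "card {y \<in> X. y mod n = i} < h" using c True by simp
    moreover have "{y \<in> insert x X. y mod n = i} \<subseteq> {a \<in> ?A. key (port \<omega> a) \<le> key w}"
      using before(1) w assms(3,4) by auto
    then have "card {y \<in> insert x X. y mod n = i} \<le> card {a \<in> ?A. key (port \<omega> a) \<le> key w}"
      by (intro card_mono) auto
    ultimately have "is_med h ?A (\<lambda>j. key (port \<omega> j)) (key w)"
      using h c' unfolding is_med_def by linarith
    then show ?thesis using True by (auto simp: settled_def out)
  qed
qed

lemma runs_visit_members:
  assumes e: "env \<omega> s" and lnk: "linked (iarr s ''next'') (ivar s ''j'') xs"
    and xs: "set xs \<subseteq> {..<2 * h * n}" "distinct xs" "\<And>x. x \<in> set xs \<Longrightarrow> port \<omega> x = ivar s ''w''"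
    and X: "X \<subseteq> {..<2 * h * n}" "X \<inter> set xs = {}"
    and before: "\<And>y. y \<in> X \<Longrightarrow> rarr s ''key'' (port \<omega> y) \<le> rarr s ''key'' (ivar s ''w'')"
      "\<And>y. y < 2 * h * n \<Longrightarrow> rarr s ''key'' (port \<omega> y) < rarr s ''key'' (ivar s ''w'') \<Longrightarrow> y \<in> X"
    and cnt: "counted \<omega> (rarr s ''key'') (rvar s ''beta'') X s"
  shows "runs W visit_members s (length xs * 50 + 4) (\<lambda>s'.
    counted \<omega> (rarr s ''key'') (rvar s ''beta'') (X \<union> set xs) s' \<and> frame {''i'', ''j'', ''cnt'', ''out''} s s')"
proof -
  define key where "key = rarr s ''key''"
  define \<beta> where "\<beta> = rvar s ''beta''"
  define w where "w = ivar s ''w''"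
  let ?b = "ILess (IConst 0) (IVar ''j'')"
  let ?C = "Cond (BAnd (BNot (ILess (IArr ''cnt'' (IVar ''i'')) (IVar ''L'')))
                 (BNot (ILess (IVar ''L'') (IArr ''cnt'' (IVar ''i'')))))
      (RStore ''out'' (IVar ''i'') (RAdd (RArr ''key'' (IVar ''w'')) (RVar ''beta''))) Skip"
  let ?P = "Seq (IAssign ''j'' (ISub (IVar ''j'') (IConst 1)))
    (Seq (IAssign ''i'' (IMod (IVar ''j'') (IVar ''n'')))
    (Seq (IStore ''cnt'' (IVar ''i'') (IAdd (IArr ''cnt'' (IVar ''i'')) (IConst 1)))
    (Seq ?C (IAssign ''j'' (IArr ''next'' (IVar ''j''))))))"
  let ?Y = "{''i'', ''j'', ''cnt'', ''out''}"
  let ?I = "\<lambda>c s'. (\<exists>ys zs. xs = ys @ zs \<and> linked (iarr s' ''next'') (ivar s' ''j'') zs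
    \<and> counted \<omega> key \<beta> (X \<union> set ys) s' \<and> c = length zs * 50) \<and> frame ?Y s s'"
  have m: "mods ?P = ?Y" by auto
  have "runs W visit_members s (length xs * 50 + bcost ?b + 1) (\<lambda>s'. (\<exists>c. ?I c s') \<and> \<not> bval W ?b s')"
    unfolding visit_members_def
  proof (rule runs_While_budget[where I = ?I])
    show "?I (length xs * 50) s"
      using lnk cnt frame_refl by (intro conjI exI[of _ "[]"] exI[of _ xs]) (auto simp: key_def \<beta>_def)
    fix c s' assume I: "?I c s'" and b: "bval W ?b s'"
    then obtain ys zs where yz: "xs = ys @ zs" "linked (iarr s' ''next'') (ivar s' ''j'') zs"
      "counted \<omega> key \<beta> (X \<union> set ys) s'" "c = length zs * 50" and fr: "frame ?Y s s'" by blast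
    obtain x zs' where zs: "zs = x # zs'" using yz(2) b by (cases zs) auto
    have j: "ivar s' ''j'' = Suc x" "linked (iarr s' ''next'') (iarr s' ''next'' x) zs'" using yz(2) zs by auto
    have o: "ivar s' ''n'' = n" "ivar s' ''L'' = h" "ivar s' ''w'' = w" "rarr s' ''key'' = key" "rvar s' ''beta'' = \<beta>"
      using frameD[OF fr] e by (simp_all add: env_def key_def \<beta>_def w_def)
    have x: "x < 2 * h * n" "x \<in> set xs" using xs(1) yz(1) zs by auto
    let ?X = "X \<union> set ys"
    have X': "finite ?X" "?X \<subseteq> {..<2 * h * n}" "x \<notin> ?X"
      using X xs yz(1) zs finite_subset[OF X(1)] by auto
    have xn: "x mod n < n" using n by simp
    have "iarr s' ''cnt'' (x mod n) = card {y \<in> ?X. y mod n = x mod n}" using yz(3) xn by (simp add: counted_def)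
    also have "\<dots> \<le> card {..<2 * h * n}" using X' by (intro card_mono) auto
    finally have "Suc (iarr s' ''cnt'' (x mod n)) < W" using bounds x(1) by simp
    then have inc: "Suc (iarr s' ''cnt'' (x mod n)) mod W = Suc (iarr s' ''cnt'' (x mod n))" "1 mod W = 1" "W \<noteq> Suc 0"
      using one_less_W by auto
    define s3 where "s3 = s'\<lparr>ivar := (ivar s')(''j'' := x, ''i'' := x mod n),
      iarr := (iarr s')(''cnt'' := (iarr s' ''cnt'')(x mod n := Suc (iarr s' ''cnt'' (x mod n))))\<rparr>"
    define s4 where "s4 = (if Suc (iarr s' ''cnt'' (x mod n)) = h
      then s3\<lparr>rarr := (rarr s3)(''out'' := (rarr s' ''out'')(x mod n := key w + \<beta>))\<rparr> else s3)"
    have "step W (Seq (IAssign ''j'' (ISub (IVar ''j'') (IConst 1))) (Seq (IAssign ''i'' (IMod (IVar ''j'') (IVar ''n'')))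
      (IStore ''cnt'' (IVar ''i'') (IAdd (IArr ''cnt'' (IVar ''i'')) (IConst 1))))) s' = s3"
      by (simp add: j(1) o inc s3_def)
    moreover have "step W ?C s3 = s4"
    proof -
      have "ivar s3 ''i'' = x mod n" "iarr s3 ''cnt'' (x mod n) = Suc (iarr s' ''cnt'' (x mod n))" "ivar s3 ''L'' = h"
        "ivar s3 ''w'' = w" "rarr s3 = rarr s'" "rvar s3 ''beta'' = \<beta>"
        by (simp_all add: s3_def o)
      then show ?thesis unfolding s4_def by (auto simp: o)
    qed
    ultimately have "step W ?P s' = step W (IAssign ''j'' (IArr ''next'' (IVar ''j''))) s4" by simp
    also have "\<dots> = s4\<lparr>ivar := (ivar s4)(''j'' := iarr s' ''next'' x)\<rparr>"
      by (simp add: s4_def s3_def)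
    finally have st: "step W ?P s' = s4\<lparr>ivar := (ivar s4)(''j'' := iarr s' ''next'' x)\<rparr>" .
    have cnt': "iarr (step W ?P s') ''cnt'' = (iarr s' ''cnt'')(x mod n := Suc (iarr s' ''cnt'' (x mod n)))"
      unfolding st by (simp add: s4_def s3_def)
    have out': "rarr (step W ?P s') ''out'' = (if Suc (iarr s' ''cnt'' (x mod n)) = h
        then (rarr s' ''out'')(x mod n := key w + \<beta>) else rarr s' ''out'')"
      unfolding st by (simp add: s4_def s3_def)
    have nx: "iarr (step W ?P s') ''next'' = iarr s' ''next''" "ivar (step W ?P s') ''j'' = iarr s' ''next'' x"
      unfolding st by (simp_all add: s4_def s3_def)
    have "counted \<omega> key \<beta> (insert x ?X) (step W ?P s')"
    proof (rule counted_visit[OF yz(3) X'(1,2) x(1) X'(3) _ _ _ cnt' out'])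
      show "port \<omega> x = w" using xs(3)[OF x(2)] by (simp add: w_def)
      \<comment> \<open>Pairs visited earlier in the same list have the same key as
        \<open>w\<close>, so the order inside a list is immaterial.\<close>
      show "key (port \<omega> y) \<le> key w" if "y \<in> ?X" for y
      proof (cases "y \<in> X")
        case False
        then have "y \<in> set xs" using that yz(1) by auto
        then show ?thesis using xs(3) by (simp add: w_def)
      qed (use before(1) in \<open>simp add: key_def w_def\<close>)
      show "y \<in> ?X" if "y < 2 * h * n" "key (port \<omega> y) < key w" for y
        using before(2) that by (simp add: key_def w_def)
    qed
    then have ex: "\<exists>ys zs. xs = ys @ zs \<and> linked (iarr (step W ?P s') ''next'') (ivar (step W ?P s') ''j'') zs
      \<and> counted \<omega> key \<beta> (X \<union> set ys) (step W ?P s') \<and> length zs' * 50 = length zs * 50"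
      using yz(1) zs j(2) nx by (intro exI[of _ "ys @ [x]"] exI[of _ zs']) (simp del: step.simps)
    have J: "runs W ?P s' 41 (\<lambda>s''. \<exists>ys zs. xs = ys @ zs \<and> linked (iarr s'' ''next'') (ivar s'' ''j'') zs
      \<and> counted \<omega> key \<beta> (X \<union> set ys) s'' \<and> length zs' * 50 = length zs * 50)"
    proof (rule runs_straight)
      show "straight ?P" by simp
      show "max_cost ?P \<le> 41" by simp
    qed (rule ex)
    from runs_frame[OF J] have "runs W ?P s' 41 (\<lambda>s''. \<exists>c'. ?I c' s'' \<and> 41 + bcost ?b + 1 + c' \<le> c)"
      unfolding m
    proof (rule runs_mono)
      fix s'' :: state
      assume a: "(\<exists>ys zs. xs = ys @ zs \<and> linked (iarr s'' ''next'') (ivar s'' ''j'') zs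
        \<and> counted \<omega> key \<beta> (X \<union> set ys) s'' \<and> length zs' * 50 = length zs * 50) \<and> frame ?Y s' s''"
      have "frame ?Y s s''" using frame_trans[OF fr conjunct2[OF a]] by simp
      then show "\<exists>c'. ?I c' s'' \<and> 41 + bcost ?b + 1 + c' \<le> c"
        using a yz(4) zs by (intro exI[of _ "length zs' * 50"]) auto
    qed simp
    then show "\<exists>T. runs W ?P s' T (\<lambda>s''. \<exists>c'. ?I c' s'' \<and> T + bcost ?b + 1 + c' \<le> c)" by blast
  qed
  then show ?thesis
  proof (rule runs_mono)
    fix s' assume a: "(\<exists>c. ?I c s') \<and> \<not> bval W ?b s'"
    then obtain ys zs where "xs = ys @ zs" "linked (iarr s' ''next'') (ivar s' ''j'') zs"
      "counted \<omega> key \<beta> (X \<union> set ys) s'" by blast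
    moreover from this have "zs = []" using a by (cases zs) auto
    ultimately show "counted \<omega> (rarr s ''key'') (rvar s ''beta'') (X \<union> set xs) s' \<and> frame ?Y s s'"
      using a by (auto simp: key_def \<beta>_def)
  qed simp
qed

end

context sketch_mode
begin

text \<open>Selection sort with a tournament: after \<open>c\<close> rounds exactly \<open>c\<close>
  ports are dead, no key among them exceeds a living one, and the visited pairs are those of the
  dead ports. The climb costs \<open>O(h)\<close> per round, but a list may be long; only the total
  length \<open>2 * h * n\<close> of all lists is controlled, hence the amortized loop rule.\<close>

lemma runs_sweep:
  assumes e: "env \<omega> s"
    and lnk: "\<And>g. linked (iarr s ''next'') (iarr s ''head'' g) (members \<omega> (2 * h * n) g)"
    and leaves: "\<forall>g < 256 * k * h. iarr s ''tree'' (256 * k * h + g) = g"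
    and ok: "\<forall>q. 1 \<le> q \<and> q < 256 * k * h \<longrightarrow> ok_at s q"
    and zero: "iarr s ''dead'' = (\<lambda>_. 0)" "iarr s ''cnt'' = (\<lambda>_. 0)"
  shows "runs W sweep s (256 * k * h * (60 * h + 37) + 50 * (2 * h * n) + 7)
    (\<lambda>s'. \<forall>i<n. settled \<omega> (rarr s ''key'') (rvar s ''beta'') i (rarr s' ''out'' i))"
proof -
  define N where "N = 256 * k * h"
  define M where "M = 2 * h * n"
  define key where "key = rarr s ''key''"
  define \<beta> where "\<beta> = rvar s ''beta''"
  have "1 \<le> N" using k h_ge by (simp add: N_def)
  moreover have "N \<le> n" using mode by (simp add: N_def)
  ultimately have N: "1 \<le> N" "N \<le> n" "N + N < W" using bounds(4) by linarith+
  let ?V = "Seq (IStore ''dead'' (IVar ''w'') (IConst 1))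
    (Seq (IAssign ''q'' (IDiv (IAdd (IVar ''N'') (IVar ''w'')) (IConst 2))) climb)"
  let ?P = "Seq (IAssign ''w'' (IArr ''tree'' (IConst 1))) (Seq (IAssign ''j'' (IArr ''head'' (IVar ''w''))) (Seq visit_members ?V))"
  let ?X = "{''t'', ''w'', ''j'', ''i'', ''cnt'', ''out'', ''dead'', ''q'', ''l'', ''r'', ''tree''}"
  define D where "D s' = {g. g < N \<and> dead_of s' g}" for s' :: state
  define C where "C s' = {j. j < M \<and> dead_of s' (port \<omega> j)}" for s' :: state
  let ?I = "\<lambda>c s'. card (D s') = c \<and> (\<forall>g < N. iarr s' ''tree'' (N + g) = g) \<and> (\<forall>q. 1 \<le> q \<and> q < N \<longrightarrow> ok_at s' q)
    \<and> (\<forall>a b. a < N \<and> b < N \<and> dead_of s' a \<and> \<not> dead_of s' b \<longrightarrow> key a \<le> key b)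
    \<and> counted \<omega> key \<beta> (C s') s'"
  \<comment> \<open>A pair is visited once, in the round in which its port dies, and pays 50 for
    this.\<close>
  let ?\<Psi> = "\<lambda>s' :: state. 50 * card {j. j < M \<and> \<not> dead_of s' (port \<omega> j)}"
  have m: "insert ''t'' (mods ?P) = ?X" by (auto simp: visit_members_def climb_def)
  have "runs W sweep s (N * ((60 * h + 28) + 9) + ?\<Psi> s + 7) (\<lambda>s'. ?I N s' \<and> frame (insert ''t'' (mods ?P)) s s')"
    unfolding sweep_def
  proof (rule runs_For_amortized[where I = ?I])
    show "?I 0 s" using zero leaves ok n h_ge by (auto simp: D_def C_def N_def counted_def)
  next
    fix c s' assume c: "c < N" and "frame (insert ''t'' (mods ?P)) s s'" and I: "?I c s'"
    then have fr: "frame ?X s s'" unfolding m by blast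
    have e': "env \<omega> s'" using env_frame[OF e fr] by simp
    have o: "rarr s' ''key'' = key" "rvar s' ''beta'' = \<beta>" "iarr s' ''next'' = iarr s ''next''" "iarr s' ''head'' = iarr s ''head''"
      using frameD[OF fr] by (simp_all add: key_def \<beta>_def)
    define w where "w = iarr s' ''tree'' 1"
    have ok': "node_ok (dead_of s') key (iarr s' ''tree'') q" if "1 \<le> q" "q < N" for q
      using I that by (simp add: o)
    have lv: "iarr s' ''tree'' (N + g) = g" if "g < N" for g using I that by blast
    have w: "w < N" using node_player[of N "iarr s' ''tree''" 1] ok' lv N(1) by (auto simp: w_def node_ok_def)
    have beats: "beats (dead_of s') key w g" if "g < N" for g
      using root_beats_all[of N "dead_of s'" key "iarr s' ''tree''" "N + g"] ok' lv[OF that] N(1) that by (simp add: w_def)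
    \<comment> \<open>Fewer than \<open>N\<close> players are dead, so a living one exists, and the
      root, which beats it, must be alive too.\<close>
    obtain g where g: "g < N" "\<not> dead_of s' g"
    proof -
      have "D s' \<noteq> {..<N}" using I c by auto
      then show ?thesis using that by (auto simp: D_def)
    qed
    have alive: "\<not> dead_of s' w" using beats[OF g(1)] g(2) by (auto simp: beats_def)
    have least: "key w \<le> key b" if "b < N" "\<not> dead_of s' b" for b using beats[OF that(1)] that(2) by (auto simp: beats_def)
    define xs where "xs = members \<omega> M w"
    have set_xs: "set xs = {i. i < M \<and> port \<omega> i = w}" by (simp add: xs_def set_members)
    have port: "port \<omega> i < N" if "i < M" for i using port_less that by (simp add: M_def N_def)
    let ?s1 = "s'\<lparr>ivar := (ivar s')(''w'' := w)\<rparr>"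
    let ?s2 = "s'\<lparr>ivar := (ivar s')(''w'' := w, ''j'' := iarr s ''head'' w)\<rparr>"
    have visit: "runs W visit_members ?s2 (length xs * 50 + 4)
      (\<lambda>s3. counted \<omega> key \<beta> (C s' \<union> set xs) s3 \<and> frame {''i'', ''j'', ''cnt'', ''out''} ?s2 s3)"
    proof -
      have "runs W visit_members ?s2 (length xs * 50 + 4)
        (\<lambda>s3. counted \<omega> (rarr ?s2 ''key'') (rvar ?s2 ''beta'') (C s' \<union> set xs) s3 \<and> frame {''i'', ''j'', ''cnt'', ''out''} ?s2 s3)"
      proof (rule runs_visit_members)
        show "env \<omega> ?s2" using e' by (simp add: env_def)
        show "linked (iarr ?s2 ''next'') (ivar ?s2 ''j'') xs" using lnk by (simp add: o xs_def M_def)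
        show "distinct xs" by (simp add: xs_def distinct_members)
        show "set xs \<subseteq> {..<2 * h * n}" "\<And>x. x \<in> set xs \<Longrightarrow> port \<omega> x = ivar ?s2 ''w''"
          by (auto simp: set_xs M_def)
        show "C s' \<subseteq> {..<2 * h * n}" "C s' \<inter> set xs = {}" using alive by (auto simp: C_def M_def set_xs)
        show "rarr ?s2 ''key'' (port \<omega> y) \<le> rarr ?s2 ''key'' (ivar ?s2 ''w'')" if "y \<in> C s'" for y
          using I that port w alive by (simp add: C_def o)
        show "y \<in> C s'" if "y < 2 * h * n" "rarr ?s2 ''key'' (port \<omega> y) < rarr ?s2 ''key'' (ivar ?s2 ''w'')" for y
          using least[of "port \<omega> y"] that port[of y] by (auto simp: C_def o M_def)
        show "counted \<omega> (rarr ?s2 ''key'') (rvar ?s2 ''beta'') (C s') ?s2" using I by (simp add: counted_def o)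
      qed
      then show ?thesis by (simp add: o)
    qed
    have potential: "?\<Psi> s' = 50 * length xs + 50 * card {j. j < M \<and> \<not> dead_of s' (port \<omega> j) \<and> port \<omega> j \<noteq> w}"
    proof -
      have split: "{j. j < M \<and> \<not> dead_of s' (port \<omega> j)} = set xs \<union> {j. j < M \<and> \<not> dead_of s' (port \<omega> j) \<and> port \<omega> j \<noteq> w}"
        using alive by (auto simp: set_xs)
      have "card (set xs \<union> {j. j < M \<and> \<not> dead_of s' (port \<omega> j) \<and> port \<omega> j \<noteq> w})
          = card (set xs) + card {j. j < M \<and> \<not> dead_of s' (port \<omega> j) \<and> port \<omega> j \<noteq> w}"
        by (intro card_Un_disjoint) (auto simp: set_xs)
      moreover have "card (set xs) = length xs" unfolding xs_def by (rule distinct_card[OF distinct_members])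
      ultimately show ?thesis unfolding split by simp
    qed
    let ?Q = "\<lambda>s''. ?I (Suc c) s'' \<and> (60 * h + 28 + 50 * length xs) + ?\<Psi> s'' \<le> (60 * h + 28) + ?\<Psi> s'"
    have tail: "runs W ?V s3 (1 + 3 + (1 + 6 + (h * 60 + 4))) ?Q"
      if cnt: "counted \<omega> key \<beta> (C s' \<union> set xs) s3" and fr3: "frame {''i'', ''j'', ''cnt'', ''out''} ?s2 s3" for s3
    proof -
      have o3: "ivar s3 ''w'' = w" "ivar s3 ''N'' = N" "iarr s3 ''dead'' = iarr s' ''dead''" "iarr s3 ''tree'' = iarr s' ''tree''" "rarr s3 ''key'' = key"
        using frameD[OF fr3] e' by (simp_all add: o env_def N_def)
      let ?s4 = "s3\<lparr>iarr := (iarr s3)(''dead'' := (iarr s' ''dead'')(w := 1))\<rparr>"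
      let ?s5 = "?s4\<lparr>ivar := (ivar s3)(''q'' := (N + w) div 2)\<rparr>"
      have dead5: "dead_of ?s5 = (dead_of s')(w := True)" by (rule ext) simp
      have q: "(N + w) div 2 < N" "N + w < W" "W \<noteq> Suc 0" "2 mod W = 2" using w N bounds by auto
      have climb: "runs W climb ?s5 (h * 60 + 4) (\<lambda>s6. ((\<forall>g < N. iarr s6 ''tree'' (N + g) = g)
        \<and> (\<forall>q. 1 \<le> q \<and> q < N \<longrightarrow> ok_at s6 q)) \<and> frame {''q'', ''l'', ''r'', ''tree''} ?s5 s6)"
      proof (rule runs_climb[folded N_def])
        show "\<forall>g<N. iarr ?s5 ''tree'' (N + g) = g" using lv by (simp add: o3)
        show "ivar ?s5 ''q'' < 2 ^ h" "ivar ?s5 ''q'' < N" using q N n_less_pow by simp_all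
        fix q assume "1 \<le> q" "q < N"
        then show "ok_at ?s5 q \<or> (\<exists>e. q = ivar ?s5 ''q'' div 2 ^ e)"
          unfolding dead5 using kill_winner[of N "dead_of s'" key "iarr s' ''tree''" q w] ok' lv
          by (simp add: o3)
      qed
      show ?thesis
      proof (rule runs_Seq)
        show "runs W (IStore ''dead'' (IVar ''w'') (IConst 1)) s3 3 (\<lambda>s4. s4 = ?s4)"
          by (rule runs_straight) (simp_all add: o3 q)
        fix s4 assume s4: "s4 = ?s4"
        show "runs W (Seq (IAssign ''q'' (IDiv (IAdd (IVar ''N'') (IVar ''w'')) (IConst 2))) climb) s4 (1 + 6 + (h * 60 + 4)) ?Q"
        proof (rule runs_Seq)
          show "runs W (IAssign ''q'' (IDiv (IAdd (IVar ''N'') (IVar ''w'')) (IConst 2))) s4 6 (\<lambda>s5. s5 = ?s5)"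
            unfolding s4 by (rule runs_straight) (simp_all add: o3 q)
          fix s5 assume s5: "s5 = ?s5"
          show "runs W climb s5 (h * 60 + 4) ?Q"
            unfolding s5
          proof (rule runs_mono[OF climb])
            fix s6 assume s6: "((\<forall>g < N. iarr s6 ''tree'' (N + g) = g)
              \<and> (\<forall>q. 1 \<le> q \<and> q < N \<longrightarrow> ok_at s6 q)) \<and> frame {''q'', ''l'', ''r'', ''tree''} ?s5 s6"
            have o6: "iarr s6 ''cnt'' = iarr s3 ''cnt''" "rarr s6 ''out'' = rarr s3 ''out''"
              and dead6: "iarr s6 ''dead'' = (iarr s' ''dead'')(w := 1)"
              using frameD[OF conjunct2[OF s6]] by simp_all
            have "D s6 = insert w (D s')" using w by (auto simp: D_def dead6)
            moreover have "w \<notin> D s'" "finite (D s')" using alive by (auto simp: D_def)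
            ultimately have 1: "card (D s6) = Suc c" using I by simp
            have 2: "key a \<le> key b" if "a < N" "b < N" "dead_of s6 a" "\<not> dead_of s6 b" for a b
              using that I least by (auto simp: dead6 split: if_splits)
            have "C s6 = C s' \<union> set xs" by (auto simp: C_def dead6 set_xs)
            then have 3: "counted \<omega> key \<beta> (C s6) s6" using cnt by (simp add: counted_def o6)
            have "{j. j < M \<and> \<not> dead_of s6 (port \<omega> j)} = {j. j < M \<and> \<not> dead_of s' (port \<omega> j) \<and> port \<omega> j \<noteq> w}"
              unfolding dead6 by auto
            then have 4: "?\<Psi> s' = 50 * length xs + ?\<Psi> s6" unfolding potential by simp
            show "?Q s6" using s6 1 2 3 4 by auto
          qed simp
        qed
      qed
    qed
    have run: "runs W ?P s' (1 + 3 + (1 + 3 + (1 + (length xs * 50 + 4) + (1 + 3 + (1 + 6 + (h * 60 + 4)))))) ?Q"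
    proof (rule runs_Seq)
      show "runs W (IAssign ''w'' (IArr ''tree'' (IConst 1))) s' 3 (\<lambda>s1. s1 = ?s1)"
        by (rule runs_straight) (use one_less_W in \<open>simp_all add: w_def\<close>)
      fix s1 assume s1: "s1 = ?s1"
      show "runs W (Seq (IAssign ''j'' (IArr ''head'' (IVar ''w''))) (Seq visit_members ?V)) s1
        (1 + 3 + (1 + (length xs * 50 + 4) + (1 + 3 + (1 + 6 + (h * 60 + 4))))) ?Q"
      proof (rule runs_Seq)
        show "runs W (IAssign ''j'' (IArr ''head'' (IVar ''w''))) s1 3 (\<lambda>s2. s2 = ?s2)"
          unfolding s1 by (rule runs_straight) (simp_all add: o)
        fix s2 assume s2: "s2 = ?s2"
        show "runs W (Seq visit_members ?V) s2 (1 + (length xs * 50 + 4) + (1 + 3 + (1 + 6 + (h * 60 + 4)))) ?Q"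
          unfolding s2 by (rule runs_Seq[OF visit]) (use tail in blast)
      qed
    qed
    have T: "1 + 3 + (1 + 3 + (1 + (length xs * 50 + 4) + (1 + 3 + (1 + 6 + (h * 60 + 4))))) = 60 * h + 28 + 50 * length xs"
      by simp
    show "\<exists>T'. runs W ?P s' T' (\<lambda>s''. ?I (Suc c) s'' \<and> T' + ?\<Psi> s'' \<le> (60 * h + 28) + ?\<Psi> s')"
      by (rule exI[of _ "60 * h + 28 + 50 * length xs"], rule run[unfolded T])
  qed (use e bounds(1) n in \<open>auto simp: env_def N_def visit_members_def climb_def D_def C_def counted_def\<close>)
  then show ?thesis
  proof (rule runs_mono)
    have "?\<Psi> s \<le> 50 * card {..<M}" by (intro mult_left_mono card_mono) auto
    moreover have "50 * card {..<M} = 50 * (2 * h * n)" by (simp add: M_def)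
    moreover have "N * ((60 * h + 28) + 9) = 256 * k * h * (60 * h + 37)" unfolding N_def by simp
    ultimately show "N * ((60 * h + 28) + 9) + ?\<Psi> s + 7 \<le> 256 * k * h * (60 * h + 37) + 50 * (2 * h * n) + 7"
      by linarith
    fix s' :: state assume I: "?I N s' \<and> frame (insert ''t'' (mods ?P)) s s'"
    \<comment> \<open>After \<open>N\<close> rounds all ports are dead, hence all pairs have been
      counted.\<close>
    have "D s' \<subseteq> {..<N}" "card (D s') = card {..<N}" using I by (auto simp: D_def)
    then have "D s' = {..<N}" by (intro card_subset_eq) auto
    then have "dead_of s' (port \<omega> j)" if "j < M" for j
      using port_less[of j \<omega>] that by (auto simp: D_def N_def M_def)
    then have C: "C s' = {..<M}" by (auto simp: C_def)
    show "\<forall>i<n. settled \<omega> (rarr s ''key'') (rvar s ''beta'') i (rarr s' ''out'' i)"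
    proof (intro allI impI)
      fix i assume i: "i < n"
      have "h \<le> card {x \<in> C s'. x mod n = i}"
      proof -
        \<comment> \<open>Of the \<open>2 * h\<close> visited pairs of coordinate \<open>i\<close>,
          those in the first \<open>h\<close> rows already carry its counter to
          \<open>h\<close>.\<close>
        have "(\<lambda>r. r * n + i) ` {..<h} \<subseteq> {x \<in> C s'. x mod n = i}"
        proof
          fix x assume "x \<in> (\<lambda>r. r * n + i) ` {..<h}"
          then obtain r where r: "r < h" "x = r * n + i" by auto
          have "Suc r * n \<le> h * n" using r by (intro mult_right_mono) auto
          then have "x < M" using r i by (simp add: M_def)
          then show "x \<in> {x \<in> C s'. x mod n = i}" using r i C by simp
        qed
        then have "card ((\<lambda>r. r * n + i) ` {..<h}) \<le> card {x \<in> C s'. x mod n = i}"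
          using C by (intro card_mono) auto
        moreover have "inj_on (\<lambda>r. r * n + i) {..<h}" using n by (auto simp: inj_on_def)
        ultimately show ?thesis by (simp add: card_image)
      qed
      then show "settled \<omega> (rarr s ''key'') (rvar s ''beta'') i (rarr s' ''out'' i)"
        using I i by (simp add: counted_def key_def \<beta>_def)
    qed
  qed
qed

lemma runs_recover:
  assumes "ivar s ''n'' = n" "ivar s ''k'' = k" "iarr s ''rand'' = \<omega>"
    and zero: "iarr s ''head'' = (\<lambda>_. 0)" "iarr s ''dead'' = (\<lambda>_. 0)" "iarr s ''cnt'' = (\<lambda>_. 0)"
  shows "runs W recover_prog s (1000 * (h * n)) (\<lambda>s'. \<exists>\<beta>.
    is_med h {..<2 * h} (\<lambda>t. rarr s ''in'' (128 * k * h + t)) \<beta> \<and>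
    (\<forall>i<n. is_med h {j. j < 2 * h * n \<and> j mod n = i} (\<lambda>j. sign_of (\<omega> j) *
      (rarr s ''in'' (cell n (64 * k) \<omega> j) - \<beta> * cell_sum (2 * h * n) n (64 * k) \<omega> (\<lambda>_. 1) (cell n (64 * k) \<omega> j)))
      (rarr s' ''out'' i - \<beta>)))" (is "runs _ _ _ _ ?Q")
proof -
  define y where "y = rarr s ''in''"
  let ?T1 = "2 * h * (2 * h * 50 + 50) + 7"
  let ?T2 = "2 * h * n * 80 + 7"
  let ?T3 = "128 * k * h * 40 + 7"
  let ?T4 = "256 * k * h * 14 + 7"
  let ?T5 = "256 * k * h * 56 + 12"
  let ?T6 = "256 * k * h * (60 * h + 37) + 50 * (2 * h * n) + 7"
  let ?T = "1 + 19 + (1 + ?T1 + (1 + ?T2 + (1 + ?T3 + (1 + ?T4 + (1 + ?T5 + ?T6)))))"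
  let ?main = "Seq set_constants (Seq find_median_sample (Seq subtract_bias
    (Seq set_keys (Seq set_leaves (Seq build_tree sweep)))))"
  have "runs W recover_prog s (1 + (16 * h + 20) + (1 + 3 + ?T)) ?Q"
    unfolding recover_prog_def
  proof (rule runs_Seq[OF runs_set_thresholds[OF assms(1,2)]])
    fix s1 :: state
    assume s1: "(ivar s1 ''L'' = h \<and> ivar s1 ''N'' = 256 * k * h) \<and> frame {''L'', ''pow'', ''N''} s s1"
    note f1 = frameD[OF conjunct2[OF s1]]
    have c: "ivar s1 ''n'' = n" "ivar s1 ''k'' = k" "ivar s1 ''L'' = h" "ivar s1 ''N'' = 256 * k * h" "iarr s1 ''rand'' = \<omega>"
      using s1 assms f1 by simp_all
    have "runs W ?main s1 ?T ?Q"
    proof (rule runs_Seq[OF runs_set_constants[OF c]])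
      fix s2 assume s2: "env \<omega> s2 \<and> frame {''d'', ''B'', ''DB'', ''M''} s1 s2"
      note f2 = frameD[OF conjunct2[OF s2]] and e2 = conjunct1[OF s2]
      show "runs W (Seq find_median_sample (Seq subtract_bias (Seq set_keys (Seq set_leaves (Seq build_tree sweep))))) s2
        (1 + ?T1 + (1 + ?T2 + (1 + ?T3 + (1 + ?T4 + (1 + ?T5 + ?T6))))) ?Q"
      proof (rule runs_Seq[OF runs_find_median_sample[OF e2]])
        fix s3
        assume s3: "is_med h {..<2 * h} (\<lambda>t. rarr s2 ''in'' (128 * k * h + t)) (rvar s3 ''beta'')
          \<and> frame {''t'', ''v'', ''c1'', ''c2'', ''u'', ''beta''} s2 s3"
        note f3 = frameD[OF conjunct2[OF s3]]
        have e3: "env \<omega> s3" by (rule env_frame[OF e2 conjunct2[OF s3]]) simp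
        have h3: "iarr s3 ''head'' = (\<lambda>_. 0)" using zero f1 f2 f3 by simp
        define \<beta> where "\<beta> = rvar s3 ''beta''"
        have in3: "rarr s2 ''in'' = y" "rarr s3 ''in'' = y" using f1 f2 f3 by (simp_all add: y_def)
        have med: "is_med h {..<2 * h} (\<lambda>t. y (128 * k * h + t)) \<beta>" using s3 by (simp add: in3 \<beta>_def)
        show "runs W (Seq subtract_bias (Seq set_keys (Seq set_leaves (Seq build_tree sweep)))) s3
          (1 + ?T2 + (1 + ?T3 + (1 + ?T4 + (1 + ?T5 + ?T6)))) ?Q"
        proof (rule runs_Seq[OF runs_subtract_bias[OF e3 h3]])
          fix s4
          assume s4: "(rarr s4 ''in'' = (\<lambda>a. rarr s3 ''in'' a - rvar s3 ''beta'' * cell_sum (2 * h * n) n (64 * k) \<omega> (\<lambda>_. 1) a)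
            \<and> (\<forall>g. linked (iarr s4 ''next'') (iarr s4 ''head'' g) (members \<omega> (2 * h * n) g)))
            \<and> frame {''j'', ''w'', ''e'', ''g'', ''in'', ''next'', ''head''} s3 s4"
          note f4 = frameD[OF conjunct2[OF s4]]
          have e4: "env \<omega> s4" by (rule env_frame[OF e3 conjunct2[OF s4]]) simp
          show "runs W (Seq set_keys (Seq set_leaves (Seq build_tree sweep))) s4
            (1 + ?T3 + (1 + ?T4 + (1 + ?T5 + ?T6))) ?Q"
          proof (rule runs_Seq[OF runs_set_keys[OF e4]])
            fix s5
            assume s5: "(\<forall>a < 128 * k * h. rarr s5 ''key'' (2 * a) = rarr s4 ''in'' a \<and> rarr s5 ''key'' (2 * a + 1) = - rarr s4 ''in'' a)
              \<and> frame {''e'', ''key''} s4 s5"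
            note f5 = frameD[OF conjunct2[OF s5]]
            have e5: "env \<omega> s5" by (rule env_frame[OF e4 conjunct2[OF s5]]) simp
            define key where "key = rarr s5 ''key''"
            have key: "key (port \<omega> j) = sign_of (\<omega> j) * (y (cell n (64 * k) \<omega> j)
                - \<beta> * cell_sum (2 * h * n) n (64 * k) \<omega> (\<lambda>_. 1) (cell n (64 * k) \<omega> j))"
              if "j < 2 * h * n" for j
            proof -
              have "rarr s4 ''in'' (cell n (64 * k) \<omega> j) = y (cell n (64 * k) \<omega> j)
                - \<beta> * cell_sum (2 * h * n) n (64 * k) \<omega> (\<lambda>_. 1) (cell n (64 * k) \<omega> j)"
                using s4 by (simp add: in3 \<beta>_def)
              moreover have "key (port \<omega> j) = sign_of (\<omega> j) * rarr s4 ''in'' (cell n (64 * k) \<omega> j)"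
                using s5 cell_less[OF that, of \<omega>] by (simp add: key_def port_def sign_of_def)
              ultimately show ?thesis by simp
            qed
            show "runs W (Seq set_leaves (Seq build_tree sweep)) s5 (1 + ?T4 + (1 + ?T5 + ?T6)) ?Q"
            proof (rule runs_Seq[OF runs_set_leaves[OF e5]])
              fix s6
              assume s6: "(\<forall>g < 256 * k * h. iarr s6 ''tree'' (256 * k * h + g) = g) \<and> frame {''g'', ''tree''} s5 s6"
              note f6 = frameD[OF conjunct2[OF s6]]
              have e6: "env \<omega> s6" by (rule env_frame[OF e5 conjunct2[OF s6]]) simp
              show "runs W (Seq build_tree sweep) s6 (1 + ?T5 + ?T6) ?Q"
              proof (rule runs_Seq[OF runs_build_tree[OF e6 conjunct1[OF s6]]])
                fix s7
                assume s7: "(\<forall>g < 256 * k * h. iarr s7 ''tree'' (256 * k * h + g) = g) \<and> (\<forall>q. 1 \<le> q \<and> q < 256 * k * h \<longrightarrow> ok_at s7 q)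
                  \<and> frame {''N1'', ''u'', ''q'', ''l'', ''r'', ''tree''} s6 s7"
                note fr7 = conjunct2[OF conjunct2[OF s7]]
                note f7 = frameD[OF fr7]
                have e7: "env \<omega> s7" by (rule env_frame[OF e6 fr7]) simp
                have z7: "iarr s7 ''dead'' = (\<lambda>_. 0)" "iarr s7 ''cnt'' = (\<lambda>_. 0)"
                  using zero f1 f2 f3 f4 f5 f6 f7 by simp_all
                have o7: "rarr s7 ''key'' = key" "rvar s7 ''beta'' = \<beta>" "iarr s7 ''next'' = iarr s4 ''next''" "iarr s7 ''head'' = iarr s4 ''head''"
                  using f4 f5 f6 f7 by (simp_all add: key_def \<beta>_def)
                have "runs W sweep s7 ?T6 (\<lambda>s'. \<forall>i<n. settled \<omega> (rarr s7 ''key'') (rvar s7 ''beta'') i (rarr s' ''out'' i))"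
                  by (rule runs_sweep[OF e7 _ conjunct1[OF s7] conjunct1[OF conjunct2[OF s7]] z7]) (use s4 in \<open>simp add: o7\<close>)
                then show "runs W sweep s7 ?T6 ?Q"
                proof (rule runs_mono)
                  fix s' :: state assume set: "\<forall>i<n. settled \<omega> (rarr s7 ''key'') (rvar s7 ''beta'') i (rarr s' ''out'' i)"
                  have "is_med h {j. j < 2 * h * n \<and> j mod n = i} (\<lambda>j. sign_of (\<omega> j) *
                      (y (cell n (64 * k) \<omega> j) - \<beta> * cell_sum (2 * h * n) n (64 * k) \<omega> (\<lambda>_. 1) (cell n (64 * k) \<omega> j)))
                      (rarr s' ''out'' i - \<beta>)" if i: "i < n" for i
                  proof -
                    have "settled \<omega> key \<beta> i (rarr s' ''out'' i)" using set i by (simp add: o7)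
                    then have "is_med h {j. j < 2 * h * n \<and> j mod n = i} (\<lambda>j. key (port \<omega> j)) (rarr s' ''out'' i - \<beta>)"
                      by (auto simp: settled_def)
                    then show ?thesis by (simp add: is_med_def key cong: conj_cong)
                  qed
                  then show "?Q s'" using med unfolding y_def by blast
                qed simp
              qed
            qed
          qed
        qed
      qed
    qed
    then show "runs W (Cond (ILess (IVar ''n'') (IVar ''N'')) copy_input ?main) s1 (1 + 3 + ?T) ?Q"
      using runs_Cond[of W "ILess (IVar ''n'') (IVar ''N'')" s1 copy_input ?T ?Q ?main] c mode by simp
  qed
  then show ?thesis
  proof (rule runs_mono)
    have "1 * h \<le> 256 * k * h" using k by (intro mult_right_mono) auto
    then have "h \<le> n" using mode by linarith
    then have hh: "h * h \<le> h * n" by (rule mult_left_mono) simp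
    \<comment> \<open>The cost of sorting: one climb of length \<open>O(h)\<close> per signed
      bucket. That there are at most \<open>n\<close> of them turns this into
      \<open>O(h * n)\<close>.\<close>
    have "256 * k * h * (60 * h + 37) \<le> n * (60 * h + 37)" using mode by (rule mult_right_mono) simp
    then have T6: "256 * k * h * (60 * h + 37) \<le> 60 * (h * n) + 37 * n" by (simp add: algebra_simps)
    have hn: "h \<le> h * n" "2 * n \<le> h * n" "4 \<le> h * n" using n h_ge mult_mono[OF h_ge n] by simp_all
    have "2 * h * (2 * h * 50 + 50) = 200 * (h * h) + 100 * h" "2 * h * n * 80 = 160 * (h * n)" "50 * (2 * h * n) = 100 * (h * n)"
      by (simp_all add: algebra_simps)
    then show "1 + (16 * h + 20) + (1 + 3 + ?T) \<le> 1000 * (h * n)" using hh T6 hn mode by linarith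
  qed
qed

end

lemma (in sketch_params) runs_recover_copy:
  assumes "n < 256 * k * h" "ivar s ''n'' = n" "ivar s ''k'' = k"
  shows "runs W recover_prog s (1000 * (h * n)) (\<lambda>s'. \<forall>i<n. rarr s' ''out'' i = rarr s ''in'' i)" (is "runs _ _ _ _ ?Q")
proof -
  have "runs W recover_prog s (1 + (16 * h + 20) + (1 + 3 + (n * 14 + 7))) ?Q"
    unfolding recover_prog_def
  proof (rule runs_Seq[OF runs_set_thresholds[OF assms(2,3)]])
    fix s1 :: state
    assume s1: "(ivar s1 ''L'' = h \<and> ivar s1 ''N'' = 256 * k * h) \<and> frame {''L'', ''pow'', ''N''} s s1"
    have c: "ivar s1 ''n'' = n" "ivar s1 ''N'' = 256 * k * h" "rarr s1 ''in'' = rarr s ''in''"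
      using s1 assms frameD[OF conjunct2[OF s1]] by simp_all
    show "runs W (Cond (ILess (IVar ''n'') (IVar ''N'')) copy_input (Seq set_constants (Seq find_median_sample
        (Seq subtract_bias (Seq set_keys (Seq set_leaves (Seq build_tree sweep))))))) s1 (1 + 3 + (n * 14 + 7)) ?Q"
      using runs_Cond[of W "ILess (IVar ''n'') (IVar ''N'')" s1 copy_input "n * 14 + 7" ?Q]
        runs_copy_input[OF c(1)] c assms(1) by simp
  qed
  moreover have "h \<le> h * n" "n \<le> h * n" "4 \<le> h * n" using n h_ge mult_mono[OF h_ge n] by simp_all
  ultimately show ?thesis by (elim runs_mono) linarith+
qed

section \<open>The sketching scheme\<close>

text \<open>The claim for one \<open>n\<close> and \<open>k\<close> with all constants filled in.
  Those for rows and time carry a factor 2 from \<open>h \<le> 2 * log 2 n\<close>. The 512 is set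
  by the identity case, where \<open>m = n < 256 * k * h\<close>; the true sketch has at most
  \<open>130 * k * h\<close> rows.\<close>

definition has_scheme :: "nat \<Rightarrow> nat \<Rightarrow> nat \<Rightarrow> bool" where
  "has_scheme W n k \<longleftrightarrow> (\<exists>(m::nat) (\<Phi> :: (nat \<Rightarrow> nat) \<Rightarrow> real mat) (\<R> :: (nat \<Rightarrow> nat) \<Rightarrow> real vec \<Rightarrow> real vec).
    real m \<le> 512 * (real k * log 2 (real n)) \<and>
    (\<forall>\<omega> \<in> set_pmf (seed_pmf W). \<Phi> \<omega> \<in> carrier_mat m n \<and> (\<forall>y \<in> carrier_vec m. \<R> \<omega> y \<in> carrier_vec n)) \<and>
    (\<forall>x \<in> carrier_vec n.
      measure_pmf.prob (seed_pmf W)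
        {\<omega>. linf_norm (\<R> \<omega> (\<Phi> \<omega> *\<^sub>v x) - x) \<le> 13 / sqrt (real k) * bias_err 2 k x}
      \<ge> 1 - 2 / real n) \<and>
    (\<forall>\<omega> \<in> set_pmf (seed_pmf W). \<forall>x \<in> carrier_vec n.
      computes_within W sketch_prog (800 * (real n * log 2 (real n))) (input_state n k \<omega> x) (\<Phi> \<omega> *\<^sub>v x)) \<and>
    (\<forall>\<omega> \<in> set_pmf (seed_pmf W). \<forall>y \<in> carrier_vec m.
      computes_within W recover_prog (2000 * (real n * log 2 (real n))) (input_state n k \<omega> y) (\<R> \<omega> y)))"

lemma computes_within_of_runs:
  assumes "runs W P s T Q" "real T \<le> B" "\<And>s'. Q s' \<Longrightarrow> \<forall>i<dim_vec v. rarr s' ''out'' i = v $ i"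
  shows "computes_within W P B s v"
  using assms unfolding runs_def computes_within_def
  by (meson of_nat_le_iff order_trans)

lemma linf_norm_le:
  assumes "0 < dim_vec x" "\<And>i. i < dim_vec x \<Longrightarrow> \<bar>x $ i\<bar> \<le> c"
  shows "linf_norm x \<le> c"
  unfolding linf_norm_def using assms by (subst Max_le_iff) (auto simp: lessThan_empty_iff)

text \<open>Since the minima are attained, the probabilistic analysis can fix an optimal outlier set
  and an optimal bias before any word is drawn.\<close>

lemma bias_err_eq_sqrt:
  "\<exists>S \<beta>. S \<subseteq> {..<dim_vec x} \<and> card S \<le> k \<and> bias_err 2 k x = sqrt (\<Sum>i\<in>{..<dim_vec x} - S. (x $ i - \<beta>)\<^sup>2)"
proof -
  obtain \<beta> where b: "bias_err 2 k x = err 2 k (shift_vec x \<beta>)" using bias_err_attained by blast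
  have d: "dim_vec (shift_vec x \<beta>) = dim_vec x" by (simp add: shift_vec_def)
  obtain S where "S \<subseteq> {..<dim_vec x}" "card S \<le> k" "err 2 k (shift_vec x \<beta>) = lp_norm 2 (zero_out S (shift_vec x \<beta>))"
    using err_attained_zero_out[of 2 "shift_vec x \<beta>" k] by (auto simp: d)
  then show ?thesis using b by (auto simp: lp_norm_2_zero_out_shift)
qed

lemma bias_err_nonneg: "0 \<le> bias_err 2 k x"
proof -
  obtain S \<beta> where "bias_err 2 k x = sqrt (\<Sum>i\<in>{..<dim_vec x} - S. (x $ i - \<beta>)\<^sup>2)"
    using bias_err_eq_sqrt by blast
  then show ?thesis by (simp add: sum_nonneg)
qed

context sketch_params
begin

text \<open>\<open>h - 1\<close> is at most the logarithm, and the missing 1 is too, because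
  \<open>n \<ge> 2\<close>.\<close>

lemma h_le_log: "real h \<le> 2 * log 2 (real n)"
proof -
  have "(2::nat) ^ (h - 1) \<le> n" using floorlog_bounds[of n 2] n by (simp add: h)
  then have "real (h - 1) \<le> log 2 (real n)" using n by (intro le_log2_of_power) auto
  moreover have "1 \<le> log 2 (real n)" using n by simp
  ultimately show ?thesis using h_ge by (simp add: of_nat_diff)
qed

lemma time_le: "real (c * (h * n)) \<le> 2 * real c * (real n * log 2 (real n))"
proof -
  have "real c * real n * real h \<le> real c * real n * (2 * log 2 (real n))"
    by (intro mult_left_mono h_le_log) simp
  then show ?thesis by (simp add: mult_ac)
qed

lemma has_scheme_identity:
  assumes "n < 256 * k * h"
  shows "has_scheme W n k"
  unfolding has_scheme_def
proof (intro exI[of _ n] exI[of _ "\<lambda>_. 1\<^sub>m n"] exI[of _ "\<lambda>_ y. y"] conjI ballI)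
  have "real n \<le> real (256 * k * h)" using assms by (intro of_nat_mono) simp
  also have "\<dots> = 256 * real k * real h" by simp
  also have "\<dots> \<le> 256 * real k * (2 * log 2 (real n))" by (intro mult_left_mono h_le_log) simp
  finally show "real n \<le> 512 * (real k * log 2 (real n))" by simp
next
  fix x :: "real vec" assume x: "x \<in> carrier_vec n"
  have "linf_norm (1\<^sub>m n *\<^sub>v x - x) \<le> 13 / sqrt (real k) * bias_err 2 k x"
    using x n bias_err_nonneg by (intro linf_norm_le) auto
  then show "1 - 2 / real n \<le> measure_pmf.prob (seed_pmf W)
      {\<omega>. linf_norm (1\<^sub>m n *\<^sub>v x - x) \<le> 13 / sqrt (real k) * bias_err 2 k x}" by simp
next
  fix \<omega> and x :: "real vec" assume x: "x \<in> carrier_vec n"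
  show "computes_within W sketch_prog (800 * (real n * log 2 (real n))) (input_state n k \<omega> x) (1\<^sub>m n *\<^sub>v x)"
    by (rule computes_within_of_runs[OF runs_sketch_copy[OF assms]])
      (use x time_le[of 400] in \<open>auto simp: input_state_def\<close>)
  show "computes_within W recover_prog (2000 * (real n * log 2 (real n))) (input_state n k \<omega> x) x"
    by (rule computes_within_of_runs[OF runs_recover_copy[OF assms]])
      (use x time_le[of 1000] in \<open>auto simp: input_state_def\<close>)
qed auto

end

context sketch_mode
begin

text \<open>For given \<open>a\<close> and \<open>i\<close> at most one \<open>j\<close>
  contributes, as the cell fixes the row. Writing the entry as a sum over \<open>j\<close> lets the
  product with \<open>x\<close> turn into \<open>cell_sum\<close> by exchanging sums.\<close>

definition sketch_mat :: "(nat \<Rightarrow> nat) \<Rightarrow> real mat" where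
  "sketch_mat \<omega> = mat (128 * k * h + 2 * h) n (\<lambda>(a, i). if a < 128 * k * h
    then (\<Sum>j<2 * h * n. if cell n (64 * k) \<omega> j = a \<and> j mod n = i then sign_of (\<omega> j) else 0)
    else if \<omega> (2 * h * n + (a - 128 * k * h)) mod n = i then 1 else 0)"

lemma sketch_mat_mult:
  assumes "x \<in> carrier_vec n" "a < 128 * k * h + 2 * h"
  shows "(sketch_mat \<omega> *\<^sub>v x) $ a = (if a < 128 * k * h then cell_sum (2 * h * n) n (64 * k) \<omega> (\<lambda>i. x $ i) a
    else x $ (\<omega> (2 * h * n + (a - 128 * k * h)) mod n))"
proof -
  have "(sketch_mat \<omega> *\<^sub>v x) $ a = (\<Sum>i<n. sketch_mat \<omega> $$ (a, i) * x $ i)"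
    using assms by (simp add: sketch_mat_def scalar_prod_def atLeast0LessThan)
  also have "\<dots> = (if a < 128 * k * h then cell_sum (2 * h * n) n (64 * k) \<omega> (\<lambda>i. x $ i) a
    else x $ (\<omega> (2 * h * n + (a - 128 * k * h)) mod n))"
  proof (cases "a < 128 * k * h")
    case True
    have "(\<Sum>i<n. sketch_mat \<omega> $$ (a, i) * x $ i)
      = (\<Sum>i<n. \<Sum>j<2 * h * n. if cell n (64 * k) \<omega> j = a \<and> j mod n = i then sign_of (\<omega> j) * x $ i else 0)"
      using assms True by (simp add: sketch_mat_def sum_distrib_right if_distrib[of "\<lambda>z. z * _"] cong: if_cong)
    also have "\<dots> = (\<Sum>j<2 * h * n. \<Sum>i<n. if cell n (64 * k) \<omega> j = a \<and> j mod n = i then sign_of (\<omega> j) * x $ i else 0)"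
      by (rule sum.swap)
    also have "\<dots> = (\<Sum>j<2 * h * n. if cell n (64 * k) \<omega> j = a then sign_of (\<omega> j) * x $ (j mod n) else 0)"
    proof (rule sum.cong)
      fix j
      have "(\<Sum>i<n. if j mod n = i then sign_of (\<omega> j) * x $ i else 0) = sign_of (\<omega> j) * x $ (j mod n)"
        using n by (subst sum.delta') auto
      then show "(\<Sum>i<n. if cell n (64 * k) \<omega> j = a \<and> j mod n = i then sign_of (\<omega> j) * x $ i else 0)
        = (if cell n (64 * k) \<omega> j = a then sign_of (\<omega> j) * x $ (j mod n) else 0)" by simp
    qed simp
    finally show ?thesis using True by (simp add: cell_sum_def)
  next
    case False
    let ?i = "\<omega> (2 * h * n + (a - 128 * k * h)) mod n"
    have "(\<Sum>i<n. sketch_mat \<omega> $$ (a, i) * x $ i) = (\<Sum>i<n. if ?i = i then x $ i else 0)"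
      using assms False by (intro sum.cong) (auto simp: sketch_mat_def)
    also have "\<dots> = x $ ?i" using n by (subst sum.delta') auto
    finally show ?thesis using False by simp
  qed
  finally show ?thesis .
qed

definition recovered :: "(nat \<Rightarrow> nat) \<Rightarrow> real vec \<Rightarrow> real vec \<Rightarrow> bool" where
  "recovered \<omega> y v \<longleftrightarrow> (\<exists>\<beta>. is_med h {..<2 * h} (\<lambda>t. y $ (128 * k * h + t)) \<beta> \<and>
    (\<forall>i<n. is_med h {j. j < 2 * h * n \<and> j mod n = i} (\<lambda>j. sign_of (\<omega> j) *
      (y $ cell n (64 * k) \<omega> j - \<beta> * cell_sum (2 * h * n) n (64 * k) \<omega> (\<lambda>_. 1) (cell n (64 * k) \<omega> j)))
      (v $ i - \<beta>)))"

text \<open>The vector is the output of the program itself. This works for every \<open>y\<close>,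
  also for those that are not sketches, as required of the recovery procedure.\<close>

lemma ex_recovered:
  assumes "y \<in> carrier_vec (128 * k * h + 2 * h)"
  shows "\<exists>v \<in> carrier_vec n. recovered \<omega> y v
    \<and> computes_within W recover_prog (2000 * (real n * log 2 (real n))) (input_state n k \<omega> y) v"
proof -
  let ?s = "input_state n k \<omega> y"
  have inp: "rarr ?s ''in'' a = y $ a" if "a < 128 * k * h + 2 * h" for a
    using that assms by (simp add: input_state_def)
  obtain t s' \<beta> where run: "exec W recover_prog ?s t s'" "t \<le> 1000 * (h * n)"
    and med: "is_med h {..<2 * h} (\<lambda>t. rarr ?s ''in'' (128 * k * h + t)) \<beta>"
    and out: "\<And>i. i < n \<Longrightarrow> is_med h {j. j < 2 * h * n \<and> j mod n = i} (\<lambda>j. sign_of (\<omega> j) *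
      (rarr ?s ''in'' (cell n (64 * k) \<omega> j) - \<beta> * cell_sum (2 * h * n) n (64 * k) \<omega> (\<lambda>_. 1) (cell n (64 * k) \<omega> j)))
      (rarr s' ''out'' i - \<beta>)"
    using runs_recover[of ?s \<omega>] unfolding runs_def by (auto simp: input_state_def)
  let ?v = "vec n (rarr s' ''out'')"
  have "recovered \<omega> y ?v"
    unfolding recovered_def
  proof (intro exI[of _ \<beta>] conjI allI impI)
    show "is_med h {..<2 * h} (\<lambda>t. y $ (128 * k * h + t)) \<beta>"
      using med by (subst is_med_cong[where g = "\<lambda>t. rarr ?s ''in'' (128 * k * h + t)"]) (auto simp: inp)
    fix i assume i: "i < n"
    have "cell n (64 * k) \<omega> j < 128 * k * h + 2 * h" if "j < 2 * h * n" for j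
      using cell_less[OF that, of \<omega>] by simp
    then show "is_med h {j. j < 2 * h * n \<and> j mod n = i} (\<lambda>j. sign_of (\<omega> j) *
      (y $ cell n (64 * k) \<omega> j - \<beta> * cell_sum (2 * h * n) n (64 * k) \<omega> (\<lambda>_. 1) (cell n (64 * k) \<omega> j)))
      (?v $ i - \<beta>)"
      using out[OF i] i
      by (subst is_med_cong[where g = "\<lambda>j. sign_of (\<omega> j) * (rarr ?s ''in'' (cell n (64 * k) \<omega> j)
        - \<beta> * cell_sum (2 * h * n) n (64 * k) \<omega> (\<lambda>_. 1) (cell n (64 * k) \<omega> j))"]) (simp_all add: inp)
  qed
  moreover have "real t \<le> real (1000 * (h * n))" using run(2) by (rule of_nat_mono)
  then have "real t \<le> 2000 * (real n * log 2 (real n))" using time_le[of 1000] by simp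
  then have "computes_within W recover_prog (2000 * (real n * log 2 (real n))) ?s ?v"
    unfolding computes_within_def using run(1) by auto
  ultimately show ?thesis by (intro bexI[of _ ?v]) auto
qed

lemma has_scheme_sketch: "has_scheme W n k"
proof -
  define m where "m = 128 * k * h + 2 * h"
  let ?good = "\<lambda>\<omega> y v. v \<in> carrier_vec n \<and> recovered \<omega> y v
    \<and> computes_within W recover_prog (2000 * (real n * log 2 (real n))) (input_state n k \<omega> y) v"
  \<comment> \<open>The recovery map is chosen, separately for each \<open>\<omega>\<close> and
    \<open>y\<close>, so that it meets the median conditions and is at the same time what the
    program computes.\<close>
  define R where "R \<omega> y = (SOME v. ?good \<omega> y v)" for \<omega> y
  have R: "?good \<omega> y (R \<omega> y)" if "y \<in> carrier_vec m" for \<omega> y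
    unfolding R_def by (rule someI_ex) (use ex_recovered that in \<open>auto simp: m_def\<close>)
  have dim: "sketch_mat \<omega> \<in> carrier_mat m n" for \<omega> by (simp add: sketch_mat_def m_def)
  show ?thesis
    unfolding has_scheme_def
  proof (intro exI[of _ m] exI[of _ sketch_mat] exI[of _ R] conjI ballI)
    have "1 * h \<le> k * h" using k by (intro mult_right_mono) auto
    then have "m \<le> 130 * (k * h)" by (simp add: m_def)
    then have "real m \<le> real (130 * (k * h))" by (rule of_nat_mono)
    also have "\<dots> = 130 * (real k * real h)" by simp
    also have "\<dots> \<le> 130 * (real k * (2 * log 2 (real n)))" by (intro mult_left_mono h_le_log) auto
    also have "\<dots> \<le> 512 * (real k * log 2 (real n))" using n by simp
    finally show "real m \<le> 512 * (real k * log 2 (real n))" .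
  next
    fix x :: "real vec" assume x: "x \<in> carrier_vec n"
    obtain S \<beta>' where S: "S \<subseteq> {..<n}" "card S \<le> k"
      and err: "bias_err 2 k x = sqrt (\<Sum>i\<in>{..<n} - S. (x $ i - \<beta>')\<^sup>2)"
      using bias_err_eq_sqrt[of x k] x by auto
    define D where "D = (\<Sum>i\<in>{..<n} - S. (x $ i - \<beta>')\<^sup>2)"
    have W2: "W = 2 * (W div 2)" using h_ge by (simp add: W)
    have b: "64 * k \<le> W div 2" "2 * h * n + 2 * h \<le> W" "n \<le> W" "n \<le> 2 ^ h" "64 * k \<le> n"
    proof -
      show "64 * k \<le> W div 2" using bounds by linarith
      have "h \<le> h * n" using n by simp
      then show "2 * h * n + 2 * h \<le> W" using bounds(3) by linarith
      show "n \<le> W" using bounds by linarith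
      show "n \<le> 2 ^ h" using n_less_pow by simp
      have "k * 1 \<le> k * h" using h_ge by (intro mult_left_mono) auto
      then show "64 * k \<le> n" using mode by linarith
    qed
    let ?good = "{\<omega>. \<forall>\<beta>. is_med h {..<2 * h} (\<lambda>t. x $ (\<omega> (2 * h * n + t) mod n)) \<beta> \<longrightarrow>
      (\<forall>i<n. \<forall>v. is_med h {j. j < 2 * h * n \<and> j mod n = i} (\<lambda>j. sign_of (\<omega> j) *
          (cell_sum (2 * h * n) n (64 * k) \<omega> (\<lambda>i. x $ i) (cell n (64 * k) \<omega> j)
            - \<beta> * cell_sum (2 * h * n) n (64 * k) \<omega> (\<lambda>_. 1) (cell n (64 * k) \<omega> j))) (v - \<beta>)
        \<longrightarrow> \<bar>v - x $ i\<bar> \<le> 13 * sqrt D / sqrt (real k))}"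
    have "1 - 2 / real n \<le> measure_pmf.prob (Pi_pmf {..<W} 0 (\<lambda>_. pmf_of_set {..<W})) ?good"
      by (rule prob_recovery_good[OF W2 b(1,2) k(1) b(5,4,3) S, where \<beta>' = \<beta>']) (simp add: D_def)
    also have "\<dots> \<le> measure_pmf.prob (seed_pmf W)
        {\<omega>. linf_norm (R \<omega> (sketch_mat \<omega> *\<^sub>v x) - x) \<le> 13 / sqrt (real k) * bias_err 2 k x}"
      unfolding seed_pmf_def
    proof (intro measure_pmf.finite_measure_mono subsetI)
      fix \<omega> assume "\<omega> \<in> ?good"
      then have close: "\<bar>v - x $ i\<bar> \<le> 13 * sqrt D / sqrt (real k)"
        if "is_med h {..<2 * h} (\<lambda>t. x $ (\<omega> (2 * h * n + t) mod n)) \<beta>" "i < n"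
          "is_med h {j. j < 2 * h * n \<and> j mod n = i} (\<lambda>j. sign_of (\<omega> j) *
          (cell_sum (2 * h * n) n (64 * k) \<omega> (\<lambda>i. x $ i) (cell n (64 * k) \<omega> j)
            - \<beta> * cell_sum (2 * h * n) n (64 * k) \<omega> (\<lambda>_. 1) (cell n (64 * k) \<omega> j))) (v - \<beta>)" for \<beta> i v
        using that by blast
      let ?y = "sketch_mat \<omega> *\<^sub>v x"
      have "?y \<in> carrier_vec m" using dim[of \<omega>] x by (rule mult_mat_vec_carrier)
      then have v: "R \<omega> ?y \<in> carrier_vec n" "recovered \<omega> ?y (R \<omega> ?y)" using R by blast+
      have y1: "?y $ (128 * k * h + t) = x $ (\<omega> (2 * h * n + t) mod n)" if "t < 2 * h" for t
        using sketch_mat_mult[OF x, of "128 * k * h + t" \<omega>] that by simp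
      have y2: "?y $ cell n (64 * k) \<omega> j = cell_sum (2 * h * n) n (64 * k) \<omega> (\<lambda>i. x $ i) (cell n (64 * k) \<omega> j)"
        if "j < 2 * h * n" for j
        using sketch_mat_mult[OF x, of "cell n (64 * k) \<omega> j" \<omega>] cell_less[OF that, of \<omega>] by simp
      obtain \<beta> where \<beta>: "is_med h {..<2 * h} (\<lambda>t. ?y $ (128 * k * h + t)) \<beta>"
        and med: "\<And>i. i < n \<Longrightarrow> is_med h {j. j < 2 * h * n \<and> j mod n = i} (\<lambda>j. sign_of (\<omega> j) *
          (?y $ cell n (64 * k) \<omega> j - \<beta> * cell_sum (2 * h * n) n (64 * k) \<omega> (\<lambda>_. 1) (cell n (64 * k) \<omega> j)))
          (R \<omega> ?y $ i - \<beta>)"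
        using v(2) unfolding recovered_def by blast
      have \<beta>': "is_med h {..<2 * h} (\<lambda>t. x $ (\<omega> (2 * h * n + t) mod n)) \<beta>"
        using \<beta> by (subst is_med_cong[where g = "\<lambda>t. ?y $ (128 * k * h + t)"]) (auto simp: y1)
      have "\<bar>R \<omega> ?y $ i - x $ i\<bar> \<le> 13 * sqrt D / sqrt (real k)" if i: "i < n" for i
        using med[OF i]
        by (intro close[OF \<beta>' i], subst is_med_cong[where g = "\<lambda>j. sign_of (\<omega> j) *
          (?y $ cell n (64 * k) \<omega> j - \<beta> * cell_sum (2 * h * n) n (64 * k) \<omega> (\<lambda>_. 1) (cell n (64 * k) \<omega> j))"])
          (simp_all add: y2)
      then have "linf_norm (R \<omega> ?y - x) \<le> 13 * sqrt D / sqrt (real k)"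
        using v(1) x n by (intro linf_norm_le) auto
      then show "\<omega> \<in> {\<omega>. linf_norm (R \<omega> (sketch_mat \<omega> *\<^sub>v x) - x) \<le> 13 / sqrt (real k) * bias_err 2 k x}"
        by (simp add: err D_def)
    qed simp
    finally show "1 - 2 / real n \<le> measure_pmf.prob (seed_pmf W)
        {\<omega>. linf_norm (R \<omega> (sketch_mat \<omega> *\<^sub>v x) - x) \<le> 13 / sqrt (real k) * bias_err 2 k x}" .
  next
    fix \<omega> and x :: "real vec" assume x: "x \<in> carrier_vec n"
    have i: "ivar (input_state n k \<omega> x) ''n'' = n" "ivar (input_state n k \<omega> x) ''k'' = k"
      "iarr (input_state n k \<omega> x) ''rand'' = \<omega>" "rarr (input_state n k \<omega> x) ''out'' = (\<lambda>_. 0)"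
      by (simp_all add: input_state_def)
    have "cell_sum (2 * h * n) n (64 * k) \<omega> (rarr (input_state n k \<omega> x) ''in'') = cell_sum (2 * h * n) n (64 * k) \<omega> (\<lambda>i. x $ i)"
      using x n by (auto simp: cell_sum_def input_state_def fun_eq_iff intro!: sum.cong)
    moreover have "rarr (input_state n k \<omega> x) ''in'' (l mod n) = x $ (l mod n)" for l
      using x n by (simp add: input_state_def)
    ultimately show "computes_within W sketch_prog (800 * (real n * log 2 (real n))) (input_state n k \<omega> x) (sketch_mat \<omega> *\<^sub>v x)"
      using time_le[of 400] sketch_mat_mult[OF x, of _ \<omega>] dim[of \<omega>]
      by (intro computes_within_of_runs[OF runs_sketch[OF i]]) (simp_all add: m_def)
  qed (simp_all add: R dim)
qed

end

theorem theorem4: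
  shows "\<exists>(C1::real) (C2::real). C1 > 0 \<and> C2 > 0 \<and>
    (\<exists>(C3::real) (C4::real) (C5::real) (c::nat) (P_sketch::com) (P_recover::com). c \<ge> 1 \<and>
      (\<forall>(n::nat) (k::nat). n \<ge> 2 \<and> 1 \<le> k \<and> k < n \<longrightarrow>
        (\<exists>(m::nat) (\<Phi> :: (nat \<Rightarrow> nat) \<Rightarrow> real mat) (\<R> :: (nat \<Rightarrow> nat) \<Rightarrow> real vec \<Rightarrow> real vec).
          real m \<le> C3 * (real k * log 2 (real n)) \<and>
          (\<forall>\<omega> \<in> set_pmf (seed_pmf (word_range c n)).
            \<Phi> \<omega> \<in> carrier_mat m n \<and> (\<forall>y \<in> carrier_vec m. \<R> \<omega> y \<in> carrier_vec n)) \<and>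
          (\<forall>x \<in> carrier_vec n.
            measure_pmf.prob (seed_pmf (word_range c n))
              {\<omega>. linf_norm (\<R> \<omega> (\<Phi> \<omega> *\<^sub>v x) - x) \<le> C1 / sqrt (real k) * bias_err 2 k x}
            \<ge> 1 - C2 / real n) \<and>
          (\<forall>\<omega> \<in> set_pmf (seed_pmf (word_range c n)). \<forall>x \<in> carrier_vec n.
            computes_within (word_range c n) P_sketch (C4 * (real n * log 2 (real n)))
              (input_state n k \<omega> x) (\<Phi> \<omega> *\<^sub>v x)) \<and>
          (\<forall>\<omega> \<in> set_pmf (seed_pmf (word_range c n)). \<forall>y \<in> carrier_vec m.
            computes_within (word_range c n) P_recover (C5 * (real n * log 2 (real n)))
              (input_state n k \<omega> y) (\<R> \<omega> y)))))"
proof -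
  have scheme: "has_scheme (word_range 8 n) n k" if nk: "2 \<le> n" "1 \<le> k" "k < n" for n k
  proof -
    interpret sketch_params n k "word_range 8 n" "floorlog 2 n"
      by standard (use nk in \<open>auto simp: word_range_def\<close>)
    show ?thesis
    proof (cases "n < 256 * k * floorlog 2 n")
      case False
      then interpret sketch_mode n k "word_range 8 n" "floorlog 2 n" by unfold_locales simp
      show ?thesis by (rule has_scheme_sketch)
    qed (rule has_scheme_identity)
  qed
  show ?thesis
    by (rule exI[of _ 13], rule exI[of _ 2], rule conjI, simp, rule conjI, simp,
        rule exI[of _ 512], rule exI[of _ 800], rule exI[of _ 2000], rule exI[of _ 8],
        rule exI[of _ sketch_prog], rule exI[of _ recover_prog], rule conjI, simp,
        intro allI impI, elim conjE, rule scheme[unfolded has_scheme_def])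
qed

end
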